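(* There is an absolute constant $C>0$ such that for every $n\ge1$ and every positive semidefinite $X\in\mathbb{R}^{n\times n}$ with unit diagonal, letting $\alpha:=C\,\alpha_{\mathrm{mag}}(1+\alpha_{\mathrm{row}}^4)(1+\alpha_{\mathrm{spec}}^2)$ and $\eta:=\frac{\alpha}{1+\alpha}$, the matrix $\mathcal{M}:=(1-\eta)\mathcal{M}^{(1)}+\eta\,\mathrm{Id}$ is positive semidefinite.
   Context: $\alpha_{\mathrm{spec}}:=\|X\|_2$, $\alpha_{\mathrm{row}}:=\max_{i}\sqrt{\sum_{j\ne i}X_{ij}^2}$, $\alpha_{\mathrm{mag}}:=\max_{i\neq j}|X_{ij}|$. Fix any $M\in\mathbb{R}^{n\times n}$ with $X=MM^{\top}$. For each $\kappa\ge n$ a power of $2$, let $H_\kappa$ be the $\kappa\times\kappa$ Sylvester Hadamard matrix normalized to be orthogonal, $H_\kappa^{\le n}$ its first $n$ rows, $M_\kappa:=MH_\kappa^{\le n}$. For $z\in\{\pm1\}^\kappa$ and $i\in[n]$ let $q_{i,\kappa}(z):=\sum_{j}M_\kappa[i,j]z_j-2\sum_{\{j_1,j_2,j_3\}\subseteq[\kappa]}M_\kappa[i,j_1]M_\kappa[i,j_2]M_\kappa[i,j_3]z_{j_1}z_{j_2}z_{j_3}$, and $q_{S,\kappa}:=\prod_{i\in S}q_{i,\kappa}$. $\mathcal{M}^{(1)}$ is indexed by subsets of $[n]$ of size at most $2$ with $\mathcal{M}^{(1)}[S,T]:=\lim_{\kappa\to\infty}\mathbb{E}_{z\sim\{\pm1\}^\kappa}[q_{S\Delta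 T,\kappa}(z)]$ (limit over powers of 2; it exists). $\mathrm{Id}$ is the identity on the same index set. *)

theory Defs
  imports
    "HOL-Probability.Probability_Mass_Function"
    "Jordan_Normal_Form.Matrix"
begin

text \<open>
  All index sets \<^term>\<open>{1..n}\<close> are shifted to \<^term>\<open>{..<n}\<close>, matching the indexing
  of the matrix library.
\<close>

definition psd_on :: "'i set \<Rightarrow> ('i \<Rightarrow> 'i \<Rightarrow> real) \<Rightarrow> bool" where
  "psd_on I A \<longleftrightarrow>
     (\<forall>i\<in>I. \<forall>j\<in>I. A i j = A j i) \<and>
     (\<forall>v. 0 \<le> (\<Sum>i\<in>I. \<Sum>j\<in>I. v i * A i j * v j))"

definition psd_mat :: "real mat \<Rightarrow> bool" where
  "psd_mat A \<longleftrightarrow> square_mat A \<and> psd_on {..<dim_row A} (\<lambda>i j. A $$ (i, j))"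

definition spectral_norm :: "real mat \<Rightarrow> real" where
  "spectral_norm A =
     (SUP v \<in> {v \<in> carrier_vec (dim_col A). scalar_prod v v = 1}.
        sqrt (scalar_prod (A *\<^sub>v v) (A *\<^sub>v v)))"

definition alpha_spec :: "real mat \<Rightarrow> real" where
  "alpha_spec X = spectral_norm X"

definition alpha_row :: "real mat \<Rightarrow> real" where
  "alpha_row X =
     Max ((\<lambda>i. sqrt (\<Sum>j\<in>{..<dim_col X} - {i}. (X $$ (i, j))\<^sup>2)) ` {..<dim_row X})"

text \<open>
  Inserting 0 does not affect the maximum of absolute values; it only fixes the value 0
  for \<open>1 \<times> 1\<close> matrices, which have no off-diagonal entries.
\<close>

definition alpha_mag :: "real mat \<Rightarrow> real" where
  "alpha_mag X =
     Max (insert 0 {\<bar>X $$ (i, j)\<bar> | i j. i < dim_row X \<and> j < dim_col X \<and> i \<noteq> j})"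

fun sylvester :: "nat \<Rightarrow> real mat" where
  "sylvester 0 = 1\<^sub>m 1"
| "sylvester (Suc k) = (let H = sylvester k in four_block_mat H H H (- H))"

text \<open>
  In everything below \<^term>\<open>k\<close> is the exponent, that is, \<open>\<kappa> = 2 ^ k\<close>.
\<close>

definition hadamard :: "nat \<Rightarrow> real mat" where
  "hadamard k = (1 / sqrt (2 ^ k)) \<cdot>\<^sub>m sylvester k"

text \<open>
  Only meaningful for \<open>n \<le> 2 ^ k\<close>. For fixed \<^term>\<open>n\<close> this excludes finitely many
  \<^term>\<open>k\<close>, which do not affect the limit defining \<open>moment_matrix\<close>.
\<close>

definition hadamard_rows :: "nat \<Rightarrow> nat \<Rightarrow> real mat" where
  "hadamard_rows n k = Matrix.mat n (2 ^ k) (\<lambda>(i, j). hadamard k $$ (i, j))"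

definition lifted :: "real mat \<Rightarrow> nat \<Rightarrow> real mat" where
  "lifted M k = M * hadamard_rows (dim_col M) k"

definition q_poly :: "real mat \<Rightarrow> nat \<Rightarrow> nat \<Rightarrow> (nat \<Rightarrow> real) \<Rightarrow> real" where
  "q_poly M k i z =
     (\<Sum>j<2 ^ k. lifted M k $$ (i, j) * z j)
     - 2 * (\<Sum>J | J \<subseteq> {..<2 ^ k} \<and> card J = 3. \<Prod>j\<in>J. lifted M k $$ (i, j) * z j)"

definition q_set :: "real mat \<Rightarrow> nat \<Rightarrow> nat set \<Rightarrow> (nat \<Rightarrow> real) \<Rightarrow> real" where
  "q_set M k S z = (\<Prod>i\<in>S. q_poly M k i z)"

definition hypercube :: "nat \<Rightarrow> (nat \<Rightarrow> real) set" where
  "hypercube d = {..<d} \<rightarrow>\<^sub>E {-1, 1}"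

definition moment_matrix :: "real mat \<Rightarrow> nat set \<Rightarrow> nat set \<Rightarrow> real" where
  "moment_matrix M S T =
     lim (\<lambda>k. measure_pmf.expectation (pmf_of_set (hypercube (2 ^ k)))
                (q_set M k (sym_diff S T)))"

definition small_subsets :: "nat \<Rightarrow> nat set set" where
  "small_subsets n = {S. S \<subseteq> {..<n} \<and> card S \<le> 2}"

end

theory Submission
  imports Defs
begin

text \<open>
  With \<open>\<eta> = \<alpha> / (1 + \<alpha>)\<close> it suffices that the moment matrix plus \<open>\<alpha>\<close> times the identity is positive
  semidefinite. As \<open>\<kappa>\<close> grows, \<open>q\<^sub>i\<close> behaves like \<open>he 1 g\<^sub>i - he 3 g\<^sub>i / 3\<close> for Gaussians \<open>g\<close> with
  covariance \<open>X\<close>, so all entries become explicit polynomials in the entries of \<open>X\<close>, computed by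
  Wick's formula. On singletons the matrix is \<open>X\<close> up to cubes of off-diagonal entries.
  On the empty set and the pairs it is the sum of a rank-one matrix, the Gram matrix of
  \<open>m\<^sub>i m\<^sub>j\<^sup>T + m\<^sub>j m\<^sub>i\<^sup>T - 2 X\<^sub>i\<^sub>j (m\<^sub>i m\<^sub>i\<^sup>T + m\<^sub>j m\<^sub>j\<^sup>T)\<close> (up to scaling, where \<open>m\<^sub>i\<close> is row \<open>i\<close> of \<open>M\<close>),
  and an error. The coefficient \<open>-2\<close> of the cubic part of \<open>q\<^sub>i\<close> is what makes all terms that are not
  small fit into this Gram matrix, including those at overlapping pairs. The remaining terms are
  bounded by Cauchy-Schwarz in terms of the spectral norm, the row norms and the largest
  off-diagonal entry.
\<close>

section \<open>Averages over the hypercube\<close>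

text \<open>The obstacle is overlap. Entries are indexed through \<open>sym_diff\<close>, which
  drops a repeated index as if q_i^2 were 1, although q_i^2 is not constant. Wick's formula
  therefore describes only the entries at disjoint pairs, and the Gram matrix has to predict the
  others as well. Replace the cubic coefficient -2 by -t, so that q_i behaves like he_1 - (t/6)
  he_3. For every t the large terms of the four-point moment complete to the Gram matrix of m_i
  m_j^T + m_j m_i^T - t X_ij (m_i m_i^T + m_j m_j^T). At the pairs {i,j} and {i,l} the true entry is
  X_jl to leading order, while the rank-one and Gram parts together predict X_jl + ((t-2)^2/2) X_ij
  X_il. Cauchy-Schwarz over rows bounds the extra term by alpha_row^2 without any factor alpha_mag,
  so it has to vanish, which forces t = 2. At disjoint pairs, absolute values would lose too much: a
  term such as X_ij^2 X_ik X_jl is linear in its connecting entries, and only the spectral norm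
  controls their contraction. Entrywise bounds serve where the connecting entries are dominated by
  products of squares.\<close>

definition cube_avg :: "nat \<Rightarrow> ((nat \<Rightarrow> real) \<Rightarrow> real) \<Rightarrow> real" where
  "cube_avg d f = (\<Sum>z\<in>hypercube d. f z) / 2 ^ d"

lemma finite_hypercube: "finite (hypercube d)"
  by (auto simp: hypercube_def intro: finite_PiE)

lemma card_hypercube: "card (hypercube d) = 2 ^ d"
  by (simp add: hypercube_def card_PiE numeral_2_eq_2)

lemma hypercube_sq: "z \<in> hypercube d \<Longrightarrow> j < d \<Longrightarrow> z j * z j = 1"
  by (force simp: hypercube_def PiE_iff)

lemma hypercube_abs: "z \<in> hypercube d \<Longrightarrow> j < d \<Longrightarrow> \<bar>z j\<bar> = 1"
  by (force simp: hypercube_def PiE_iff)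

lemma expectation_hypercube:
  "measure_pmf.expectation (pmf_of_set (hypercube d)) f = cube_avg d f"
proof -
  have "hypercube d \<noteq> {}"
    using card_hypercube[of d] by auto
  then show ?thesis
    by (simp add: integral_pmf_of_set finite_hypercube card_hypercube cube_avg_def)
qed

lemma cube_avg_add: "cube_avg d (\<lambda>z. f z + g z) = cube_avg d f + cube_avg d g"
  by (simp add: cube_avg_def sum.distrib add_divide_distrib)

lemma cube_avg_diff: "cube_avg d (\<lambda>z. f z - g z) = cube_avg d f - cube_avg d g"
  by (simp add: cube_avg_def sum_subtractf diff_divide_distrib)

lemma cube_avg_cmult: "cube_avg d (\<lambda>z. c * f z) = c * cube_avg d f"
  by (simp add: cube_avg_def sum_distrib_left)

lemma cube_avg_sum: "cube_avg d (\<lambda>z. \<Sum>i\<in>I. f i z) = (\<Sum>i\<in>I. cube_avg d (f i))"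
  by (simp add: cube_avg_def sum.swap[of _ _ I] sum_divide_distrib)

lemma cube_avg_const: "cube_avg d (\<lambda>z. c) = c"
  by (simp add: cube_avg_def card_hypercube)

lemma cube_avg_cong:
  "(\<And>z. z \<in> hypercube d \<Longrightarrow> f z = g z) \<Longrightarrow> cube_avg d f = cube_avg d g"
  by (simp add: cube_avg_def)

lemma cube_avg_mono:
  "(\<And>z. z \<in> hypercube d \<Longrightarrow> f z \<le> g z) \<Longrightarrow> cube_avg d f \<le> cube_avg d g"
  by (auto simp: cube_avg_def intro!: divide_right_mono sum_mono)

lemma cube_avg_abs_le: "\<bar>cube_avg d f\<bar> \<le> cube_avg d (\<lambda>z. \<bar>f z\<bar>)"
  by (auto simp: cube_avg_def intro!: divide_right_mono)

definition flip :: "nat \<Rightarrow> (nat \<Rightarrow> real) \<Rightarrow> nat \<Rightarrow> real" where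
  "flip j z = z(j := - z j)"

lemma cube_avg_flip:
  assumes "j < d"
  shows "cube_avg d (\<lambda>z. f (flip j z)) = cube_avg d f"
proof -
  have m: "flip j z \<in> hypercube d" if "z \<in> hypercube d" for z
    using that assms by (auto simp: hypercube_def PiE_iff flip_def extensional_def)
  have i: "flip j (flip j z) = z" for z
    by (auto simp: flip_def)
  have "(\<Sum>z\<in>hypercube d. f (flip j z)) = (\<Sum>z\<in>hypercube d. f z)"
    by (rule sum.reindex_bij_witness[of _ "flip j" "flip j"]) (auto simp: m i)
  then show ?thesis
    by (simp add: cube_avg_def)
qed

text \<open>The sign change is restricted to \<open>{..<d}\<close> because points of the hypercube
  are extensional functions; on them it is an involution.\<close>

lemma cube_avg_odd:
  assumes "\<And>z. z \<in> hypercube d \<Longrightarrow> f (\<lambda>j\<in>{..<d}. - z j) = - f z"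
  shows "cube_avg d f = 0"
proof -
  define n :: "(nat \<Rightarrow> real) \<Rightarrow> nat \<Rightarrow> real" where "n = (\<lambda>z. \<lambda>j\<in>{..<d}. - z j)"
  have m: "n z \<in> hypercube d" if "z \<in> hypercube d" for z
    using that by (auto simp: n_def hypercube_def PiE_iff)
  have i: "n (n z) = z" if "z \<in> hypercube d" for z
    using that by (auto simp: n_def hypercube_def PiE_iff extensional_def restrict_def fun_eq_iff)
  have "(\<Sum>z\<in>hypercube d. f z) = (\<Sum>z\<in>hypercube d. f (n z))"
    by (rule sum.reindex_bij_witness[of _ n n]) (auto simp: m i)
  also have "\<dots> = - (\<Sum>z\<in>hypercube d. f z)"
    by (simp add: assms n_def sum_negf)
  finally show ?thesis
    by (simp add: cube_avg_def)
qed

section \<open>Sub-Gaussian exponential moments\<close>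

lemma exp_plus_exp_minus_le: "exp x + exp (- x) \<le> 2 * exp ((x::real)\<^sup>2)"
proof -
  have pos: "exp y + exp (- y) \<le> 2 * exp (y\<^sup>2)" if "y \<ge> 0" for y :: real
  proof (cases "y \<le> 1")
    \<comment> \<open>In this range the linear terms of the two quadratic upper bounds cancel in the
      sum; in the other range \<open>y\<close> itself is at most its square.\<close>
    case True
    have 1: "exp y \<le> 1 + y + y\<^sup>2"
      using exp_bound[of y] that True by auto
    have "exp (- y) = 1 / exp y"
      by (simp add: exp_minus inverse_eq_divide)
    also have "\<dots> \<le> 1 / (1 + y)"
      using that exp_ge_add_one_self[of y] by (intro divide_left_mono) auto
    also have "\<dots> \<le> 1 - y + y\<^sup>2"
    proof -
      have "(1 - y + y\<^sup>2) * (1 + y) = 1 + y ^ 3"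
        by (simp add: algebra_simps power2_eq_square power3_eq_cube)
      then show ?thesis
        using that by (simp add: divide_le_eq)
    qed
    finally have 2: "exp (- y) \<le> 1 - y + y\<^sup>2" .
    have "1 + y\<^sup>2 \<le> exp (y\<^sup>2)"
      by (rule exp_ge_add_one_self)
    with 1 2 show ?thesis by linarith
  next
    case False
    then have "y \<le> y\<^sup>2"
      by (simp add: power2_eq_square)
    then have "exp y \<le> exp (y\<^sup>2)" "exp (- y) \<le> exp (y\<^sup>2)"
      using that by auto
    then show ?thesis by linarith
  qed
  show ?thesis
    using pos[of x] pos[of "- x"] by (cases "x \<ge> 0") (auto simp: add.commute)
qed

definition lin_form :: "nat \<Rightarrow> (nat \<Rightarrow> real) \<Rightarrow> (nat \<Rightarrow> real) \<Rightarrow> real" where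
  "lin_form d u z = (\<Sum>j<d. u j * z j)"

lemma lin_form_flip:
  assumes "j < d"
  shows "lin_form d u (flip j z) = lin_form d u z - 2 * u j * z j"
proof -
  have "lin_form d u (flip j z) = (\<Sum>i\<in>{..<d}. u i * z i - (if i = j then 2 * u j * z j else 0))"
    unfolding lin_form_def by (rule sum.cong) (auto simp: flip_def)
  also have "\<dots> = lin_form d u z - 2 * u j * z j"
    using assms by (simp add: sum_subtractf lin_form_def)
  finally show ?thesis .
qed

text \<open>The coordinates are independent, so the average of the exponential factors into
  two-point averages, one for each coordinate. The factor 1/2 of the sharp exponent is given
  away.\<close>

lemma cube_avg_exp_lin_form:
  "cube_avg d (\<lambda>z. exp (lin_form d u z)) \<le> exp (\<Sum>j<d. (u j)\<^sup>2)"
proof -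
  have "(\<Sum>z\<in>hypercube d. exp (lin_form d u z)) =
      (\<Sum>z\<in>hypercube d. \<Prod>j<d. exp (u j * z j))"
    by (simp add: lin_form_def exp_sum)
  also have "\<dots> = (\<Prod>j<d. \<Sum>y\<in>{-1, 1::real}. exp (u j * y))"
    unfolding hypercube_def by (subst prod_sum_PiE) auto
  also have "\<dots> = (\<Prod>j<d. exp (u j) + exp (- u j))"
    by (simp add: add.commute)
  also have "\<dots> \<le> (\<Prod>j<d. 2 * exp ((u j)\<^sup>2))"
    by (intro prod_mono conjI exp_plus_exp_minus_le) (simp add: add_nonneg_nonneg)
  also have "\<dots> = 2 ^ d * exp (\<Sum>j<d. (u j)\<^sup>2)"
    by (simp add: prod.distrib exp_sum)
  finally show ?thesis
    by (simp add: cube_avg_def divide_le_eq mult.commute)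
qed

section \<open>The Gaussian limit\<close>

text \<open>The envelope for all error terms: products of such weights are again of this kind, they
  dominate polynomials, and their averages stay bounded as the dimension grows. There are four slots
  because \<open>sym_diff\<close> of two sets of size at most two has at most four elements.\<close>

definition growth :: "real \<Rightarrow> (nat \<Rightarrow> real) \<Rightarrow> real" where
  "growth c x = exp (c * (\<Sum>s<4. \<bar>x s\<bar>))"

lemma growth_add: "growth (c + d) x = growth c x * growth d x"
  by (simp add: growth_def exp_add algebra_simps)

lemma growth_pos: "growth c x > 0"
  by (simp add: growth_def)

text \<open>The sum of the moduli is at most four times the largest one, and the exponential of a
  modulus is at most the sum over both signs. This leaves exponentials of single linear
  forms.\<close>

lemma growth_le:
  assumes "c \<ge> 0"
  shows "growth c x \<le> (\<Sum>s<4. exp (4 * c * x s) + exp (- (4 * c * x s)))"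
proof -
  have ne: "finite ((\<lambda>s. \<bar>x s\<bar>) ` {..<4::nat})" "(\<lambda>s. \<bar>x s\<bar>) ` {..<4::nat} \<noteq> {}"
    by (auto simp: lessThan_empty_iff)
  obtain t where t: "t < 4" "\<bar>x t\<bar> = Max ((\<lambda>s. \<bar>x s\<bar>) ` {..<4::nat})"
    using Max_in[OF ne] by auto
  have "(\<Sum>s<4. \<bar>x s\<bar>) \<le> (\<Sum>s<4::nat. \<bar>x t\<bar>)"
    by (intro sum_mono) (auto simp: t(2))
  then have "c * (\<Sum>s<4. \<bar>x s\<bar>) \<le> c * (4 * \<bar>x t\<bar>)"
    using assms by (intro mult_left_mono) auto
  then have "growth c x \<le> exp (4 * c * \<bar>x t\<bar>)"
    by (simp add: growth_def algebra_simps)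
  also have "\<dots> \<le> exp (4 * c * x t) + exp (- (4 * c * x t))"
    by (cases "x t \<ge> 0") auto
  also have "\<dots> \<le> (\<Sum>s<4. exp (4 * c * x s) + exp (- (4 * c * x s)))"
    using t(1) by (intro member_le_sum[of t "{..<4}" "\<lambda>s. exp (4 * c * x s) + exp (- (4 * c * x s))"])
      (auto intro: add_nonneg_nonneg)
  finally show ?thesis .
qed

lemma cube_avg_growth:
  assumes "c \<ge> 0" and "\<And>s. s < 4 \<Longrightarrow> (\<Sum>j<d. (u s j)\<^sup>2) \<le> 1"
  shows "cube_avg d (\<lambda>z. growth c (\<lambda>s. lin_form d (u s) z)) \<le> 8 * exp (16 * c\<^sup>2)"
proof -
  have e: "cube_avg d (\<lambda>z. exp (t * lin_form d (u s) z)) \<le> exp (t\<^sup>2)" if "s < 4" for s t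
  proof -
    have "t * lin_form d (u s) z = lin_form d (\<lambda>j. t * u s j) z" for z
      by (simp add: lin_form_def sum_distrib_left mult.assoc)
    then have "cube_avg d (\<lambda>z. exp (t * lin_form d (u s) z)) \<le> exp (\<Sum>j<d. (t * u s j)\<^sup>2)"
      using cube_avg_exp_lin_form[of d "\<lambda>j. t * u s j"] by simp
    also have "(\<Sum>j<d. (t * u s j)\<^sup>2) = t\<^sup>2 * (\<Sum>j<d. (u s j)\<^sup>2)"
      by (simp add: power_mult_distrib sum_distrib_left)
    also have "\<dots> \<le> t\<^sup>2 * 1"
      using assms(2)[OF that] by (intro mult_left_mono) auto
    finally show ?thesis by simp
  qed
  have "cube_avg d (\<lambda>z. growth c (\<lambda>s. lin_form d (u s) z)) \<le>
     cube_avg d (\<lambda>z. \<Sum>s<4. exp ((4 * c) * lin_form d (u s) z) + exp ((- 4 * c) * lin_form d (u s) z))"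
    using growth_le[OF assms(1)] by (intro cube_avg_mono) simp
  also have "\<dots> = (\<Sum>s<4. cube_avg d (\<lambda>z. exp ((4 * c) * lin_form d (u s) z)) +
       cube_avg d (\<lambda>z. exp ((- 4 * c) * lin_form d (u s) z)))"
    by (simp only: cube_avg_sum cube_avg_add)
  also have "\<dots> \<le> (\<Sum>s<4::nat. exp ((4 * c)\<^sup>2) + exp ((- 4 * c)\<^sup>2))"
    by (intro sum_mono add_mono e) auto
  also have "\<dots> = 8 * exp (16 * c\<^sup>2)"
    by (simp add: power_mult_distrib)
  finally show ?thesis .
qed

text \<open>\<open>D\<close> is the gradient, and the remainder is quadratic in the step with the
  weight \<open>growth\<close>. The increment is subtracted because flipping \<open>z j\<close>
  changes a linear form by \<open>- 2 * u j * z j\<close>.\<close>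

definition taylor1 :: "((nat \<Rightarrow> real) \<Rightarrow> real) \<Rightarrow> ((nat \<Rightarrow> real) \<Rightarrow> nat \<Rightarrow> real) \<Rightarrow> bool" where
  "taylor1 \<Phi> D \<longleftrightarrow> (\<exists>K c. K \<ge> 0 \<and> c \<ge> 0 \<and> (\<forall>x h \<epsilon>. 0 \<le> \<epsilon> \<longrightarrow> \<epsilon> \<le> 1 \<longrightarrow> (\<forall>s<4. \<bar>h s\<bar> \<le> \<epsilon>) \<longrightarrow>
     \<bar>\<Phi> x\<bar> \<le> K * growth c x \<and> (\<forall>s<4. \<bar>D x s\<bar> \<le> K * growth c x) \<and>
     \<bar>\<Phi> (\<lambda>s. x s - h s) - \<Phi> x + (\<Sum>s<4. h s * D x s)\<bar> \<le> K * \<epsilon>\<^sup>2 * growth c x))"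

lemma taylor1_mult:
  assumes "taylor1 \<Phi> D" "taylor1 \<Psi> E"
  shows "taylor1 (\<lambda>x. \<Phi> x * \<Psi> x) (\<lambda>x s. D x s * \<Psi> x + \<Phi> x * E x s)"
proof -
  obtain K c where K: "K \<ge> 0" "c \<ge> 0" and
    1: "\<And>x h \<epsilon>. 0 \<le> \<epsilon> \<Longrightarrow> \<epsilon> \<le> 1 \<Longrightarrow> (\<forall>s<4. \<bar>h s\<bar> \<le> \<epsilon>) \<Longrightarrow>
     \<bar>\<Phi> x\<bar> \<le> K * growth c x \<and> (\<forall>s<4. \<bar>D x s\<bar> \<le> K * growth c x) \<and>
     \<bar>\<Phi> (\<lambda>s. x s - h s) - \<Phi> x + (\<Sum>s<4. h s * D x s)\<bar> \<le> K * \<epsilon>\<^sup>2 * growth c x"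
    using assms(1) unfolding taylor1_def by blast
  obtain L e where L: "L \<ge> 0" "e \<ge> 0" and
    2: "\<And>x h \<epsilon>. 0 \<le> \<epsilon> \<Longrightarrow> \<epsilon> \<le> 1 \<Longrightarrow> (\<forall>s<4. \<bar>h s\<bar> \<le> \<epsilon>) \<Longrightarrow>
     \<bar>\<Psi> x\<bar> \<le> L * growth e x \<and> (\<forall>s<4. \<bar>E x s\<bar> \<le> L * growth e x) \<and>
     \<bar>\<Psi> (\<lambda>s. x s - h s) - \<Psi> x + (\<Sum>s<4. h s * E x s)\<bar> \<le> L * \<epsilon>\<^sup>2 * growth e x"
    using assms(2) unfolding taylor1_def by blast
  show ?thesis
    unfolding taylor1_def
  \<comment> \<open>27 = 16 + 6 + 5: the product of the two first-order terms, the remainder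
    \<open>r1\<close> times the shifted second factor, and \<open>\<Phi> x - d1\<close> times
    \<open>r2\<close>.\<close>
  proof (rule exI[of _ "27 * K * L"], rule exI[of _ "c + e"], intro conjI allI impI)
    show "0 \<le> 27 * K * L" "0 \<le> c + e" using K L by auto
    fix x h :: "nat \<Rightarrow> real" and \<epsilon> :: real
    assume \<epsilon>: "0 \<le> \<epsilon>" "\<epsilon> \<le> 1" and h: "\<forall>s<4. \<bar>h s\<bar> \<le> \<epsilon>"
    define k where "k = K * growth c x"
    define l where "l = L * growth e x"
    have kl: "k \<ge> 0" "l \<ge> 0"
      using K L growth_pos[of c x] growth_pos[of e x] by (auto simp: k_def l_def)
    have G: "N * K * L * growth (c + e) x = N * (k * l)" for N
      by (simp add: growth_add k_def l_def)
    define d1 where "d1 = (\<Sum>s<4. h s * D x s)"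
    define d2 where "d2 = (\<Sum>s<4. h s * E x s)"
    define r1 where "r1 = \<Phi> (\<lambda>s. x s - h s) - \<Phi> x + d1"
    define r2 where "r2 = \<Psi> (\<lambda>s. x s - h s) - \<Psi> x + d2"
    have b1: "\<bar>\<Phi> x\<bar> \<le> k" "\<And>s. s < 4 \<Longrightarrow> \<bar>D x s\<bar> \<le> k" "\<bar>r1\<bar> \<le> \<epsilon>\<^sup>2 * k"
      using 1[OF \<epsilon> h, of x] by (auto simp: k_def r1_def d1_def mult_ac)
    have b2: "\<bar>\<Psi> x\<bar> \<le> l" "\<And>s. s < 4 \<Longrightarrow> \<bar>E x s\<bar> \<le> l" "\<bar>r2\<bar> \<le> \<epsilon>\<^sup>2 * l"
      using 2[OF \<epsilon> h, of x] by (auto simp: l_def r2_def d2_def mult_ac)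
    have "\<bar>\<Phi> x * \<Psi> x\<bar> \<le> k * l"
      unfolding abs_mult using b1 b2 kl by (intro mult_mono) auto
    then show "\<bar>\<Phi> x * \<Psi> x\<bar> \<le> 27 * K * L * growth (c + e) x"
      unfolding G using kl mult_nonneg_nonneg[OF kl] by linarith
    show "\<bar>D x s * \<Psi> x + \<Phi> x * E x s\<bar> \<le> 27 * K * L * growth (c + e) x" if "s < 4" for s
    proof -
      have "\<bar>D x s * \<Psi> x\<bar> \<le> k * l" "\<bar>\<Phi> x * E x s\<bar> \<le> k * l"
        unfolding abs_mult using b1 b2 kl that by (auto intro!: mult_mono)
      then show ?thesis
        unfolding G using mult_nonneg_nonneg[OF kl] by linarith
    qed
    have d1: "\<bar>d1\<bar> \<le> 4 * (\<epsilon> * k)"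
    proof -
      have "\<bar>d1\<bar> \<le> (\<Sum>s<4::nat. \<epsilon> * k)"
        unfolding d1_def using h b1(2) \<epsilon>
        by (intro order.trans[OF sum_abs] sum_mono) (auto simp: abs_mult intro!: mult_mono)
      then show ?thesis by simp
    qed
    have d2: "\<bar>d2\<bar> \<le> 4 * (\<epsilon> * l)"
    proof -
      have "\<bar>d2\<bar> \<le> (\<Sum>s<4::nat. \<epsilon> * l)"
        unfolding d2_def using h b2(2) \<epsilon>
        by (intro order.trans[OF sum_abs] sum_mono) (auto simp: abs_mult intro!: mult_mono)
      then show ?thesis by simp
    qed
    have ek: "\<epsilon> * k \<le> k" "\<epsilon> * l \<le> l" "\<epsilon>\<^sup>2 * l \<le> l"
      using \<epsilon> kl by (auto intro!: mult_left_le_one_le simp: power_le_one)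
    have "(\<Sum>s<4. h s * (D x s * \<Psi> x + \<Phi> x * E x s)) = d1 * \<Psi> x + \<Phi> x * d2"
      by (simp add: d1_def d2_def sum_distrib_left sum_distrib_right sum.distrib[symmetric] algebra_simps)
    then have "\<Phi> (\<lambda>s. x s - h s) * \<Psi> (\<lambda>s. x s - h s) - \<Phi> x * \<Psi> x +
        (\<Sum>s<4. h s * (D x s * \<Psi> x + \<Phi> x * E x s))
       = d1 * d2 + r1 * (\<Psi> x - d2 + r2) + (\<Phi> x - d1) * r2"
      by (simp add: r1_def r2_def algebra_simps)
    moreover have "\<bar>d1 * d2\<bar> \<le> (4 * (\<epsilon> * k)) * (4 * (\<epsilon> * l))"
      unfolding abs_mult using d1 d2 \<epsilon> kl by (intro mult_mono) auto
    moreover have "\<bar>r1 * (\<Psi> x - d2 + r2)\<bar> \<le> (\<epsilon>\<^sup>2 * k) * (6 * l)"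
      unfolding abs_mult using b1 b2 d2 ek kl \<epsilon> by (intro mult_mono) auto
    moreover have "\<bar>(\<Phi> x - d1) * r2\<bar> \<le> (5 * k) * (\<epsilon>\<^sup>2 * l)"
      unfolding abs_mult using b1 b2 d1 ek kl \<epsilon> by (intro mult_mono) auto
    ultimately have "\<bar>\<Phi> (\<lambda>s. x s - h s) * \<Psi> (\<lambda>s. x s - h s) - \<Phi> x * \<Psi> x +
        (\<Sum>s<4. h s * (D x s * \<Psi> x + \<Phi> x * E x s))\<bar> \<le>
       (4 * (\<epsilon> * k)) * (4 * (\<epsilon> * l)) + (\<epsilon>\<^sup>2 * k) * (6 * l) + (5 * k) * (\<epsilon>\<^sup>2 * l)"
      by linarith
    also have "\<dots> = \<epsilon>\<^sup>2 * (27 * K * L * growth (c + e) x)"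
      unfolding G by (simp add: power2_eq_square)
    finally show "\<bar>\<Phi> (\<lambda>s. x s - h s) * \<Psi> (\<lambda>s. x s - h s) - \<Phi> x * \<Psi> x +
        (\<Sum>s<4. h s * (D x s * \<Psi> x + \<Phi> x * E x s))\<bar> \<le> 27 * K * L * \<epsilon>\<^sup>2 * growth (c + e) x"
      by (simp add: mult_ac)
  qed
qed

section \<open>Probabilists' Hermite polynomials\<close>

fun he :: "nat \<Rightarrow> real \<Rightarrow> real" where
  "he 0 x = 1"
| "he (Suc 0) x = x"
| "he (Suc (Suc n)) x = x * he (Suc n) x - real (Suc n) * he n x"

lemma he_2: "he 2 x = x\<^sup>2 - 1" and he_3: "he 3 x = x ^ 3 - 3 * x"
  by (simp_all add: numeral_2_eq_2 numeral_3_eq_3 algebra_simps)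

lemma he_Suc: "he (Suc n) x = x * he n x - real n * he (n - 1) x"
  by (cases n) auto

lemma power_le_fact_exp: "x ^ n \<le> fact n * exp (x::real)" if "x \<ge> 0"
proof -
  have "x ^ n / fact n \<le> (\<Sum>k<Suc n. x ^ k / fact k)"
    using that by (intro member_le_sum[of n "{..<Suc n}" "\<lambda>k. x ^ k / fact k"]) auto
  also have "\<dots> \<le> exp x"
    using sum_le_suminf[OF summable_exp[of x], of "{..<Suc n}"] that
    by (simp add: exp_def divide_inverse mult.commute)
  finally show ?thesis
    by (simp add: divide_le_eq mult.commute)
qed

lemma he_bound:
  assumes "n \<le> 3"
  shows "\<bar>he n x\<bar> \<le> 9 * exp \<bar>x\<bar>"
proof -
  have p: "1 \<le> exp \<bar>x\<bar>" "\<bar>x\<bar> \<le> exp \<bar>x\<bar>" "\<bar>x\<bar>\<^sup>2 \<le> 2 * exp \<bar>x\<bar>" "\<bar>x\<bar> ^ 3 \<le> 6 * exp \<bar>x\<bar>"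
    using power_le_fact_exp[of "\<bar>x\<bar>" 1] power_le_fact_exp[of "\<bar>x\<bar>" 2] power_le_fact_exp[of "\<bar>x\<bar>" 3]
    by (auto simp: fact_numeral)
  have "n = 0 \<or> n = 1 \<or> n = 2 \<or> n = 3" using assms by auto
  then show ?thesis
  proof (elim disjE)
    assume "n = 2"
    have "\<bar>x\<^sup>2 - 1\<bar> \<le> \<bar>x\<bar>\<^sup>2 + 1" by (simp add: abs_le_iff)
    then have "\<bar>x\<^sup>2 - 1\<bar> \<le> 9 * exp \<bar>x\<bar>" using p by linarith
    then show ?thesis using \<open>n = 2\<close> by (simp add: he_2)
  next
    \<comment> \<open>Degree three fixes the constant: 9 = 6 + 3, where 6 is the factorial from
      \<open>power_le_fact_exp\<close> and 3 comes from the linear term.\<close>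
    assume "n = 3"
    have "\<bar>x ^ 3 - 3 * x\<bar> \<le> \<bar>x\<bar> ^ 3 + 3 * \<bar>x\<bar>"
      using abs_triangle_ineq4[of "x ^ 3" "3 * x"] by (simp add: power_abs abs_mult)
    then show ?thesis using p \<open>n = 3\<close> by (simp add: he_3)
  next
    assume "n = 0"
    have "1 \<le> 9 * exp \<bar>x\<bar>" using p by linarith
    then show ?thesis using \<open>n = 0\<close> by simp
  qed (use p in auto)
qed

lemma he_taylor:
  assumes "n \<le> 3" "\<bar>h\<bar> \<le> \<epsilon>" "\<epsilon> \<le> 1"
  shows "\<bar>he n (x - h) - he n x + h * (real n * he (n - 1) x)\<bar> \<le> 4 * \<epsilon>\<^sup>2 * exp \<bar>x\<bar>"
proof -
  have p: "1 \<le> exp \<bar>x\<bar>" "\<bar>x\<bar> \<le> exp \<bar>x\<bar>"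
    using power_le_fact_exp[of "\<bar>x\<bar>" 1] by auto
  have h2: "h\<^sup>2 \<le> \<epsilon>\<^sup>2"
    using assms by (metis abs_ge_zero power2_abs power_mono)
  have "n = 0 \<or> n = 1 \<or> n = 2 \<or> n = 3" using assms by auto
  then show ?thesis
  proof (elim disjE)
    assume n: "n = 2"
    have "he n (x - h) - he n x + h * (real n * he (n - 1) x) = h\<^sup>2"
      unfolding n he_2 by (simp add: power2_eq_square algebra_simps)
    moreover have "h\<^sup>2 * 1 \<le> (4 * \<epsilon>\<^sup>2) * exp \<bar>x\<bar>"
    proof (rule mult_mono)
      show "h\<^sup>2 \<le> 4 * \<epsilon>\<^sup>2" using h2 zero_le_power2[of \<epsilon>] by linarith
    qed (use p in auto)
    ultimately show ?thesis by simp
  next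
    assume n: "n = 3"
    have e: "he n (x - h) - he n x + h * (real n * he (n - 1) x) = h\<^sup>2 * (3 * x - h)"
      unfolding n by (simp add: he_2 he_3 power2_eq_square power3_eq_cube algebra_simps)
    have "\<bar>3 * x - h\<bar> \<le> 4 * exp \<bar>x\<bar>"
      using p assms by linarith
    then have "\<bar>h\<^sup>2 * (3 * x - h)\<bar> \<le> \<epsilon>\<^sup>2 * (4 * exp \<bar>x\<bar>)"
      unfolding abs_mult using h2 by (intro mult_mono) auto
    then show ?thesis unfolding e by (simp add: mult_ac)
  qed auto
qed

lemma taylor1_he:
  assumes "n \<le> 3" "t < 4"
  shows "taylor1 (\<lambda>x. he n (x t)) (\<lambda>x s. if s = t then real n * he (n - 1) (x t) else 0)"
  unfolding taylor1_def
\<comment> \<open>27 = 3 * 9 is dictated by the derivative, whose factor \<open>real n\<close> is at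
  most 3; value and remainder need less.\<close>
proof (rule exI[of _ 27], rule exI[of _ 1], intro conjI allI impI)
  fix x h :: "nat \<Rightarrow> real" and \<epsilon> :: real
  assume \<epsilon>: "0 \<le> \<epsilon>" "\<epsilon> \<le> 1" and h: "\<forall>s<4. \<bar>h s\<bar> \<le> \<epsilon>"
  have g: "exp \<bar>x t\<bar> \<le> growth 1 x"
    using assms(2) member_le_sum[of t "{..<4}" "\<lambda>s. \<bar>x s\<bar>"] by (auto simp: growth_def)
  show "\<bar>he n (x t)\<bar> \<le> 27 * growth 1 x"
    using he_bound[OF assms(1), of "x t"] g growth_pos[of 1 x] by linarith
  show "\<bar>if s = t then real n * he (n - 1) (x t) else 0\<bar> \<le> 27 * growth 1 x" for s
  proof -
    have "\<bar>real n * he (n - 1) (x t)\<bar> \<le> 3 * (9 * exp \<bar>x t\<bar>)"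
      unfolding abs_mult using assms(1) he_bound[of "n - 1" "x t"] by (intro mult_mono) auto
    then show ?thesis using g growth_pos[of 1 x] by auto
  qed
  have "(\<Sum>s<4. h s * (if s = t then real n * he (n - 1) (x t) else 0)) =
     (\<Sum>s\<in>{..<4}. if s = t then h t * (real n * he (n - 1) (x t)) else 0)"
    by (rule sum.cong) auto
  also have "\<dots> = h t * (real n * he (n - 1) (x t))"
    using assms by simp
  finally have e: "(\<Sum>s<4. h s * (if s = t then real n * he (n - 1) (x t) else 0)) =
      h t * (real n * he (n - 1) (x t))" .
  have "4 * \<epsilon>\<^sup>2 * exp \<bar>x t\<bar> \<le> 27 * \<epsilon>\<^sup>2 * growth 1 x"
    using g by (intro mult_mono) auto
  then show "\<bar>he n (x t - h t) - he n (x t) +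
        (\<Sum>s<4. h s * (if s = t then real n * he (n - 1) (x t) else 0))\<bar> \<le> 27 * \<epsilon>\<^sup>2 * growth 1 x"
    unfolding e using he_taylor[OF assms(1), of "h t" \<epsilon> "x t"] h \<epsilon> assms(2) by force
qed auto

section \<open>Averages of functions of linear forms with vanishing coefficients\<close>

lemma tendsto_const_div_sqrt_power2: "(\<lambda>k. c / sqrt (2 ^ k)) \<longlonglongrightarrow> 0"
proof -
  have "(\<lambda>k. c * (1 / sqrt 2) ^ k) \<longlonglongrightarrow> c * 0"
    by (intro tendsto_intros LIMSEQ_power_zero) auto
  then show ?thesis
    by (simp add: power_divide real_sqrt_power)
qed

lemma tendsto_of_diff: "(\<lambda>k. f k - h k) \<longlonglongrightarrow> 0 \<Longrightarrow> h \<longlonglongrightarrow> (l::real) \<Longrightarrow> f \<longlonglongrightarrow> l"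
  for f h :: "nat \<Rightarrow> real"
  using tendsto_add[of "\<lambda>k. f k - h k" 0 sequentially h l] by simp

text \<open>The slot \<open>s\<close> names one of four linear forms with coefficients
  \<open>u k s\<close>. Their covariances equal \<open>C\<close> exactly once \<open>k\<close>
  reaches \<open>k\<^sub>0\<close>, so convergence comes only from the shrinking of the single
  coefficients.\<close>

locale gaussian_limit =
  fixes u :: "nat \<Rightarrow> nat \<Rightarrow> nat \<Rightarrow> real" and B :: real and C :: "nat \<Rightarrow> nat \<Rightarrow> real" and k\<^sub>0 :: nat
  assumes u_bound: "\<And>k s j. k \<ge> k\<^sub>0 \<Longrightarrow> s < 4 \<Longrightarrow> j < 2 ^ k \<Longrightarrow> \<bar>u k s j\<bar> \<le> B / sqrt (2 ^ k)"
    and cov: "\<And>k s t. k \<ge> k\<^sub>0 \<Longrightarrow> s < 4 \<Longrightarrow> t < 4 \<Longrightarrow> (\<Sum>j<2 ^ k. u k s j * u k t j) = C s t"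
    and unit: "\<And>s. s < 4 \<Longrightarrow> C s s = 1"
begin

definition g :: "nat \<Rightarrow> (nat \<Rightarrow> real) \<Rightarrow> nat \<Rightarrow> real" where
  "g k z s = lin_form (2 ^ k) (u k s) z"

definition avg :: "nat \<Rightarrow> ((nat \<Rightarrow> real) \<Rightarrow> real) \<Rightarrow> real" where
  "avg k \<Phi> = cube_avg (2 ^ k) (\<lambda>z. \<Phi> (g k z))"

lemma B_nonneg: "B \<ge> 0"
proof -
  have "0 \<le> \<bar>u k\<^sub>0 0 0\<bar>" by simp
  also have "\<dots> \<le> B / sqrt (2 ^ k\<^sub>0)" by (rule u_bound) auto
  finally have "0 \<le> B / sqrt (2 ^ k\<^sub>0)" .
  moreover have "sqrt (2 ^ k\<^sub>0) > (0::real)" by simp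
  ultimately show ?thesis by (metis zero_le_divide_iff not_le)
qed

lemma avg_growth:
  assumes "k \<ge> k\<^sub>0" "c \<ge> 0"
  shows "avg k (growth c) \<le> 8 * exp (16 * c\<^sup>2)"
proof -
  have "(\<Sum>j<2 ^ k. (u k s j)\<^sup>2) \<le> 1" if "s < 4" for s
    using cov[OF assms(1) that that] unit[OF that] by (simp add: power2_eq_square)
  from cube_avg_growth[OF assms(2) this] show ?thesis
    by (simp add: avg_def g_def[abs_def])
qed

text \<open>
  Flipping the sign of \<open>z\<^sub>j\<close> moves \<open>g\<close> by \<open>O(2 powr (- k / 2))\<close>, so the second-order Taylor
  error, summed over the \<open>2 ^ k\<close> coordinates with weights \<open>O(2 powr (- k / 2))\<close>, vanishes in the limit.
\<close>

lemma integration_by_parts: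
  assumes \<Phi>: "taylor1 \<Phi> D" and t: "t < 4"
  shows "(\<lambda>k. avg k (\<lambda>x. x t * \<Phi> x) - (\<Sum>s<4. C t s * avg k (\<lambda>x. D x s))) \<longlonglongrightarrow> 0"
proof -
  obtain K c where K: "K \<ge> 0" "c \<ge> 0" and
    tay: "\<And>x h \<epsilon>. 0 \<le> \<epsilon> \<Longrightarrow> \<epsilon> \<le> 1 \<Longrightarrow> (\<forall>s<4. \<bar>h s\<bar> \<le> \<epsilon>) \<Longrightarrow>
     \<bar>\<Phi> x\<bar> \<le> K * growth c x \<and> (\<forall>s<4. \<bar>D x s\<bar> \<le> K * growth c x) \<and>
     \<bar>\<Phi> (\<lambda>s. x s - h s) - \<Phi> x + (\<Sum>s<4. h s * D x s)\<bar> \<le> K * \<epsilon>\<^sup>2 * growth c x"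
    using \<Phi> unfolding taylor1_def by blast
  define L where "L = 8 * exp (16 * c\<^sup>2)"
  define \<epsilon> where "\<epsilon> k = 2 * B / sqrt (2 ^ k)" for k :: nat
  have bound: "\<bar>avg k (\<lambda>x. x t * \<Phi> x) - (\<Sum>s<4. C t s * avg k (\<lambda>x. D x s))\<bar> \<le> (2 * B ^ 3 * K * L) / sqrt (2 ^ k)"
    if k: "k \<ge> k\<^sub>0" "\<epsilon> k \<le> 1" for k
  proof -
    define d :: nat where "d = 2 ^ k"
    define G where "G = g k"
    have \<epsilon>0: "\<epsilon> k \<ge> 0" using B_nonneg by (simp add: \<epsilon>_def)
    have one: "\<bar>cube_avg d (\<lambda>z. z j * \<Phi> (G z)) - (\<Sum>s<4. u k s j * cube_avg d (\<lambda>z. D (G z) s))\<bar>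
         \<le> K * (\<epsilon> k)\<^sup>2 * L / 2" if j: "j < d" for j
    proof -
      have zG: "flip j z j * \<Phi> (G (flip j z)) = - z j * \<Phi> (\<lambda>s. G z s - 2 * u k s j * z j)" for z
        using j by (simp add: G_def g_def[abs_def] d_def lin_form_flip) (simp add: flip_def)
      \<comment> \<open>Averaging \<open>z\<close> together with \<open>flip j z\<close>, where the
        factor \<open>z j\<close> changes sign, leaves a difference of \<open>\<Phi>\<close> across
        coordinate \<open>j\<close>, to which the Taylor bound applies.\<close>
      have "2 * cube_avg d (\<lambda>z. z j * \<Phi> (G z)) =
          cube_avg d (\<lambda>z. z j * \<Phi> (G z)) + cube_avg d (\<lambda>z. flip j z j * \<Phi> (G (flip j z)))"
        by (simp add: cube_avg_flip[OF j, of "\<lambda>z. z j * \<Phi> (G z)"])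
      also have "\<dots> = cube_avg d (\<lambda>z. z j * \<Phi> (G z) + - z j * \<Phi> (\<lambda>s. G z s - 2 * u k s j * z j))"
        by (simp only: zG cube_avg_add)
      finally have two: "2 * cube_avg d (\<lambda>z. z j * \<Phi> (G z)) = \<dots>" .
      have "2 * (\<Sum>s<4. u k s j * cube_avg d (\<lambda>z. D (G z) s)) =
          cube_avg d (\<lambda>z. 2 * (\<Sum>s<4. u k s j * D (G z) s))"
        by (simp only: cube_avg_sum cube_avg_cmult)
      also have "\<dots> = cube_avg d (\<lambda>z. z j * (\<Sum>s<4. 2 * u k s j * z j * D (G z) s))"
      proof (rule cube_avg_cong)
        fix z assume z: "z \<in> hypercube d"
        have "z j * (\<Sum>s<4. 2 * u k s j * z j * D (G z) s) = (z j * z j) * (2 * (\<Sum>s<4. u k s j * D (G z) s))"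
          by (simp add: sum_distrib_left mult_ac)
        then show "2 * (\<Sum>s<4. u k s j * D (G z) s) = z j * (\<Sum>s<4. 2 * u k s j * z j * D (G z) s)"
          by (simp add: hypercube_sq[OF z j])
      qed
      finally have eq: "2 * (cube_avg d (\<lambda>z. z j * \<Phi> (G z)) - (\<Sum>s<4. u k s j * cube_avg d (\<lambda>z. D (G z) s)))
         = cube_avg d (\<lambda>z. (z j * \<Phi> (G z) + - z j * \<Phi> (\<lambda>s. G z s - 2 * u k s j * z j)) -
                z j * (\<Sum>s<4. 2 * u k s j * z j * D (G z) s))"
        unfolding right_diff_distrib two cube_avg_diff by simp
      have "\<bar>2 * (cube_avg d (\<lambda>z. z j * \<Phi> (G z)) - (\<Sum>s<4. u k s j * cube_avg d (\<lambda>z. D (G z) s)))\<bar>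
          \<le> cube_avg d (\<lambda>z. (K * (\<epsilon> k)\<^sup>2) * growth c (G z))"
        unfolding eq
      proof (rule order.trans[OF cube_avg_abs_le cube_avg_mono])
        fix z assume z: "z \<in> hypercube d"
        have h: "\<forall>s<4. \<bar>2 * u k s j * z j\<bar> \<le> \<epsilon> k"
        proof (intro allI impI)
          fix s :: nat assume "s < 4"
          then have "\<bar>u k s j\<bar> \<le> B / sqrt (2 ^ k)"
            using u_bound[OF k(1)] j by (simp add: d_def)
          then show "\<bar>2 * u k s j * z j\<bar> \<le> \<epsilon> k"
            using hypercube_abs[OF z j] by (simp add: abs_mult \<epsilon>_def)
        qed
        have "\<bar>(z j * \<Phi> (G z) + - z j * \<Phi> (\<lambda>s. G z s - 2 * u k s j * z j)) -
                z j * (\<Sum>s<4. 2 * u k s j * z j * D (G z) s)\<bar> =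
           \<bar>- z j * (\<Phi> (\<lambda>s. G z s - 2 * u k s j * z j) - \<Phi> (G z) + (\<Sum>s<4. 2 * u k s j * z j * D (G z) s))\<bar>"
          by (simp add: algebra_simps)
        also have "\<dots> = \<bar>\<Phi> (\<lambda>s. G z s - 2 * u k s j * z j) - \<Phi> (G z) + (\<Sum>s<4. 2 * u k s j * z j * D (G z) s)\<bar>"
          by (simp add: abs_mult hypercube_abs[OF z j])
        also have "\<dots> \<le> K * (\<epsilon> k)\<^sup>2 * growth c (G z)"
          using tay[OF \<epsilon>0 k(2) h, of "G z"] by blast
        finally show "\<bar>(z j * \<Phi> (G z) + - z j * \<Phi> (\<lambda>s. G z s - 2 * u k s j * z j)) -
                z j * (\<Sum>s<4. 2 * u k s j * z j * D (G z) s)\<bar> \<le> (K * (\<epsilon> k)\<^sup>2) * growth c (G z)" .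
      qed
      also have "\<dots> \<le> K * (\<epsilon> k)\<^sup>2 * L"
        unfolding cube_avg_cmult G_def d_def L_def
        by (rule mult_left_mono[OF avg_growth[OF k(1) K(2), unfolded avg_def]]) (use K in simp)
      finally have "2 * \<bar>cube_avg d (\<lambda>z. z j * \<Phi> (G z)) - (\<Sum>s<4. u k s j * cube_avg d (\<lambda>z. D (G z) s))\<bar>
          \<le> K * (\<epsilon> k)\<^sup>2 * L"
        unfolding abs_mult by simp
      then show ?thesis by (subst pos_le_divide_eq) (simp_all add: mult.commute)
    qed
    have "avg k (\<lambda>x. x t * \<Phi> x) = cube_avg d (\<lambda>z. \<Sum>j<d. u k t j * (z j * \<Phi> (G z)))"
      by (simp add: avg_def G_def d_def g_def lin_form_def sum_distrib_right mult.assoc)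
    also have "\<dots> = (\<Sum>j<d. u k t j * cube_avg d (\<lambda>z. z j * \<Phi> (G z)))"
      by (simp only: cube_avg_sum cube_avg_cmult)
    finally have 1: "avg k (\<lambda>x. x t * \<Phi> x) = \<dots>" .
    have "(\<Sum>s<4. C t s * avg k (\<lambda>x. D x s)) =
        (\<Sum>s<4. \<Sum>j<d. u k t j * (u k s j * cube_avg d (\<lambda>z. D (G z) s)))"
      using cov[OF k(1) t, symmetric]
      by (simp add: sum_distrib_right d_def avg_def G_def mult.assoc)
    also have "\<dots> = (\<Sum>j<d. u k t j * (\<Sum>s<4. u k s j * cube_avg d (\<lambda>z. D (G z) s)))"
      by (subst sum.swap) (simp add: sum_distrib_left)
    finally have 2: "(\<Sum>s<4. C t s * avg k (\<lambda>x. D x s)) = \<dots>" .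
    have "\<bar>avg k (\<lambda>x. x t * \<Phi> x) - (\<Sum>s<4. C t s * avg k (\<lambda>x. D x s))\<bar> =
       \<bar>\<Sum>j<d. u k t j * (cube_avg d (\<lambda>z. z j * \<Phi> (G z)) - (\<Sum>s<4. u k s j * cube_avg d (\<lambda>z. D (G z) s)))\<bar>"
      unfolding 1 2 by (simp add: sum_subtractf right_diff_distrib)
    also have "\<dots> \<le> (\<Sum>j<d. (B / sqrt (2 ^ k)) * (K * (\<epsilon> k)\<^sup>2 * L / 2))"
    proof (intro order.trans[OF sum_abs] sum_mono, unfold abs_mult, rule mult_mono)
      fix j assume "j \<in> {..<d}"
      then show "\<bar>u k t j\<bar> \<le> B / sqrt (2 ^ k)"
        using u_bound[OF k(1) t] by (simp add: d_def)
      show "\<bar>cube_avg d (\<lambda>z. z j * \<Phi> (G z)) - (\<Sum>s<4. u k s j * cube_avg d (\<lambda>z. D (G z) s))\<bar>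
          \<le> K * (\<epsilon> k)\<^sup>2 * L / 2"
        using \<open>j \<in> {..<d}\<close> one by simp
    qed (use B_nonneg in auto)
    also have "\<dots> = (sqrt (2 ^ k) * sqrt (2 ^ k)) * ((B / sqrt (2 ^ k)) * (K * (\<epsilon> k)\<^sup>2 * L / 2))"
      by (simp add: d_def)
    also have "\<dots> = (2 * B ^ 3 * K * L) / sqrt (2 ^ k)"
      unfolding \<epsilon>_def by (simp add: field_simps power2_eq_square power3_eq_cube)
    finally show ?thesis .
  qed
  have "eventually (\<lambda>k. \<epsilon> k < 1) sequentially"
    using tendsto_const_div_sqrt_power2[of "2 * B"] unfolding \<epsilon>_def
    by (rule order_tendstoD) simp
  then have "eventually (\<lambda>k. norm (avg k (\<lambda>x. x t * \<Phi> x) - (\<Sum>s<4. C t s * avg k (\<lambda>x. D x s)))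
       \<le> (2 * B ^ 3 * K * L) / sqrt (2 ^ k)) sequentially"
    using eventually_ge_at_top[of k\<^sub>0] by eventually_elim (use bound in auto)
  then show ?thesis
    by (rule Lim_null_comparison[OF _ tendsto_const_div_sqrt_power2])
qed

lemma avg_diff: "avg k (\<lambda>x. \<Phi> x - \<Psi> x) = avg k \<Phi> - avg k \<Psi>"
  by (simp add: avg_def cube_avg_diff)

lemma avg_cmult: "avg k (\<lambda>x. c * \<Phi> x) = c * avg k \<Phi>"
  by (simp add: avg_def cube_avg_cmult)

lemma avg_sum: "avg k (\<lambda>x. \<Sum>i\<in>I. \<Phi> i x) = (\<Sum>i\<in>I. avg k (\<Phi> i))"
  by (simp add: avg_def cube_avg_sum)

definition H :: "nat \<Rightarrow> nat \<Rightarrow> nat \<Rightarrow> nat \<Rightarrow> (nat \<Rightarrow> real) \<Rightarrow> real" where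
  "H a b c d x = he a (x 0) * he b (x 1) * he c (x 2) * he d (x 3)"

lemma integration_by_parts_H:
  assumes "a \<le> 3" "b \<le> 3" "c \<le> 3" "d \<le> 3" "t < 4"
  shows "(\<lambda>k. avg k (\<lambda>x. x t * H a b c d x) -
      (C t 0 * (real a * avg k (H (a - 1) b c d)) + C t 1 * (real b * avg k (H a (b - 1) c d)) +
       C t 2 * (real c * avg k (H a b (c - 1) d)) + C t 3 * (real d * avg k (H a b c (d - 1))))) \<longlonglongrightarrow> 0"
proof -
  define D :: "(nat \<Rightarrow> real) \<Rightarrow> nat \<Rightarrow> real" where "D = (\<lambda>x s.
     (((if s = 0 then real a * he (a - 1) (x 0) else 0) * he b (x 1) +
       he a (x 0) * (if s = 1 then real b * he (b - 1) (x 1) else 0)) * he c (x 2) +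
      he a (x 0) * he b (x 1) * (if s = 2 then real c * he (c - 1) (x 2) else 0)) * he d (x 3) +
     he a (x 0) * he b (x 1) * he c (x 2) * (if s = (3::nat) then real d * he (d - 1) (x 3) else 0))"
  have tay: "taylor1 (H a b c d) D"
    unfolding H_def[abs_def] D_def by (intro taylor1_mult taylor1_he assms) auto
  have D: "(\<lambda>x. D x 0) = (\<lambda>x. real a * H (a - 1) b c d x)"
    "(\<lambda>x. D x 1) = (\<lambda>x. real b * H a (b - 1) c d x)"
    "(\<lambda>x. D x 2) = (\<lambda>x. real c * H a b (c - 1) d x)"
    "(\<lambda>x. D x 3) = (\<lambda>x. real d * H a b c (d - 1) x)"
    by (auto simp: D_def H_def)
  have 4: "(\<Sum>s<4. C t s * avg k (\<lambda>x. D x s)) =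
     C t 0 * (real a * avg k (H (a - 1) b c d)) + C t 1 * (real b * avg k (H a (b - 1) c d)) +
     C t 2 * (real c * avg k (H a b (c - 1) d)) + C t 3 * (real d * avg k (H a b c (d - 1)))" for k
  proof -
    have "{..<4::nat} = {0, 1, 2, 3}" by auto
    then have "(\<Sum>s<4. C t s * avg k (\<lambda>x. D x s)) = C t 0 * avg k (\<lambda>x. D x 0) +
       C t 1 * avg k (\<lambda>x. D x 1) + C t 2 * avg k (\<lambda>x. D x 2) + C t 3 * avg k (\<lambda>x. D x 3)"
      by simp
    then show ?thesis
      unfolding D avg_cmult .
  qed
  show ?thesis
    using integration_by_parts[OF tay assms(5)] unfolding 4 .
qed

end

text \<open>
  \<open>wick C a b c d\<close> is the expectation of the product of the Hermite polynomials of degrees \<open>a, b, c, d\<close>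
  in four standard Gaussians with covariance \<open>C\<close>; the recursion is Gaussian integration by parts.
\<close>

fun wick :: "(nat \<Rightarrow> nat \<Rightarrow> real) \<Rightarrow> nat \<Rightarrow> nat \<Rightarrow> nat \<Rightarrow> nat \<Rightarrow> real" where
  "wick C (Suc a) b c d = C 0 1 * (real b * wick C a (b - 1) c d) +
     C 0 2 * (real c * wick C a b (c - 1) d) + C 0 3 * (real d * wick C a b c (d - 1))"
| "wick C 0 (Suc b) c d = C 1 2 * (real c * wick C 0 b (c - 1) d) +
     C 1 3 * (real d * wick C 0 b c (d - 1))"
| "wick C 0 0 (Suc c) d = C 2 3 * (real d * wick C 0 0 c (d - 1))"
| "wick C 0 0 0 (Suc d) = 0"
| "wick C 0 0 0 0 = 1"

context gaussian_limit
begin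

text \<open>By the three-term recursion, multiplying by \<open>x 0\<close> raises the degree of the
  first slot and also produces \<open>real a * H (a - 1) b c d\<close>. With unit variance, the
  contraction of that slot with itself in the integration by parts is the same multiple. The two
  cancel in the limit, and only contractions with other slots survive; this is the recursion of
  \<open>wick\<close>.\<close>

lemma avg_H_tendsto:
  assumes "a \<le> 3" "b \<le> 3" "c \<le> 3" "d \<le> 3"
  shows "(\<lambda>k. avg k (H a b c d)) \<longlonglongrightarrow> wick C a b c d"
  using assms
proof (induction C'\<equiv>C a b c d rule: wick.induct)
  case (1 a b c d)
  let ?R = "\<lambda>k. C 0 1 * (real b * avg k (H a (b - 1) c d)) +
       C 0 2 * (real c * avg k (H a b (c - 1) d)) + C 0 3 * (real d * avg k (H a b c (d - 1)))"
  have "H (Suc a) b c d = (\<lambda>x. x 0 * H a b c d x - real a * H (a - 1) b c d x)"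
    by (simp add: fun_eq_iff H_def he_Suc algebra_simps)
  then have key: "avg k (H (Suc a) b c d) = avg k (\<lambda>x. x 0 * H a b c d x) - real a * avg k (H (a - 1) b c d)" for k
    by (simp add: avg_diff avg_cmult)
  have "(\<lambda>k. avg k (H (Suc a) b c d) - ?R k) \<longlonglongrightarrow> 0"
    unfolding key using integration_by_parts_H[of a b c d 0] 1 unit[of 0] by (simp add: algebra_simps)
  moreover have "?R \<longlonglongrightarrow> wick C (Suc a) b c d"
    unfolding wick.simps using 1 by (intro tendsto_intros 1(1,2,3)) auto
  ultimately show ?case
    by (rule tendsto_of_diff)
next
  case (2 b c d)
  let ?R = "\<lambda>k. C 1 2 * (real c * avg k (H 0 b (c - 1) d)) + C 1 3 * (real d * avg k (H 0 b c (d - 1)))"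
  have "H 0 (Suc b) c d = (\<lambda>x. x 1 * H 0 b c d x - real b * H 0 (b - 1) c d x)"
    by (simp add: fun_eq_iff H_def he_Suc algebra_simps)
  then have key: "avg k (H 0 (Suc b) c d) = avg k (\<lambda>x. x 1 * H 0 b c d x) - real b * avg k (H 0 (b - 1) c d)" for k
    by (simp add: avg_diff avg_cmult)
  have "(\<lambda>k. avg k (H 0 (Suc b) c d) - ?R k) \<longlonglongrightarrow> 0"
    unfolding key using integration_by_parts_H[of 0 b c d 1] 2 unit[of 1] by (simp add: algebra_simps)
  moreover have "?R \<longlonglongrightarrow> wick C 0 (Suc b) c d"
    unfolding wick.simps using 2 by (intro tendsto_intros 2(1,2)) auto
  ultimately show ?case
    by (rule tendsto_of_diff)
next
  case (3 c d)
  let ?R = "\<lambda>k. C 2 3 * (real d * avg k (H 0 0 c (d - 1)))"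
  have "H 0 0 (Suc c) d = (\<lambda>x. x 2 * H 0 0 c d x - real c * H 0 0 (c - 1) d x)"
    by (simp add: fun_eq_iff H_def he_Suc algebra_simps)
  then have key: "avg k (H 0 0 (Suc c) d) = avg k (\<lambda>x. x 2 * H 0 0 c d x) - real c * avg k (H 0 0 (c - 1) d)" for k
    by (simp add: avg_diff avg_cmult)
  have "(\<lambda>k. avg k (H 0 0 (Suc c) d) - ?R k) \<longlonglongrightarrow> 0"
    unfolding key using integration_by_parts_H[of 0 0 c d 2] 3 unit[of 2] by (simp add: algebra_simps)
  moreover have "?R \<longlonglongrightarrow> wick C 0 0 (Suc c) d"
    unfolding wick.simps using 3 by (intro tendsto_intros 3(1)) auto
  ultimately show ?case
    by (rule tendsto_of_diff)
next
  case (4 d)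
  have "H 0 0 0 (Suc d) = (\<lambda>x. x 3 * H 0 0 0 d x - real d * H 0 0 0 (d - 1) x)"
    by (simp add: fun_eq_iff H_def he_Suc algebra_simps)
  then have "avg k (H 0 0 0 (Suc d)) = avg k (\<lambda>x. x 3 * H 0 0 0 d x) - real d * avg k (H 0 0 0 (d - 1))" for k
    by (simp add: avg_diff avg_cmult)
  then show ?case
    using integration_by_parts_H[of 0 0 0 d 3] 4 unit[of 3] by simp
next
  case 5
  show ?case
    by (simp add: H_def avg_def cube_avg_const)
qed

lemma avg_prod_tendsto:
  "(\<lambda>k. avg k (\<lambda>x. \<Prod>s<4. he 1 (x s) - he 3 (x s) / 3)) \<longlonglongrightarrow>
    (\<Sum>a\<in>{1,3}. \<Sum>b\<in>{1,3}. \<Sum>c\<in>{1,3}. \<Sum>d\<in>{1,3}.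
       (if a = 1 then 1 else - 1/3) * ((if b = 1 then 1 else - 1/3) *
       ((if c = 1 then 1 else - 1/3) * ((if d = 1 then 1 else - 1/3) * wick C a b c d))))"
proof -
  let ?w = "\<lambda>a::nat. if a = 1 then 1 else - 1/3 :: real"
  have 4: "{..<4::nat} = {0, 1, 2, 3}" by auto
  have "(\<Prod>s<4. he 1 (x s) - he 3 (x s) / 3) =
     (\<Sum>a\<in>{1,3}. \<Sum>b\<in>{1,3}. \<Sum>c\<in>{1,3}. \<Sum>d\<in>{1,3}. ?w a * (?w b * (?w c * (?w d * H a b c d x))))" for x
  proof -
    have p: "he 1 (x s) - he 3 (x s) / 3 = (\<Sum>a\<in>{1,3}. ?w a * he a (x s))" for s
      by simp
    have "(\<Sum>a\<in>{1,3}. \<Sum>b\<in>{1,3}. \<Sum>c\<in>{1,3}. \<Sum>d\<in>{1,3}. ?w a * (?w b * (?w c * (?w d * H a b c d x)))) =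
       (\<Sum>a\<in>{1,3}. \<Sum>b\<in>{1,3}. \<Sum>c\<in>{1,3}. \<Sum>d\<in>{1,3}.
          (?w a * he a (x 0)) * ((?w b * he b (x 1)) * ((?w c * he c (x 2)) * (?w d * he d (x 3)))))"
      by (intro sum.cong refl) (simp add: H_def mult_ac)
    also have "\<dots> = (\<Sum>a\<in>{1,3}. ?w a * he a (x 0)) * ((\<Sum>b\<in>{1,3}. ?w b * he b (x 1)) *
       ((\<Sum>c\<in>{1,3}. ?w c * he c (x 2)) * (\<Sum>d\<in>{1,3}. ?w d * he d (x 3))))"
      by (simp only: sum_distrib_left[symmetric] sum_distrib_right[symmetric])
    finally show ?thesis
      unfolding 4 p by (simp add: mult.assoc)
  qed
  then have "avg k (\<lambda>x. \<Prod>s<4. he 1 (x s) - he 3 (x s) / 3) =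
     (\<Sum>a\<in>{1,3}. \<Sum>b\<in>{1,3}. \<Sum>c\<in>{1,3}. \<Sum>d\<in>{1,3}. ?w a * (?w b * (?w c * (?w d * avg k (H a b c d)))))" for k
    by (simp only: avg_sum avg_cmult)
  then show ?thesis
    by (simp only:) (intro tendsto_sum tendsto_mult tendsto_const avg_H_tendsto; auto)
qed

lemma avg_prod2_tendsto:
  "(\<lambda>k. avg k (\<lambda>x. \<Prod>s<2. he 1 (x s) - he 3 (x s) / 3)) \<longlonglongrightarrow>
    (\<Sum>a\<in>{1,3}. \<Sum>b\<in>{1,3}.
       (if a = 1 then 1 else - 1/3) * ((if b = 1 then 1 else - 1/3) * wick C a b 0 0))"
proof -
  let ?w = "\<lambda>a::nat. if a = 1 then 1 else - 1/3 :: real"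
  have 2: "{..<2::nat} = {0, 1}" by auto
  have "(\<Prod>s<2. he 1 (x s) - he 3 (x s) / 3) =
     (\<Sum>a\<in>{1,3}. \<Sum>b\<in>{1,3}. ?w a * (?w b * H a b 0 0 x))" for x
    unfolding 2 H_def by (simp add: field_simps)
  then have "avg k (\<lambda>x. \<Prod>s<2. he 1 (x s) - he 3 (x s) / 3) =
     (\<Sum>a\<in>{1,3}. \<Sum>b\<in>{1,3}. ?w a * (?w b * avg k (H a b 0 0)))" for k
    by (simp only: avg_sum avg_cmult)
  then show ?thesis
    by (simp only:) (intro tendsto_sum tendsto_mult tendsto_const avg_H_tendsto; auto)
qed

end

section \<open>Explicit two-point and four-point moments\<close>

lemma wick_numeral_simps:
  "wick C 3 b c d = C 0 1 * (real b * wick C 2 (b - 1) c d) +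
     C 0 2 * (real c * wick C 2 b (c - 1) d) + C 0 3 * (real d * wick C 2 b c (d - 1))"
  "wick C 2 b c d = C 0 1 * (real b * wick C 1 (b - 1) c d) +
     C 0 2 * (real c * wick C 1 b (c - 1) d) + C 0 3 * (real d * wick C 1 b c (d - 1))"
  "wick C 1 b c d = C 0 1 * (real b * wick C 0 (b - 1) c d) +
     C 0 2 * (real c * wick C 0 b (c - 1) d) + C 0 3 * (real d * wick C 0 b c (d - 1))"
  "wick C 0 3 c d = C 1 2 * (real c * wick C 0 2 (c - 1) d) + C 1 3 * (real d * wick C 0 2 c (d - 1))"
  "wick C 0 2 c d = C 1 2 * (real c * wick C 0 1 (c - 1) d) + C 1 3 * (real d * wick C 0 1 c (d - 1))"
  "wick C 0 1 c d = C 1 2 * (real c * wick C 0 0 (c - 1) d) + C 1 3 * (real d * wick C 0 0 c (d - 1))"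
  "wick C 0 0 3 d = C 2 3 * (real d * wick C 0 0 2 (d - 1))"
  "wick C 0 0 2 d = C 2 3 * (real d * wick C 0 0 1 (d - 1))"
  "wick C 0 0 1 d = C 2 3 * (real d * wick C 0 0 0 (d - 1))"
  "wick C 0 0 0 3 = 0" "wick C 0 0 0 2 = 0" "wick C 0 0 0 1 = 0" "wick C 0 0 0 0 = 1"
  by (simp_all add: numeral_2_eq_2 numeral_3_eq_3)

text \<open>
  For unit Gaussians \<open>g\<^sub>i, g\<^sub>j, g\<^sub>k, g\<^sub>l\<close> and \<open>q\<^sub>i = he 1 g\<^sub>i - he 3 g\<^sub>i / 3\<close>, \<open>moment2\<close> is \<open>E[q\<^sub>i q\<^sub>j]\<close> and the
  connected part of \<open>E[q\<^sub>i q\<^sub>j q\<^sub>k q\<^sub>l]\<close> with respect to the pairing \<open>ij | kl\<close> is \<open>gram4 + err4\<close>.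
  The arguments are the covariances of \<open>ij, kl, ik, jl, il, jk\<close>, in this order.
\<close>

definition moment2 :: "real \<Rightarrow> real" where
  "moment2 a = a + 2 / 3 * a ^ 3"

definition gram4 :: "real \<Rightarrow> real \<Rightarrow> real \<Rightarrow> real \<Rightarrow> real \<Rightarrow> real \<Rightarrow> real" where
  "gram4 a b c d e f = c * d + e * f - 2 * a * (c * e + f * d) - 2 * b * (c * f + e * d)
     + 2 * a * b * (c\<^sup>2 + e\<^sup>2 + f\<^sup>2 + d\<^sup>2)"

definition err4 :: "real \<Rightarrow> real \<Rightarrow> real \<Rightarrow> real \<Rightarrow> real \<Rightarrow> real \<Rightarrow> real" where
  "err4 a b c d e f =
     2 / 3 * (c ^ 3 * d + d ^ 3 * c + e ^ 3 * f + f ^ 3 * e)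
     + 2 * (a\<^sup>2 + b\<^sup>2) * (c * d + e * f) + 2 * ((c\<^sup>2 + d\<^sup>2) * e * f + (e\<^sup>2 + f\<^sup>2) * c * d)
     - 4 * (a * c * e * (b\<^sup>2 + d\<^sup>2 + f\<^sup>2) + a * f * d * (b\<^sup>2 + c\<^sup>2 + e\<^sup>2)
          + c * f * b * (a\<^sup>2 + d\<^sup>2 + e\<^sup>2) + e * d * b * (a\<^sup>2 + c\<^sup>2 + f\<^sup>2))
     + 4 / 9 * ((c * d) ^ 3 + (e * f) ^ 3)
     + 4 * ((a * b)\<^sup>2 * (c * d + e * f) + (c * d)\<^sup>2 * (a * b + e * f) + (e * f)\<^sup>2 * (a * b + c * d))
     + 16 * a * b * c * d * e * f"

lemma wick_sum2:
  "(\<Sum>a\<in>{1,3}. \<Sum>b\<in>{1,3}. (if a = 1 then 1 else - 1/3) * ((if b = 1 then 1 else - 1/3) * wick C a b 0 0))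
   = moment2 (C 0 1)"
proof -
  have "(\<Sum>a\<in>{1,3}. \<Sum>b\<in>{1,3}. (if a = 1 then 1 else - 1/3) * ((if b = 1 then 1 else - 1/3) * wick C a b 0 0))
    = wick C 1 1 0 0 - wick C 1 3 0 0 / 3 - wick C 3 1 0 0 / 3 + wick C 3 3 0 0 / 9"
    by (simp del: wick.simps One_nat_def)
  also have "\<dots> = moment2 (C 0 1)"
    by (simp add: moment2_def wick_numeral_simps power3_eq_cube del: One_nat_def)
  finally show ?thesis .
qed

text \<open>\<open>wick C p q r s\<close> is a sum over loop-free multigraphs on four vertices with
  degrees p, q, r, s. The exponents of a monomial are the edge multiplicities, and its coefficient
  is p! q! r! s! divided by the factorials of the multiplicities; for example 108 = 6^3 / 2. Every
  vertex of degree three contributes a weight -1/3.\<close>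

lemma wick_sum4:
  "(\<Sum>a\<in>{1,3}. \<Sum>b\<in>{1,3}. \<Sum>c\<in>{1,3}. \<Sum>d\<in>{1,3}.
       (if a = 1 then 1 else - 1/3) * ((if b = 1 then 1 else - 1/3) *
       ((if c = 1 then 1 else - 1/3) * ((if d = 1 then 1 else - 1/3) * wick C a b c d))))
   = moment2 (C 0 1) * moment2 (C 2 3)
     + gram4 (C 0 1) (C 2 3) (C 0 2) (C 1 3) (C 0 3) (C 1 2)
     + err4 (C 0 1) (C 2 3) (C 0 2) (C 1 3) (C 0 3) (C 1 2)"
proof -
  define a b c d e f where "a = C 0 1" and "b = C 2 3" and "c = C 0 2"
    and "d = C 1 3" and "e = C 0 3" and "f = C 1 2"
  note defs = this[symmetric]
  have "(\<Sum>a\<in>{1,3}. \<Sum>b\<in>{1,3}. \<Sum>c\<in>{1,3}. \<Sum>d\<in>{1,3}.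
       (if a = 1 then 1 else - 1/3) * ((if b = 1 then 1 else - 1/3) *
       ((if c = 1 then 1 else - 1/3) * ((if d = 1 then 1 else - 1/3) * wick C a b c d))))
    = wick C 1 1 1 1
      - (wick C 3 1 1 1 + wick C 1 3 1 1 + wick C 1 1 3 1 + wick C 1 1 1 3) / 3
      + (wick C 3 3 1 1 + wick C 3 1 3 1 + wick C 3 1 1 3 + wick C 1 3 3 1 + wick C 1 3 1 3 + wick C 1 1 3 3) / 9
      - (wick C 3 3 3 1 + wick C 3 3 1 3 + wick C 3 1 3 3 + wick C 1 3 3 3) / 27
      + wick C 3 3 3 3 / 81"
    by (simp add: field_simps del: wick.simps One_nat_def)
  moreover have "wick C 1 1 1 1 = a * b + c * d + e * f"
    by (simp add: wick_numeral_simps defs algebra_simps del: One_nat_def)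
  moreover have "wick C 3 1 1 1 = 6 * a * c * e" "wick C 1 3 1 1 = 6 * a * f * d"
      "wick C 1 1 3 1 = 6 * c * f * b" "wick C 1 1 1 3 = 6 * e * d * b"
    by (simp_all add: wick_numeral_simps defs algebra_simps del: One_nat_def)
  moreover have "wick C 3 3 1 1 = 6 * a ^ 3 * b + 18 * a\<^sup>2 * (c * d + e * f)"
      "wick C 3 1 3 1 = 6 * c ^ 3 * d + 18 * c\<^sup>2 * (a * b + e * f)"
      "wick C 3 1 1 3 = 6 * e ^ 3 * f + 18 * e\<^sup>2 * (a * b + c * d)"
      "wick C 1 3 3 1 = 6 * f ^ 3 * e + 18 * f\<^sup>2 * (a * b + c * d)"
      "wick C 1 3 1 3 = 6 * d ^ 3 * c + 18 * d\<^sup>2 * (a * b + e * f)"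
      "wick C 1 1 3 3 = 6 * b ^ 3 * a + 18 * b\<^sup>2 * (c * d + e * f)"
    by (simp_all add: wick_numeral_simps defs algebra_simps power2_eq_square power3_eq_cube del: One_nat_def)
  moreover have "wick C 3 3 3 1 = 108 * (a * c * e * f\<^sup>2 + a * f * d * c\<^sup>2 + c * f * b * a\<^sup>2)"
      "wick C 3 3 1 3 = 108 * (a * c * e * d\<^sup>2 + a * f * d * e\<^sup>2 + e * d * b * a\<^sup>2)"
      "wick C 3 1 3 3 = 108 * (a * c * e * b\<^sup>2 + c * f * b * e\<^sup>2 + e * d * b * c\<^sup>2)"
      "wick C 1 3 3 3 = 108 * (a * f * d * b\<^sup>2 + c * f * b * d\<^sup>2 + e * d * b * f\<^sup>2)"
    by (simp_all add: wick_numeral_simps defs algebra_simps power2_eq_square power3_eq_cube del: One_nat_def)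
  moreover have "wick C 3 3 3 3 = 36 * ((a * b) ^ 3 + (c * d) ^ 3 + (e * f) ^ 3)
      + 324 * ((a * b)\<^sup>2 * (c * d + e * f) + (c * d)\<^sup>2 * (a * b + e * f) + (e * f)\<^sup>2 * (a * b + c * d))
      + 1296 * a * b * c * d * e * f"
    by (simp add: wick_numeral_simps defs algebra_simps power2_eq_square power3_eq_cube del: One_nat_def)
  ultimately show ?thesis
    unfolding defs by (simp add: moment2_def gram4_def err4_def field_simps power2_eq_square power3_eq_cube)
qed

section \<open>Limiting moments\<close>

lemma sum_lessThan_add: "(\<Sum>j<m + n. f j) = (\<Sum>j<m. f j) + (\<Sum>j<n. f (m + j))"
  for f :: "nat \<Rightarrow> real"
  by (induction n) auto

lemma sylvester_carrier: "sylvester k \<in> carrier_mat (2 ^ k) (2 ^ k)"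
  by (induction k) (auto simp: Let_def)

lemma sylvester_Suc_index:
  assumes "i < 2 ^ Suc k" "j < 2 ^ Suc k"
  shows "sylvester (Suc k) $$ (i, j) =
    (if i < 2 ^ k then if j < 2 ^ k then sylvester k $$ (i, j) else sylvester k $$ (i, j - 2 ^ k)
     else if j < 2 ^ k then sylvester k $$ (i - 2 ^ k, j) else - sylvester k $$ (i - 2 ^ k, j - 2 ^ k))"
proof -
  have d: "dim_row (sylvester k) = 2 ^ k" "dim_col (sylvester k) = 2 ^ k"
    using sylvester_carrier[of k] by auto
  show ?thesis
    using assms by (auto simp: Let_def d)
qed

lemma sylvester_abs: "i < 2 ^ k \<Longrightarrow> j < 2 ^ k \<Longrightarrow> \<bar>sylvester k $$ (i, j)\<bar> = 1"
proof (induction k arbitrary: i j)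
  case (Suc k)
  then show ?case
    unfolding sylvester_Suc_index[OF Suc.prems] by auto
qed auto

lemma sylvester_orthogonal:
  "i < 2 ^ k \<Longrightarrow> l < 2 ^ k \<Longrightarrow>
    (\<Sum>j<2 ^ k. sylvester k $$ (i, j) * sylvester k $$ (l, j)) = (if i = l then 2 ^ k else 0)"
proof (induction k arbitrary: i l)
  case (Suc k)
  \<comment> \<open>\<open>I\<close> is the position inside a block, and \<open>\<sigma>\<close> is
    the sign with which the right half of a row repeats its left half. The two halves of the scalar
    product thus add up or cancel, as the signs of the two rows agree or not.\<close>
  define I where "I i = (if i < 2 ^ k then i else i - 2 ^ k)" for i :: nat
  define \<sigma> where "\<sigma> i = (if i < 2 ^ k then 1 else - 1 :: real)" for i :: nat
  have I: "I i < 2 ^ k" "I l < 2 ^ k"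
    using Suc.prems by (auto simp: I_def)
  have il: "i = l \<longleftrightarrow> I i = I l \<and> \<sigma> i = \<sigma> l"
    using Suc.prems by (auto simp: I_def \<sigma>_def)
  have s: "sylvester (Suc k) $$ (m, j) = sylvester k $$ (I m, j)"
    "sylvester (Suc k) $$ (m, 2 ^ k + j) = \<sigma> m * sylvester k $$ (I m, j)"
    if "m < 2 ^ Suc k" "j < 2 ^ k" for m j
    using that by (subst sylvester_Suc_index; simp add: I_def \<sigma>_def)+
  have "(\<Sum>j<2 ^ Suc k. sylvester (Suc k) $$ (i, j) * sylvester (Suc k) $$ (l, j)) =
    (\<Sum>j<2 ^ k + 2 ^ k. sylvester (Suc k) $$ (i, j) * sylvester (Suc k) $$ (l, j))"
    by (simp add: mult_2)
  also have "\<dots> = (\<Sum>j<2 ^ k. sylvester k $$ (I i, j) * sylvester k $$ (I l, j)) +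
      (\<Sum>j<2 ^ k. \<sigma> i * \<sigma> l * (sylvester k $$ (I i, j) * sylvester k $$ (I l, j)))"
    unfolding sum_lessThan_add using Suc.prems
    by (intro arg_cong2[of _ _ _ _ "(+)"] sum.cong) (auto simp: s simp del: sylvester.simps)
  also have "\<dots> = (1 + \<sigma> i * \<sigma> l) * (if I i = I l then 2 ^ k else 0)"
    unfolding sum_distrib_left[symmetric] Suc.IH[OF I] by (simp add: algebra_simps)
  also have "\<dots> = (if i = l then 2 ^ Suc k else 0)"
    by (auto simp: il \<sigma>_def)
  finally show ?case .
qed auto

section \<open>Elementary symmetric polynomials in terms of power sums\<close>

lemma sum_subsets_Suc:
  fixes x :: "nat \<Rightarrow> real"
  shows "(\<Sum>J | J \<subseteq> {..<Suc d} \<and> card J = Suc r. \<Prod>j\<in>J. x j) =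
    (\<Sum>J | J \<subseteq> {..<d} \<and> card J = Suc r. \<Prod>j\<in>J. x j) + x d * (\<Sum>J | J \<subseteq> {..<d} \<and> card J = r. \<Prod>j\<in>J. x j)"
proof -
  let ?A = "{J. J \<subseteq> {..<d} \<and> card J = Suc r}" and ?B = "{J. J \<subseteq> {..<d} \<and> card J = r}"
  have fin: "finite J" if "J \<subseteq> {..<d}" for J
    using that finite_subset by blast
  have finA: "finite {J. J \<subseteq> {..<d} \<and> card J = m}" for m
    by (rule finite_subset[of _ "Pow {..<d}"]) auto
  have split: "{J. J \<subseteq> {..<Suc d} \<and> card J = Suc r} = ?A \<union> insert d ` ?B"
  proof (intro equalityI subsetI)
    fix J assume J: "J \<in> {J. J \<subseteq> {..<Suc d} \<and> card J = Suc r}"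
    then have finJ: "finite J" using finite_subset by blast
    show "J \<in> ?A \<union> insert d ` ?B"
    proof (cases "d \<in> J")
      case True
      then have "J = insert d (J - {d})" "card (J - {d}) = r" "J - {d} \<subseteq> {..<d}"
        using J finJ by (auto simp: card_Diff_singleton less_Suc_eq)
      then show ?thesis by blast
    next
      case False
      then have "J \<subseteq> {..<d}" using J by (auto simp: less_Suc_eq)
      then show ?thesis using J by auto
    qed
  next
    fix J assume "J \<in> ?A \<union> insert d ` ?B"
    then show "J \<in> {J. J \<subseteq> {..<Suc d} \<and> card J = Suc r}"
    proof
      assume "J \<in> insert d ` ?B"
      then obtain L where L: "J = insert d L" "L \<subseteq> {..<d}" "card L = r" by auto
      then have "d \<notin> L" by auto
      then show ?thesis using L fin[OF L(2)] by auto
    qed auto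
  qed
  have inj: "inj_on (insert d) ?B"
  proof (rule inj_onI)
    fix J L assume "J \<in> ?B" "L \<in> ?B" and eq: "insert d J = insert d L"
    then have "d \<notin> J" "d \<notin> L" by auto
    with eq show "J = L" by (simp add: insert_ident)
  qed
  have "(\<Sum>J\<in>?A \<union> insert d ` ?B. \<Prod>j\<in>J. x j) =
      (\<Sum>J\<in>?A. \<Prod>j\<in>J. x j) + (\<Sum>J\<in>insert d ` ?B. \<Prod>j\<in>J. x j)"
    by (rule sum.union_disjoint) (auto simp: finA)
  also have "(\<Sum>J\<in>insert d ` ?B. \<Prod>j\<in>J. x j) = (\<Sum>J\<in>?B. \<Prod>j\<in>insert d J. x j)"
    by (simp add: sum.reindex[OF inj])
  also have "\<dots> = (\<Sum>J\<in>?B. x d * (\<Prod>j\<in>J. x j))"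
  proof (rule sum.cong)
    fix J assume "J \<in> ?B"
    then have "finite J" "d \<notin> J" using fin by auto
    then show "(\<Prod>j\<in>insert d J. x j) = x d * (\<Prod>j\<in>J. x j)" by simp
  qed simp
  finally show ?thesis
    unfolding split by (simp add: sum_distrib_left)
qed

lemma sum_subsets_0:
  fixes x :: "nat \<Rightarrow> real"
  shows "(\<Sum>J | J \<subseteq> {..<d} \<and> card J = 0. \<Prod>j\<in>J. x j) = (1::real)"
proof -
  have "{J. J \<subseteq> {..<d} \<and> card J = 0} = {{}}"
    using finite_subset[of _ "{..<d}"] by auto
  then show ?thesis by simp
qed

lemma sum_subsets_1:
  fixes x :: "nat \<Rightarrow> real"
  shows "(\<Sum>J | J \<subseteq> {..<d} \<and> card J = 1. \<Prod>j\<in>J. x j) = (\<Sum>j<d. x j :: real)"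
proof (induction d)
  case 0
  have "{J. J \<subseteq> {..<0::nat} \<and> card J = 1} = {}" by auto
  then show ?case by simp
next
  case (Suc d)
  then show ?case using sum_subsets_Suc[where d = d and r = 0 and x = x] sum_subsets_0[where d = d and x = x] by simp
qed

lemma sum_subsets_2:
  fixes x :: "nat \<Rightarrow> real"
  shows "(\<Sum>J | J \<subseteq> {..<d} \<and> card J = 2. \<Prod>j\<in>J. x j) = ((\<Sum>j<d. x j)\<^sup>2 - (\<Sum>j<d. (x j)\<^sup>2 :: real)) / 2"
proof (induction d)
  case 0
  have "{J. J \<subseteq> {..<0::nat} \<and> card J = 2} = {}" by auto
  then show ?case by simp
next
  case (Suc d)
  then show ?case
    using sum_subsets_Suc[where d = d and r = 1 and x = x] sum_subsets_1[where d = d and x = x]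
    by (simp add: numeral_2_eq_2 field_simps)
qed

text \<open>Newton's identity of degree three. When the second power sum is 1, the first two terms
  form \<open>he 3\<close> of the linear form, divided by 6; only the cubic power sum is left
  over.\<close>

lemma sum_subsets_3:
  fixes x :: "nat \<Rightarrow> real"
  shows "(\<Sum>J | J \<subseteq> {..<d} \<and> card J = 3. \<Prod>j\<in>J. x j) =
    ((\<Sum>j<d. x j) ^ 3 - 3 * (\<Sum>j<d. x j) * (\<Sum>j<d. (x j)\<^sup>2) + 2 * (\<Sum>j<d. (x j) ^ 3 :: real)) / 6"
proof (induction d)
  case 0
  have "{J. J \<subseteq> {..<0::nat} \<and> card J = 3} = {}" by auto
  then show ?case by simp
next
  case (Suc d)
  have "(\<Sum>J | J \<subseteq> {..<Suc d} \<and> card J = 3. \<Prod>j\<in>J. x j) =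
     ((\<Sum>j<d. x j) ^ 3 - 3 * (\<Sum>j<d. x j) * (\<Sum>j<d. (x j)\<^sup>2) + 2 * (\<Sum>j<d. (x j) ^ 3)) / 6 +
      x d * (((\<Sum>j<d. x j)\<^sup>2 - (\<Sum>j<d. (x j)\<^sup>2)) / 2)"
    using sum_subsets_Suc[where d = d and r = 2 and x = x] Suc.IH sum_subsets_2[where d = d and x = x] by simp
  then show ?case
    by (simp add: field_simps power2_eq_square power3_eq_cube)
qed

section \<open>From the polynomials q_i to Hermite polynomials of linear forms\<close>

definition row_bound :: "real mat \<Rightarrow> real" where
  "row_bound M = (\<Sum>i<dim_row M. \<Sum>l<dim_col M. \<bar>M $$ (i, l)\<bar>)"

lemma lifted_index:
  assumes "M \<in> carrier_mat n n" "i < n" "j < 2 ^ k" "n \<le> 2 ^ k"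
  shows "lifted M k $$ (i, j) = (\<Sum>l<n. M $$ (i, l) * (sylvester k $$ (l, j) / sqrt (2 ^ k)))"
proof -
  have d: "dim_row (sylvester k) = 2 ^ k" "dim_col (sylvester k) = 2 ^ k"
    using sylvester_carrier[of k] by auto
  show ?thesis
    using assms by (auto simp: lifted_def hadamard_rows_def hadamard_def scalar_prod_def d
        lessThan_atLeast0 intro!: sum.cong)
qed

text \<open>All entries of the normalized Hadamard matrix have modulus 2^(-k/2). The constant may
  depend on \<open>M\<close>, and thereby on \<open>n\<close>, since \<open>M\<close> is fixed while
  \<open>k\<close> grows; hence the crude choice of \<open>row_bound\<close>.\<close>

lemma lifted_abs_le:
  assumes "M \<in> carrier_mat n n" "i < n" "j < 2 ^ k" "n \<le> 2 ^ k"
  shows "\<bar>lifted M k $$ (i, j)\<bar> \<le> row_bound M / sqrt (2 ^ k)"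
proof -
  have "\<bar>lifted M k $$ (i, j)\<bar> \<le> (\<Sum>l<n. \<bar>M $$ (i, l)\<bar> / sqrt (2 ^ k))"
    unfolding lifted_index[OF assms] using assms
    by (intro order.trans[OF sum_abs] sum_mono) (simp add: abs_mult sylvester_abs)
  also have "\<dots> = (\<Sum>l<n. \<bar>M $$ (i, l)\<bar>) / sqrt (2 ^ k)"
    by (simp add: sum_divide_distrib)
  also have "\<dots> \<le> row_bound M / sqrt (2 ^ k)"
    using assms member_le_sum[of i "{..<n}" "\<lambda>i. \<Sum>l<n. \<bar>M $$ (i, l)\<bar>"]
    by (auto simp: row_bound_def intro!: divide_right_mono sum_nonneg)
  finally show ?thesis .
qed

lemma mult_transpose_index:
  assumes "M \<in> carrier_mat n n" "i < n" "j < n"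
  shows "(M * transpose_mat M) $$ (i, j) = (\<Sum>l<n. M $$ (i, l) * M $$ (j, l) :: real)"
  using assms by (auto simp: scalar_prod_def lessThan_atLeast0 intro!: sum.cong)

lemma lifted_cov:
  assumes M: "M \<in> carrier_mat n n" and "i < n" "i' < n" and n: "n \<le> 2 ^ k"
  shows "(\<Sum>j<2 ^ k. lifted M k $$ (i, j) * lifted M k $$ (i', j)) = (M * transpose_mat M) $$ (i, i')"
proof -
  let ?S = "\<lambda>l j. sylvester k $$ (l, j)"
  have "(\<Sum>j<2 ^ k. lifted M k $$ (i, j) * lifted M k $$ (i', j)) =
     (\<Sum>j<2 ^ k. \<Sum>l<n. \<Sum>l'<n. (M $$ (i, l) * M $$ (i', l') / 2 ^ k) * (?S l j * ?S l' j))"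
    by (intro sum.cong refl) (simp add: lifted_index[OF M _ _ n] assms sum_product mult_ac)
  also have "\<dots> = (\<Sum>l<n. \<Sum>l'<n. \<Sum>j<2 ^ k. (M $$ (i, l) * M $$ (i', l') / 2 ^ k) * (?S l j * ?S l' j))"
    by (subst sum.swap, rule sum.cong[OF refl], rule sum.swap)
  also have "\<dots> = (\<Sum>l<n. \<Sum>l'<n. (M $$ (i, l) * M $$ (i', l') / 2 ^ k) * (if l = l' then 2 ^ k else 0))"
    unfolding sum_distrib_left[symmetric] using n
    by (intro sum.cong refl) (simp add: sylvester_orthogonal)
  also have "\<dots> = (\<Sum>l<n. \<Sum>l'<n. if l = l' then M $$ (i, l) * M $$ (i', l') else 0)"
    by (intro sum.cong refl) auto
  also have "\<dots> = (\<Sum>l<n. M $$ (i, l) * M $$ (i', l))"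
    by simp
  finally show ?thesis
    by (simp add: mult_transpose_index[OF M] assms)
qed

lemma q_poly_eq:
  assumes z: "z \<in> hypercube (2 ^ k)" and unit: "(\<Sum>j<2 ^ k. lifted M k $$ (i, j) * lifted M k $$ (i, j)) = 1"
  defines "g \<equiv> lin_form (2 ^ k) (\<lambda>j. lifted M k $$ (i, j)) z"
  shows "q_poly M k i z = he 1 g - he 3 g / 3 - 2 / 3 * (\<Sum>j<2 ^ k. (lifted M k $$ (i, j) * z j) ^ 3)"
proof -
  have "(\<Sum>j<2 ^ k. (lifted M k $$ (i, j) * z j)\<^sup>2) = (\<Sum>j<2 ^ k. lifted M k $$ (i, j) * lifted M k $$ (i, j))"
  proof (rule sum.cong)
    fix j :: nat assume "j \<in> {..<2 ^ k}"
    then have "z j * z j = 1" using hypercube_sq[OF z] by simp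
    moreover have "(lifted M k $$ (i, j) * z j)\<^sup>2 = lifted M k $$ (i, j) * lifted M k $$ (i, j) * (z j * z j)"
      by (simp add: power2_eq_square)
    ultimately show "(lifted M k $$ (i, j) * z j)\<^sup>2 = lifted M k $$ (i, j) * lifted M k $$ (i, j)" by simp
  qed simp
  then have "(\<Sum>j<2 ^ k. (lifted M k $$ (i, j) * z j)\<^sup>2) = 1"
    by (simp add: unit)
  then show ?thesis
    unfolding q_poly_def sum_subsets_3 g_def lin_form_def by (simp add: he_3 field_simps)
qed

text \<open>The cubic power sum has 2^k terms, each of order 2^(-3k/2).\<close>

lemma q_poly_remainder:
  assumes M: "M \<in> carrier_mat n n" and "i < n" and n: "n \<le> 2 ^ k" and z: "z \<in> hypercube (2 ^ k)"
  shows "\<bar>2 / 3 * (\<Sum>j<2 ^ k. (lifted M k $$ (i, j) * z j) ^ 3)\<bar> \<le> row_bound M ^ 3 / sqrt (2 ^ k)"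
proof -
  have rb: "row_bound M \<ge> 0"
    by (auto simp: row_bound_def intro!: sum_nonneg)
  have "\<bar>\<Sum>j<2 ^ k. (lifted M k $$ (i, j) * z j) ^ 3\<bar> \<le> (\<Sum>j<(2::nat) ^ k. (row_bound M / sqrt (2 ^ k)) ^ 3)"
  proof (intro order.trans[OF sum_abs] sum_mono)
    fix j :: nat assume "j \<in> {..<2 ^ k}"
    then have "\<bar>lifted M k $$ (i, j) * z j\<bar> \<le> row_bound M / sqrt (2 ^ k)"
      using lifted_abs_le[OF M assms(2) _ n] hypercube_abs[OF z] by (simp add: abs_mult)
    then show "\<bar>(lifted M k $$ (i, j) * z j) ^ 3\<bar> \<le> (row_bound M / sqrt (2 ^ k)) ^ 3"
      unfolding power_abs by (intro power_mono) auto
  qed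
  also have "\<dots> = (sqrt (2 ^ k) * sqrt (2 ^ k)) * (row_bound M / sqrt (2 ^ k)) ^ 3"
    by simp
  also have "\<dots> = row_bound M ^ 3 / sqrt (2 ^ k)"
    by (simp add: field_simps power3_eq_cube)
  finally have "\<bar>\<Sum>j<2 ^ k. (lifted M k $$ (i, j) * z j) ^ 3\<bar> \<le> row_bound M ^ 3 / sqrt (2 ^ k)" .
  moreover have "\<bar>2 / 3 * (\<Sum>j<2 ^ k. (lifted M k $$ (i, j) * z j) ^ 3)\<bar> =
     2 / 3 * \<bar>\<Sum>j<2 ^ k. (lifted M k $$ (i, j) * z j) ^ 3\<bar>"
    by (simp add: abs_mult)
  ultimately show ?thesis by linarith
qed

text \<open>The factors are exchanged one at a time. As \<open>1 \<le> G s\<close> and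
  \<open>\<delta> \<le> 1\<close>, an exchanged factor is at most \<open>2 * G s\<close> in modulus,
  so the bounds of the factors multiply.\<close>

lemma prod_perturb:
  fixes Q R G :: "nat \<Rightarrow> real"
  assumes "\<And>s. s < m \<Longrightarrow> \<bar>Q s\<bar> \<le> G s" "\<And>s. s < m \<Longrightarrow> 1 \<le> G s" "\<And>s. s < m \<Longrightarrow> \<bar>R s - Q s\<bar> \<le> \<delta>" "\<delta> \<le> 1"
  shows "\<bar>(\<Prod>s<m. R s) - (\<Prod>s<m. Q s)\<bar> \<le> \<delta> * real m * (\<Prod>s<m. 2 * G s)"
  using assms(1-3)
proof (induction m)
  case (Suc m)
  let ?P = "\<Prod>s<m. 2 * G s"
  have \<delta>: "0 \<le> \<delta>" using Suc.prems(3)[of 0] by force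
  have G: "1 \<le> G m" "\<bar>Q m\<bar> \<le> G m" "\<bar>R m - Q m\<bar> \<le> \<delta>"
    using Suc.prems by auto
  have P: "0 \<le> ?P"
    using Suc.prems(2) by (intro prod_nonneg) (force simp: less_Suc_eq)
  have Qp: "\<bar>\<Prod>s<m. Q s\<bar> \<le> ?P"
    unfolding abs_prod using Suc.prems(1,2) by (intro prod_mono) (force simp: less_Suc_eq)
  have IH: "\<bar>(\<Prod>s<m. R s) - (\<Prod>s<m. Q s)\<bar> \<le> \<delta> * real m * ?P"
    using Suc.prems by (intro Suc.IH) auto
  have "(\<Prod>s<Suc m. R s) - (\<Prod>s<Suc m. Q s) =
     ((\<Prod>s<m. R s) - (\<Prod>s<m. Q s)) * R m + (\<Prod>s<m. Q s) * (R m - Q m)"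
    by (simp add: algebra_simps)
  also have "\<bar>\<dots>\<bar> \<le> \<bar>((\<Prod>s<m. R s) - (\<Prod>s<m. Q s)) * R m\<bar> + \<bar>(\<Prod>s<m. Q s) * (R m - Q m)\<bar>"
    by (rule abs_triangle_ineq)
  also have "\<dots> \<le> \<delta> * real m * ?P * (2 * G m) + ?P * \<delta>"
    unfolding abs_mult using G IH P Qp \<delta> assms(4) by (intro add_mono mult_mono) auto
  also have "?P * \<delta> \<le> ?P * \<delta> * (2 * G m)"
    using G P \<delta> mult_left_mono[of 1 "2 * G m" "?P * \<delta>"] by simp
  finally show ?case
    by (simp add: algebra_simps)
qed auto

text \<open>The size of the matrix can serve as threshold for the exponent, because
  \<open>n \<le> k\<close> implies \<open>n \<le> 2 ^ k\<close>, so that all \<open>n\<close>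
  Hadamard rows exist.\<close>

lemma gaussian_limit_lifted:
  assumes M: "M \<in> carrier_mat n n" and unit: "\<And>i. i < n \<Longrightarrow> (M * transpose_mat M) $$ (i, i) = 1"
    and r: "\<And>s. s < 4 \<Longrightarrow> r s < n"
  shows "gaussian_limit (\<lambda>k s j. lifted M k $$ (r s, j)) (row_bound M)
    (\<lambda>s t. (M * transpose_mat M) $$ (r s, r t)) n"
proof
  fix k s j t :: nat
  assume "n \<le> k"
  then have "n \<le> 2 ^ k"
    by (meson le_trans less_exp less_or_eq_imp_le)
  then show "\<bar>lifted M k $$ (r s, j)\<bar> \<le> row_bound M / sqrt (2 ^ k)" if "s < 4" "j < 2 ^ k"
    using lifted_abs_le[OF M r] that by blast
  show "(\<Sum>j<2 ^ k. lifted M k $$ (r s, j) * lifted M k $$ (r t, j)) = (M * transpose_mat M) $$ (r s, r t)"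
    if "s < 4" "t < 4"
    using lifted_cov[OF M r r \<open>n \<le> 2 ^ k\<close>] that by blast
qed (use unit r in blast)

lemma cube_avg_q_poly_tendsto:
  assumes M: "M \<in> carrier_mat n n" and unit: "\<And>i. i < n \<Longrightarrow> (M * transpose_mat M) $$ (i, i) = 1"
    and r: "\<And>s. s < 4 \<Longrightarrow> r s < n" and m: "m \<le> 4"
    and lim: "(\<lambda>k. gaussian_limit.avg (\<lambda>k s j. lifted M k $$ (r s, j)) k
        (\<lambda>x. \<Prod>s<m. he 1 (x s) - he 3 (x s) / 3)) \<longlonglongrightarrow> l"
  shows "(\<lambda>k. cube_avg (2 ^ k) (\<lambda>z. \<Prod>s<m. q_poly M k (r s) z)) \<longlonglongrightarrow> l"
proof (rule tendsto_of_diff[OF _ lim])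
  interpret gaussian_limit "\<lambda>k s j. lifted M k $$ (r s, j)" "row_bound M"
    "\<lambda>s t. (M * transpose_mat M) $$ (r s, r t)" n
    by (rule gaussian_limit_lifted[OF M unit r])
  define Q where "Q x = he 1 x - he 3 x / 3" for x
  define \<delta> where "\<delta> k = row_bound M ^ 3 / sqrt (2 ^ k)" for k :: nat
  \<comment> \<open>At most four factors are exchanged, each with weight 36 = 2 * 18, where 18 = 9 +
    9 comes from \<open>he_bound\<close> in degrees one and three. The last factor is the bound of
    \<open>avg_growth\<close> for exponent one.\<close>
  define K :: real where "K = 4 * 36 ^ 4 * (8 * exp 16)"
  have \<delta>0: "\<delta> k \<ge> 0" for k
    using B_nonneg by (simp add: \<delta>_def)
  have bound: "\<bar>cube_avg (2 ^ k) (\<lambda>z. \<Prod>s<m. q_poly M k (r s) z) - avg k (\<lambda>x. \<Prod>s<m. Q (x s))\<bar> \<le> K * row_bound M ^ 3 / sqrt (2 ^ k)"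
    if k: "k \<ge> n" "\<delta> k \<le> 1" for k
  proof -
    have nk: "n \<le> 2 ^ k"
      using k(1) by (meson le_trans less_exp less_or_eq_imp_le)
    have "\<bar>cube_avg (2 ^ k) (\<lambda>z. \<Prod>s<m. q_poly M k (r s) z) - avg k (\<lambda>x. \<Prod>s<m. Q (x s))\<bar> =
       \<bar>cube_avg (2 ^ k) (\<lambda>z. (\<Prod>s<m. q_poly M k (r s) z) - (\<Prod>s<m. Q (g k z s)))\<bar>"
      by (simp add: avg_def cube_avg_diff)
    also have "\<dots> \<le> cube_avg (2 ^ k) (\<lambda>z. (\<delta> k * (4 * 36 ^ 4)) * growth 1 (g k z))"
    proof (rule order.trans[OF cube_avg_abs_le cube_avg_mono])
      fix z assume z: "z \<in> hypercube (2 ^ k)"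
      let ?G = "\<lambda>s. 18 * exp \<bar>g k z s\<bar>"
      have "\<bar>(\<Prod>s<m. q_poly M k (r s) z) - (\<Prod>s<m. Q (g k z s))\<bar> \<le> \<delta> k * real m * (\<Prod>s<m. 2 * ?G s)"
      proof (rule prod_perturb)
        fix s assume "s < m"
        then have s: "s < 4" "r s < n" using m r by auto
        have "\<bar>Q (g k z s)\<bar> \<le> \<bar>he 1 (g k z s)\<bar> + \<bar>he 3 (g k z s)\<bar>"
          unfolding Q_def by linarith
        then show "\<bar>Q (g k z s)\<bar> \<le> ?G s"
          using he_bound[of 1 "g k z s"] he_bound[of 3 "g k z s"] by linarith
        have "1 \<le> exp \<bar>g k z s\<bar>" by simp
        then show "1 \<le> ?G s" by linarith
        have "(\<Sum>j<2 ^ k. lifted M k $$ (r s, j) * lifted M k $$ (r s, j)) = 1"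
          using cov[OF k(1) s(1) s(1)] local.unit[OF s(1)] by simp
        from q_poly_eq[OF z this] q_poly_remainder[OF M s(2) nk z]
        show "\<bar>q_poly M k (r s) z - Q (g k z s)\<bar> \<le> \<delta> k"
          by (simp add: Q_def g_def \<delta>_def)
      qed (rule k)
      also have "(\<Prod>s<m. 2 * ?G s) = 36 ^ m * exp (\<Sum>s<m. \<bar>g k z s\<bar>)"
        by (simp add: prod.distrib exp_sum power_mult_distrib[symmetric])
      also have "\<delta> k * real m * (36 ^ m * exp (\<Sum>s<m. \<bar>g k z s\<bar>)) \<le> \<delta> k * 4 * (36 ^ 4 * growth 1 (g k z))"
      proof (intro mult_mono)
        show "exp (\<Sum>s<m. \<bar>g k z s\<bar>) \<le> growth 1 (g k z)"
          using m by (auto simp: growth_def intro!: sum_mono2)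
        show "(36::real) ^ m \<le> 36 ^ 4"
          using m by (intro power_increasing) auto
      qed (use m \<delta>0 in auto)
      finally show "\<bar>(\<Prod>s<m. q_poly M k (r s) z) - (\<Prod>s<m. Q (g k z s))\<bar> \<le> (\<delta> k * (4 * 36 ^ 4)) * growth 1 (g k z)"
        by simp
    qed
    also have "\<dots> \<le> (\<delta> k * (4 * 36 ^ 4)) * (8 * exp (16 * 1\<^sup>2))"
      unfolding cube_avg_cmult
      by (rule mult_left_mono[OF avg_growth[OF k(1), unfolded avg_def]]) (use \<delta>0 in auto)
    also have "\<dots> = K * row_bound M ^ 3 / sqrt (2 ^ k)"
      by (simp add: \<delta>_def K_def)
    finally show ?thesis .
  qed
  have "eventually (\<lambda>k. \<delta> k < 1) sequentially"
    using tendsto_const_div_sqrt_power2[of "row_bound M ^ 3"] unfolding \<delta>_def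
    by (rule order_tendstoD) simp
  then have "eventually (\<lambda>k. norm (cube_avg (2 ^ k) (\<lambda>z. \<Prod>s<m. q_poly M k (r s) z) -
      avg k (\<lambda>x. \<Prod>s<m. Q (x s))) \<le> K * row_bound M ^ 3 / sqrt (2 ^ k)) sequentially"
    using eventually_ge_at_top[of n] by eventually_elim (use bound in auto)
  then show "(\<lambda>k. cube_avg (2 ^ k) (\<lambda>z. \<Prod>s<m. q_poly M k (r s) z) -
      avg k (\<lambda>x. \<Prod>s<m. he 1 (x s) - he 3 (x s) / 3)) \<longlonglongrightarrow> 0"
    unfolding Q_def by (rule Lim_null_comparison[OF _ tendsto_const_div_sqrt_power2])
qed

section \<open>Evaluation of the limiting moments\<close>

definition limit_moment :: "real mat \<Rightarrow> nat set \<Rightarrow> real" where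
  "limit_moment M U = lim (\<lambda>k. cube_avg (2 ^ k) (q_set M k U))"

lemma moment_matrix_eq: "moment_matrix M S T = limit_moment M (sym_diff S T)"
  by (simp add: moment_matrix_def limit_moment_def expectation_hypercube)

lemma limit_moment_empty: "limit_moment M {} = 1"
  by (simp add: limit_moment_def q_set_def[abs_def] cube_avg_const)

lemma q_poly_uminus: "q_poly M k i (\<lambda>j\<in>{..<2 ^ k}. - z j) = - q_poly M k i z"
proof -
  let ?n = "\<lambda>j\<in>{..<2 ^ k}. - z j"
  have 1: "(\<Sum>j<2 ^ k. lifted M k $$ (i, j) * ?n j) = - (\<Sum>j<2 ^ k. lifted M k $$ (i, j) * z j)"
    by (simp add: sum_negf[symmetric])
  have "(\<Sum>J | J \<subseteq> {..<2 ^ k} \<and> card J = 3. \<Prod>j\<in>J. lifted M k $$ (i, j) * ?n j) =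
      (\<Sum>J | J \<subseteq> {..<2 ^ k} \<and> card J = 3. - (\<Prod>j\<in>J. lifted M k $$ (i, j) * z j))"
  proof (rule sum.cong)
    fix J :: "nat set" assume J: "J \<in> {J. J \<subseteq> {..<2 ^ k} \<and> card J = 3}"
    have "(\<Prod>j\<in>J. lifted M k $$ (i, j) * ?n j) = (\<Prod>j\<in>J. (- 1) * (lifted M k $$ (i, j) * z j))"
      using J by (intro prod.cong) auto
    also have "\<dots> = (- 1) ^ card J * (\<Prod>j\<in>J. lifted M k $$ (i, j) * z j)"
      by (simp only: prod.distrib prod_constant)
    finally show "(\<Prod>j\<in>J. lifted M k $$ (i, j) * ?n j) = - (\<Prod>j\<in>J. lifted M k $$ (i, j) * z j)"
      using J by simp
  qed simp
  then show ?thesis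
    unfolding q_poly_def 1 by (simp add: sum_negf)
qed

text \<open>Every q_i has only terms of odd degree in \<open>z\<close>, so an odd number of factors
  changes sign under negation of \<open>z\<close>; already the averages at finite \<open>k\<close>
  vanish.\<close>

lemma limit_moment_odd:
  assumes "odd (card U)"
  shows "limit_moment M U = 0"
proof -
  have "cube_avg (2 ^ k) (q_set M k U) = 0" for k
  proof (rule cube_avg_odd)
    fix z
    have "q_set M k U (\<lambda>j\<in>{..<2 ^ k}. - z j) = (\<Prod>i\<in>U. (- 1) * q_poly M k i z)"
      by (simp add: q_set_def q_poly_uminus)
    also have "\<dots> = (- 1) ^ card U * q_set M k U z"
      by (simp only: prod.distrib prod_constant q_set_def)
    finally show "q_set M k U (\<lambda>j\<in>{..<2 ^ k}. - z j) = - q_set M k U z"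
      using assms by simp
  qed
  then show ?thesis
    by (simp add: limit_moment_def)
qed

lemma limit_moment_2:
  assumes M: "M \<in> carrier_mat n n" and diag: "\<And>i. i < n \<Longrightarrow> (M * transpose_mat M) $$ (i, i) = 1"
    and "i < n" "j < n" "i \<noteq> j"
  shows "limit_moment M {i, j} = moment2 ((M * transpose_mat M) $$ (i, j))"
proof -
  \<comment> \<open>All four slots have to be filled with valid rows. The last two repeat
    \<open>j\<close>; the product that is averaged involves only the first two.\<close>
  define r where "r s = (if s = 0 then i else j)" for s :: nat
  have r: "r s < n" for s using assms by (simp add: r_def)
  interpret gaussian_limit "\<lambda>k s j. lifted M k $$ (r s, j)" "row_bound M"
    "\<lambda>s t. (M * transpose_mat M) $$ (r s, r t)" n
    by (rule gaussian_limit_lifted[OF M diag r])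
  have 2: "{..<2::nat} = {0, 1}" by auto
  have "q_set M k {i, j} = (\<lambda>z. \<Prod>s<2. q_poly M k (r s) z)" for k
    unfolding 2 using assms by (auto simp: q_set_def r_def fun_eq_iff)
  then have "(\<lambda>k. cube_avg (2 ^ k) (q_set M k {i, j})) \<longlonglongrightarrow> moment2 ((M * transpose_mat M) $$ (r 0, r 1))"
    using cube_avg_q_poly_tendsto[OF M diag r _ avg_prod2_tendsto[unfolded wick_sum2]] by simp
  then show ?thesis
    unfolding limit_moment_def by (simp add: limI r_def)
qed

lemma limit_moment_4:
  assumes M: "M \<in> carrier_mat n n" and diag: "\<And>i. i < n \<Longrightarrow> (M * transpose_mat M) $$ (i, i) = 1"
    and "i < n" "j < n" "k < n" "l < n" "distinct [i, j, k, l]"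
  defines "X \<equiv> \<lambda>i j. (M * transpose_mat M) $$ (i, j)"
  shows "limit_moment M {i, j, k, l} = moment2 (X i j) * moment2 (X k l)
     + gram4 (X i j) (X k l) (X i k) (X j l) (X i l) (X j k)
     + err4 (X i j) (X k l) (X i k) (X j l) (X i l) (X j k)"
proof -
  define r where "r s = (if s = 0 then i else if s = 1 then j else if s = 2 then k else l)" for s :: nat
  have r: "r s < n" for s using assms by (simp add: r_def)
  interpret gaussian_limit "\<lambda>k s j. lifted M k $$ (r s, j)" "row_bound M"
    "\<lambda>s t. (M * transpose_mat M) $$ (r s, r t)" n
    by (rule gaussian_limit_lifted[OF M diag r])
  have 4: "{..<4::nat} = {0, 1, 2, 3}" by auto
  have "q_set M \<kappa> {i, j, k, l} = (\<lambda>z. \<Prod>s<4. q_poly M \<kappa> (r s) z)" for \<kappa>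
    unfolding 4 using assms(7) by (auto simp: q_set_def r_def fun_eq_iff)
  then have "(\<lambda>\<kappa>. cube_avg (2 ^ \<kappa>) (q_set M \<kappa> {i, j, k, l})) \<longlonglongrightarrow>
     moment2 (X (r 0) (r 1)) * moment2 (X (r 2) (r 3))
     + gram4 (X (r 0) (r 1)) (X (r 2) (r 3)) (X (r 0) (r 2)) (X (r 1) (r 3)) (X (r 0) (r 3)) (X (r 1) (r 2))
     + err4 (X (r 0) (r 1)) (X (r 2) (r 3)) (X (r 0) (r 2)) (X (r 1) (r 3)) (X (r 0) (r 3)) (X (r 1) (r 2))"
    using cube_avg_q_poly_tendsto[OF M diag r _ avg_prod_tendsto[unfolded wick_sum4]]
    unfolding X_def by simp
  then show ?thesis
    unfolding limit_moment_def by (simp add: limI r_def)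
qed

section \<open>Error terms\<close>

text \<open>\<open>A\<close> stands for the off-diagonal part of X, and \<open>V\<close> for the
  coefficients of a test vector on pairs, spread over ordered pairs with zero diagonal. The
  constants \<open>\<mu>\<close>, \<open>\<rho>\<close>, \<open>\<sigma>\<close> bound the entries,
  the rows and the spectral norm of \<open>A\<close>.\<close>

locale error_bound =
  fixes n :: nat and A V :: "nat \<Rightarrow> nat \<Rightarrow> real" and \<mu> \<rho> \<sigma> :: real
  assumes A_sym: "A i j = A j i"
    and V_sym: "V i j = V j i"
    and A_le: "\<bar>A i j\<bar> \<le> \<mu>"
    and \<mu>_le_1: "\<mu> \<le> 1"
    and row: "(\<Sum>j<n. (A i j)\<^sup>2) \<le> \<rho>\<^sup>2"
    and spec: "(\<Sum>i<n. (\<Sum>j<n. A i j * y j)\<^sup>2) \<le> \<sigma>\<^sup>2 * (\<Sum>j<n. (y j)\<^sup>2)"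
    and V_diag: "V i i = 0"
    and \<rho>_nonneg: "0 \<le> \<rho>" and \<sigma>_nonneg: "0 \<le> \<sigma>"
begin

definition fro :: "(nat \<Rightarrow> nat \<Rightarrow> real) \<Rightarrow> real" where
  "fro W = (\<Sum>i<n. \<Sum>j<n. (W i j)\<^sup>2)"

definition form :: "(nat \<Rightarrow> nat \<Rightarrow> nat \<Rightarrow> nat \<Rightarrow> real) \<Rightarrow> real" where
  "form f = (\<Sum>i<n. \<Sum>j<n. \<Sum>k<n. \<Sum>l<n. V i j * V k l * f i j k l)"

definition bnd :: "real \<Rightarrow> (nat \<Rightarrow> nat \<Rightarrow> nat \<Rightarrow> nat \<Rightarrow> real) \<Rightarrow> bool" where
  "bnd K f \<longleftrightarrow> \<bar>form f\<bar> \<le> K * fro V"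

lemma \<mu>_nonneg: "0 \<le> \<mu>"
  using A_le[of 0 0] by linarith

lemma fro_nonneg: "0 \<le> fro W"
  by (simp add: fro_def sum_nonneg)

lemma fro_transpose: "fro (\<lambda>i j. W j i) = fro W"
  unfolding fro_def by (rule sum.swap)

lemma bnd_mono: "bnd K f \<Longrightarrow> K \<le> L \<Longrightarrow> bnd L f"
  unfolding bnd_def using mult_right_mono[of K L "fro V"] fro_nonneg[of V] by linarith

lemma bnd_add: "bnd K f \<Longrightarrow> bnd L g \<Longrightarrow> bnd (K + L) (\<lambda>i j k l. f i j k l + g i j k l)"
  unfolding bnd_def form_def by (simp add: distrib_left distrib_right sum.distrib)

lemma bnd_cmult:
  assumes "bnd K f"
  shows "bnd (\<bar>c\<bar> * K) (\<lambda>i j k l. c * f i j k l)"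
proof -
  have "form (\<lambda>i j k l. c * f i j k l) = c * form f"
    by (simp add: form_def sum_distrib_left mult_ac)
  then show ?thesis
    using assms mult_left_mono[of "\<bar>form f\<bar>" "K * fro V" "\<bar>c\<bar>"] by (simp add: bnd_def abs_mult mult.assoc)
qed

lemma bnd_swap12: "bnd K f \<Longrightarrow> bnd K (\<lambda>i j k l. f j i k l)"
proof -
  have "form (\<lambda>i j k l. f j i k l) = (\<Sum>i<n. \<Sum>j<n. \<Sum>k<n. \<Sum>l<n. V j i * V k l * f j i k l)"
    unfolding form_def by (subst V_sym) simp
  also have "\<dots> = form f"
    unfolding form_def by (rule sum.swap)
  finally show "bnd K f \<Longrightarrow> bnd K (\<lambda>i j k l. f j i k l)"
    by (simp add: bnd_def)
qed

lemma bnd_swap_pairs: "bnd K f \<Longrightarrow> bnd K (\<lambda>i j k l. f k l i j)"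
proof -
  have "form (\<lambda>i j k l. f k l i j) = (\<Sum>i<n. \<Sum>j<n. \<Sum>k<n. \<Sum>l<n. V k l * V i j * f k l i j)"
    unfolding form_def by (simp add: mult_ac)
  also have "\<dots> = (\<Sum>i<n. \<Sum>k<n. \<Sum>j<n. \<Sum>l<n. V k l * V i j * f k l i j)"
    by (rule sum.cong[OF refl sum.swap])
  also have "\<dots> = (\<Sum>k<n. \<Sum>i<n. \<Sum>j<n. \<Sum>l<n. V k l * V i j * f k l i j)"
    by (rule sum.swap)
  also have "\<dots> = (\<Sum>k<n. \<Sum>i<n. \<Sum>l<n. \<Sum>j<n. V k l * V i j * f k l i j)"
    by (rule sum.cong[OF refl], rule sum.cong[OF refl], rule sum.swap)
  also have "\<dots> = form f"
    unfolding form_def by (rule sum.cong[OF refl], rule sum.swap)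
  finally show "bnd K f \<Longrightarrow> bnd K (\<lambda>i j k l. f k l i j)"
    by (simp add: bnd_def)
qed

lemma bnd_swap34: "bnd K f \<Longrightarrow> bnd K (\<lambda>i j k l. f i j l k)"
  using bnd_swap_pairs[OF bnd_swap12[OF bnd_swap_pairs[of K f]]] .

lemma bnd_cong: "bnd K f \<Longrightarrow> (\<And>i j k l. g i j k l = f i j k l) \<Longrightarrow> bnd K g"
  by (simp add: bnd_def form_def)

lemma cauchy_vec:
  assumes "(\<Sum>i<n. (x i)\<^sup>2) \<le> p\<^sup>2 * N" "(\<Sum>i<n. (y i)\<^sup>2) \<le> r\<^sup>2 * N" "0 \<le> p" "0 \<le> r" "0 \<le> N"
  shows "\<bar>\<Sum>i<n. x i * y i :: real\<bar> \<le> p * r * N"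
proof -
  have "(\<Sum>i<n. x i * y i)\<^sup>2 \<le> (\<Sum>i<n. (x i)\<^sup>2) * (\<Sum>i<n. (y i)\<^sup>2)"
    by (rule Cauchy_Schwarz_ineq_sum)
  also have "\<dots> \<le> (p\<^sup>2 * N) * (r\<^sup>2 * N)"
    using assms by (intro mult_mono) (auto intro!: sum_nonneg)
  also have "\<dots> = (p * r * N)\<^sup>2"
    by (simp add: power2_eq_square)
  finally have "\<bar>\<Sum>i<n. x i * y i\<bar>\<^sup>2 \<le> (p * r * N)\<^sup>2"
    by simp
  then show ?thesis
    by (rule power2_le_imp_le) (use assms in auto)
qed

lemma cauchy_fro:
  assumes "fro P \<le> p\<^sup>2 * N" "fro R \<le> r\<^sup>2 * N" "0 \<le> p" "0 \<le> r" "0 \<le> N"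
  shows "\<bar>\<Sum>i<n. \<Sum>j<n. P i j * R i j\<bar> \<le> p * r * N"
proof -
  let ?I = "{..<n} \<times> {..<n}"
  have "(\<Sum>i<n. \<Sum>j<n. P i j * R i j)\<^sup>2 = (\<Sum>x\<in>?I. P (fst x) (snd x) * R (fst x) (snd x))\<^sup>2"
    by (simp add: sum.cartesian_product split_beta)
  also have "\<dots> \<le> (\<Sum>x\<in>?I. (P (fst x) (snd x))\<^sup>2) * (\<Sum>x\<in>?I. (R (fst x) (snd x))\<^sup>2)"
    by (rule Cauchy_Schwarz_ineq_sum)
  also have "\<dots> = fro P * fro R"
    by (simp add: fro_def sum.cartesian_product split_beta)
  also have "\<dots> \<le> (p\<^sup>2 * N) * (r\<^sup>2 * N)"
    using assms by (intro mult_mono) (auto simp: fro_nonneg)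
  also have "\<dots> = (p * r * N)\<^sup>2"
    by (simp add: power2_eq_square)
  finally have "\<bar>\<Sum>i<n. \<Sum>j<n. P i j * R i j\<bar>\<^sup>2 \<le> (p * r * N)\<^sup>2"
    by simp
  then show ?thesis
    by (rule power2_le_imp_le) (use assms in auto)
qed

lemma fro_mult_A: "fro (\<lambda>i k. \<Sum>j<n. W i j * A j k) \<le> \<sigma>\<^sup>2 * fro W"
proof -
  have "(\<Sum>k<n. (\<Sum>j<n. W i j * A j k)\<^sup>2) \<le> \<sigma>\<^sup>2 * (\<Sum>j<n. (W i j)\<^sup>2)" for i
    using spec[of "W i"] by (simp add: A_sym mult.commute)
  then have "fro (\<lambda>i k. \<Sum>j<n. W i j * A j k) \<le> (\<Sum>i<n. \<sigma>\<^sup>2 * (\<Sum>j<n. (W i j)\<^sup>2))"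
    unfolding fro_def by (intro sum_mono)
  then show ?thesis
    by (simp only: fro_def sum_distrib_left)
qed

lemma fro_A_mult: "fro (\<lambda>i k. \<Sum>j<n. A i j * W j k) \<le> \<sigma>\<^sup>2 * fro W"
proof -
  have "(\<lambda>i k. \<Sum>j<n. A i j * W j k) = (\<lambda>i k. \<Sum>j<n. W j k * A j i)"
    by (simp add: A_sym mult.commute)
  then have "fro (\<lambda>i k. \<Sum>j<n. A i j * W j k) = fro (\<lambda>k i. \<Sum>j<n. W j k * A j i)"
    by (simp only: fro_transpose[of "\<lambda>k i. \<Sum>j<n. W j k * A j i"])
  also have "\<dots> \<le> \<sigma>\<^sup>2 * fro (\<lambda>k j. W j k)"
    by (rule fro_mult_A)
  finally show ?thesis
    by (simp only: fro_transpose[of W])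
qed

lemma fro_scale:
  assumes "\<And>i j. \<bar>f i j\<bar> \<le> c"
  shows "fro (\<lambda>i j. f i j * W i j) \<le> c\<^sup>2 * fro W"
proof -
  have "(f i j)\<^sup>2 \<le> c\<^sup>2" for i j
    using assms[of i j] by (metis abs_ge_zero power2_abs power_mono)
  then show ?thesis
    unfolding fro_def sum_distrib_left power_mult_distrib
    by (intro sum_mono mult_right_mono) auto
qed

lemma A2_le: "\<bar>(A i j)\<^sup>2\<bar> \<le> \<mu>\<^sup>2"
  using power_mono[OF A_le[of i j], of 2] by simp

lemma A_row_swap: "(\<Sum>j<n. (A j i)\<^sup>2) \<le> \<rho>\<^sup>2"
  using row[of i] by (simp add: A_sym)

text \<open>As matrices, this is the Frobenius product of P with A R A, and each multiplication by A
  costs a factor \<open>\<sigma>\<close> in Frobenius norm.\<close>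

lemma bilinear_bound:
  assumes "fro P \<le> p\<^sup>2 * fro V" "fro R \<le> r\<^sup>2 * fro V" "0 \<le> p" "0 \<le> r"
  shows "\<bar>\<Sum>i<n. \<Sum>j<n. \<Sum>k<n. \<Sum>l<n. P i j * R k l * (A i k * A j l)\<bar> \<le> p * (\<sigma>\<^sup>2 * r) * fro V"
proof -
  let ?Q = "\<lambda>i j. \<Sum>k<n. A i k * (\<Sum>l<n. R k l * A l j)"
  have "fro ?Q \<le> \<sigma>\<^sup>2 * (\<sigma>\<^sup>2 * fro R)"
    by (intro order.trans[OF fro_A_mult] mult_left_mono fro_mult_A) auto
  also have "\<dots> \<le> \<sigma>\<^sup>2 * (\<sigma>\<^sup>2 * (r\<^sup>2 * fro V))"
    using assms by (intro mult_left_mono) auto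
  finally have "fro ?Q \<le> (\<sigma>\<^sup>2 * r)\<^sup>2 * fro V"
    by (simp add: power2_eq_square mult_ac)
  then have "\<bar>\<Sum>i<n. \<Sum>j<n. P i j * ?Q i j\<bar> \<le> p * (\<sigma>\<^sup>2 * r) * fro V"
    using assms by (intro cauchy_fro) (auto simp: fro_nonneg)
  then show ?thesis
    by (simp add: sum_distrib_left A_sym mult_ac)
qed

lemma fro_V_A2: "fro (\<lambda>i j. (A i j)\<^sup>2 * V i j) \<le> (\<mu>\<^sup>2)\<^sup>2 * fro V"
  by (rule fro_scale[OF A2_le])

text \<open>
  The letters in the names below are the arguments of \<open>err4\<close>.
\<close>

lemma bnd_aacd: "bnd (\<mu>\<^sup>2 * \<sigma>\<^sup>2) (\<lambda>i j k l. (A i j)\<^sup>2 * (A i k * A j l))"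
  using bilinear_bound[OF fro_V_A2, of V 1] by (simp add: bnd_def form_def mult_ac)

lemma bnd_aabbcd: "bnd (\<mu>\<^sup>2 * (\<sigma>\<^sup>2 * \<mu>\<^sup>2)) (\<lambda>i j k l. (A i j)\<^sup>2 * (A k l)\<^sup>2 * (A i k * A j l))"
  using bilinear_bound[OF fro_V_A2 fro_V_A2] by (simp add: bnd_def form_def mult_ac)

lemma fro_VA: "fro (\<lambda>i k. \<Sum>j<n. V i j * A j k) \<le> \<sigma>\<^sup>2 * fro V"
  by (rule fro_mult_A)

lemma fro_VA': "fro (\<lambda>k i. \<Sum>j<n. V i j * A j k) \<le> \<sigma>\<^sup>2 * fro V"
  unfolding fro_transpose[of "\<lambda>i k. \<Sum>j<n. V i j * A j k"] by (rule fro_VA)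

text \<open>Summing over j and over l are two matrix products with A. What remains is the Frobenius
  product of V A, weighted by the squared entries of A, with the transpose of V A.\<close>

lemma bnd_ccef: "bnd (\<mu>\<^sup>2 * \<sigma> * \<sigma>) (\<lambda>i j k l. (A i k)\<^sup>2 * (A i l * A j k))"
proof -
  let ?P = "\<lambda>i k. (A i k)\<^sup>2 * (\<Sum>j<n. V i j * A j k)" and ?R = "\<lambda>i k. \<Sum>l<n. V k l * A l i"
  have "fro ?P \<le> (\<mu>\<^sup>2)\<^sup>2 * (\<sigma>\<^sup>2 * fro V)"
    by (intro order.trans[OF fro_scale[OF A2_le]] mult_left_mono fro_VA) auto
  then have "fro ?P \<le> (\<mu>\<^sup>2 * \<sigma>)\<^sup>2 * fro V"
    by (simp add: power_mult_distrib mult_ac)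
  then have "\<bar>\<Sum>i<n. \<Sum>k<n. ?P i k * ?R i k\<bar> \<le> \<mu>\<^sup>2 * \<sigma> * \<sigma> * fro V"
    using \<mu>_nonneg \<sigma>_nonneg fro_VA' by (intro cauchy_fro) (auto simp: fro_nonneg)
  also have "(\<Sum>i<n. \<Sum>k<n. ?P i k * ?R i k) =
     (\<Sum>i<n. \<Sum>k<n. \<Sum>j<n. \<Sum>l<n. V i j * V k l * ((A i k)\<^sup>2 * (A i l * A j k)))"
    by (simp add: sum_distrib_left sum_product A_sym mult_ac)
  also have "\<dots> = form (\<lambda>i j k l. (A i k)\<^sup>2 * (A i l * A j k))"
    unfolding form_def by (rule sum.cong[OF refl sum.swap])
  finally show ?thesis
    by (simp add: bnd_def)
qed

text \<open>One entry of \<open>A\<close> pays for \<open>\<mu>\<close>. The others are split in the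
  Cauchy-Schwarz inequality over j: \<open>h\<close> is summed at once by its row bound, whereas
  \<open>A j k\<close> stays with \<open>V\<close> and is summed later, over k. This yields two
  factors \<open>\<rho>\<close>.\<close>

lemma weighted_row_bound:
  assumes f: "\<And>i j k. \<bar>f i j k\<bar> \<le> \<mu> * \<bar>A j k\<bar> * \<bar>h i j k\<bar>"
    and h: "\<And>i k. (\<Sum>j<n. (h i j k)\<^sup>2) \<le> \<rho>\<^sup>2"
  shows "fro (\<lambda>i k. \<Sum>j<n. V i j * f i j k) \<le> (\<mu> * \<rho>\<^sup>2)\<^sup>2 * fro V"
proof -
  have "(\<Sum>j<n. V i j * f i j k)\<^sup>2 \<le> \<mu>\<^sup>2 * \<rho>\<^sup>2 * (\<Sum>j<n. (V i j)\<^sup>2 * (A j k)\<^sup>2)" for i k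
  proof -
    have "\<bar>\<Sum>j<n. V i j * f i j k\<bar> \<le> (\<Sum>j<n. (\<mu> * (\<bar>V i j\<bar> * \<bar>A j k\<bar>)) * \<bar>h i j k\<bar>)"
      by (intro order.trans[OF sum_abs] sum_mono)
        (use mult_left_mono[OF f, of "\<bar>V i j\<bar>" for i j] in \<open>auto simp: abs_mult mult_ac\<close>)
    then have "(\<Sum>j<n. V i j * f i j k)\<^sup>2 \<le> (\<Sum>j<n. (\<mu> * (\<bar>V i j\<bar> * \<bar>A j k\<bar>)) * \<bar>h i j k\<bar>)\<^sup>2"
      using power_mono[of "\<bar>\<Sum>j<n. V i j * f i j k\<bar>" _ 2] by (simp only: abs_ge_zero power2_abs)
    also have "\<dots> \<le> (\<Sum>j<n. (\<mu> * (\<bar>V i j\<bar> * \<bar>A j k\<bar>))\<^sup>2) * (\<Sum>j<n. \<bar>h i j k\<bar>\<^sup>2)"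
      by (rule Cauchy_Schwarz_ineq_sum)
    also have "\<dots> \<le> (\<Sum>j<n. (\<mu> * (\<bar>V i j\<bar> * \<bar>A j k\<bar>))\<^sup>2) * \<rho>\<^sup>2"
      using h by (intro mult_left_mono sum_nonneg) auto
    also have "\<dots> = \<mu>\<^sup>2 * \<rho>\<^sup>2 * (\<Sum>j<n. (V i j)\<^sup>2 * (A j k)\<^sup>2)"
      by (simp add: power_mult_distrib sum_distrib_left sum_distrib_right mult_ac)
    finally show ?thesis .
  qed
  then have "fro (\<lambda>i k. \<Sum>j<n. V i j * f i j k) \<le>
      (\<Sum>i<n. \<Sum>k<n. \<mu>\<^sup>2 * \<rho>\<^sup>2 * (\<Sum>j<n. (V i j)\<^sup>2 * (A j k)\<^sup>2))"
    unfolding fro_def by (intro sum_mono)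
  also have "\<dots> = \<mu>\<^sup>2 * \<rho>\<^sup>2 * (\<Sum>i<n. \<Sum>k<n. \<Sum>j<n. (V i j)\<^sup>2 * (A j k)\<^sup>2)"
    by (simp add: sum_distrib_left)
  also have "(\<Sum>i<n. \<Sum>k<n. \<Sum>j<n. (V i j)\<^sup>2 * (A j k)\<^sup>2) = (\<Sum>i<n. \<Sum>j<n. (V i j)\<^sup>2 * (\<Sum>k<n. (A j k)\<^sup>2))"
    unfolding sum_distrib_left by (rule sum.cong[OF refl sum.swap])
  also have "\<dots> \<le> (\<Sum>i<n. \<Sum>j<n. (V i j)\<^sup>2 * \<rho>\<^sup>2)"
    by (intro sum_mono mult_left_mono row) auto
  also have "\<dots> = \<rho>\<^sup>2 * fro V"
    by (simp add: fro_def sum_distrib_left mult.commute)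
  finally have "fro (\<lambda>i k. \<Sum>j<n. V i j * f i j k) \<le> \<mu>\<^sup>2 * \<rho>\<^sup>2 * (\<rho>\<^sup>2 * fro V)"
    by (simp add: mult_left_mono)
  then show ?thesis
    by (simp add: power2_eq_square mult_ac)
qed

text \<open>The cubed entry supplies the three factors of \<open>weighted_row_bound\<close>, which
  handles the sum over i; the linear entry is contracted over l by the spectral norm.\<close>

lemma bnd_cccd: "bnd ((\<mu> * \<rho>\<^sup>2) * \<sigma>) (\<lambda>i j k l. (A i k) ^ 3 * A j l)"
proof -
  let ?P = "\<lambda>j k. \<Sum>i<n. V j i * (A i k) ^ 3" and ?R = "\<lambda>j k. \<Sum>l<n. V k l * A l j"
  have "\<bar>(A i k) ^ 3\<bar> \<le> \<mu> * \<bar>A i k\<bar> * \<bar>A i k\<bar>" for i k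
    using mult_right_mono[OF A_le, of "\<bar>A i k\<bar> * \<bar>A i k\<bar>" i k] by (simp add: power3_eq_cube abs_mult mult_ac)
  then have "fro ?P \<le> (\<mu> * \<rho>\<^sup>2)\<^sup>2 * fro V"
    by (rule weighted_row_bound[where h = "\<lambda>j i k. A i k"]) (rule A_row_swap)
  then have "\<bar>\<Sum>j<n. \<Sum>k<n. ?P j k * ?R j k\<bar> \<le> (\<mu> * \<rho>\<^sup>2) * \<sigma> * fro V"
    using \<mu>_nonneg \<sigma>_nonneg fro_VA' by (intro cauchy_fro) (auto simp: fro_nonneg)
  also have "(\<Sum>j<n. \<Sum>k<n. ?P j k * ?R j k) =
     (\<Sum>j<n. \<Sum>k<n. \<Sum>i<n. \<Sum>l<n. V i j * V k l * ((A i k) ^ 3 * A j l))"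
    by (simp only: sum_product, intro sum.cong refl) (simp add: A_sym V_sym mult_ac)
  also have "\<dots> = (\<Sum>j<n. \<Sum>i<n. \<Sum>k<n. \<Sum>l<n. V i j * V k l * ((A i k) ^ 3 * A j l))"
    by (rule sum.cong[OF refl sum.swap])
  also have "\<dots> = form (\<lambda>i j k l. (A i k) ^ 3 * A j l)"
    unfolding form_def by (rule sum.swap)
  finally show ?thesis
    by (simp add: bnd_def)
qed

text \<open>For fixed i the sum splits into a row sum over j and the diagonal entry at i of A W A,
  where W is V weighted by the squared entries of A. The diagonal is bounded by the whole Frobenius
  norm.\<close>

lemma bnd_acebb: "bnd (\<rho> * (\<sigma>\<^sup>2 * \<mu>\<^sup>2)) (\<lambda>i j k l. A i j * A i k * A i l * (A k l)\<^sup>2)"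
proof -
  let ?D = "\<lambda>i j. \<Sum>k<n. A i k * (\<Sum>l<n. ((A k l)\<^sup>2 * V k l) * A l j)"
  let ?x = "\<lambda>i. \<Sum>j<n. V i j * A i j"
  have "fro ?D \<le> \<sigma>\<^sup>2 * (\<sigma>\<^sup>2 * ((\<mu>\<^sup>2)\<^sup>2 * fro V))"
    by (intro order.trans[OF fro_A_mult] mult_left_mono order.trans[OF fro_mult_A] fro_V_A2) auto
  moreover have "(\<Sum>i<n. (?D i i)\<^sup>2) \<le> fro ?D"
    unfolding fro_def by (intro sum_mono member_le_sum[of _ "{..<n}" "\<lambda>j. (?D i j)\<^sup>2" for i]) auto
  ultimately have D: "(\<Sum>i<n. (?D i i)\<^sup>2) \<le> (\<sigma>\<^sup>2 * \<mu>\<^sup>2)\<^sup>2 * fro V"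
    by (simp add: power2_eq_square mult_ac)
  have "(?x i)\<^sup>2 \<le> (\<Sum>j<n. (V i j)\<^sup>2) * \<rho>\<^sup>2" for i
    by (intro order.trans[OF Cauchy_Schwarz_ineq_sum] mult_left_mono row sum_nonneg) auto
  then have "(\<Sum>i<n. (?x i)\<^sup>2) \<le> (\<Sum>i<n. (\<Sum>j<n. (V i j)\<^sup>2) * \<rho>\<^sup>2)"
    by (intro sum_mono)
  then have x: "(\<Sum>i<n. (?x i)\<^sup>2) \<le> \<rho>\<^sup>2 * fro V"
    by (simp add: fro_def sum_distrib_left sum_distrib_right mult.commute)
  have "\<bar>\<Sum>i<n. ?x i * ?D i i\<bar> \<le> \<rho> * (\<sigma>\<^sup>2 * \<mu>\<^sup>2) * fro V"
    by (rule cauchy_vec[OF x D]) (auto simp: \<rho>_nonneg fro_nonneg)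
  also have "(\<Sum>i<n. ?x i * ?D i i) = form (\<lambda>i j k l. A i j * A i k * A i l * (A k l)\<^sup>2)"
    unfolding form_def
    by (simp only: sum_product, simp only: sum_distrib_left, intro sum.cong refl) (simp add: A_sym mult_ac)
  finally show ?thesis
    by (simp add: bnd_def)
qed

text \<open>The sum over k is a product of V with A. The sum over j fits
  \<open>weighted_row_bound\<close>, with \<open>A i j\<close> as the entry that pays for
  \<open>\<mu>\<close>, and \<open>A i l\<close> gives a second \<open>\<mu>\<close>
  pointwise.\<close>

lemma bnd_acedd: "bnd (\<mu> * (\<mu> * \<rho>\<^sup>2) * \<sigma>) (\<lambda>i j k l. A i j * A i k * A i l * (A j l)\<^sup>2)"
proof -
  let ?P = "\<lambda>i l. A i l * (\<Sum>j<n. V i j * (A i j * (A j l)\<^sup>2))" and ?R = "\<lambda>i l. \<Sum>k<n. V l k * A k i"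
  have "\<bar>A i j * (A j l)\<^sup>2\<bar> \<le> \<mu> * \<bar>A j l\<bar> * \<bar>A j l\<bar>" for i j l
    using mult_right_mono[OF A_le, of "\<bar>A j l\<bar> * \<bar>A j l\<bar>" i j] by (simp add: power2_eq_square abs_mult mult_ac)
  then have "fro (\<lambda>i l. \<Sum>j<n. V i j * (A i j * (A j l)\<^sup>2)) \<le> (\<mu> * \<rho>\<^sup>2)\<^sup>2 * fro V"
    by (rule weighted_row_bound[where h = "\<lambda>i j l. A j l"]) (rule A_row_swap)
  then have "fro ?P \<le> \<mu>\<^sup>2 * ((\<mu> * \<rho>\<^sup>2)\<^sup>2 * fro V)"
    by (intro order.trans[OF fro_scale[OF A_le]] mult_left_mono) auto
  then have "fro ?P \<le> (\<mu> * (\<mu> * \<rho>\<^sup>2))\<^sup>2 * fro V"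
    by (simp add: power_mult_distrib mult_ac)
  then have "\<bar>\<Sum>i<n. \<Sum>l<n. ?P i l * ?R i l\<bar> \<le> \<mu> * (\<mu> * \<rho>\<^sup>2) * \<sigma> * fro V"
    using \<mu>_nonneg \<sigma>_nonneg fro_VA' by (intro cauchy_fro) (auto simp: fro_nonneg)
  also have "(\<Sum>i<n. \<Sum>l<n. ?P i l * ?R i l) =
     (\<Sum>i<n. \<Sum>l<n. \<Sum>j<n. \<Sum>k<n. V i j * V k l * (A i j * A i k * A i l * (A j l)\<^sup>2))"
    by (simp only: mult.assoc[of "A _ _"] sum_product, simp only: sum_distrib_left, intro sum.cong refl)
      (simp add: A_sym V_sym mult_ac)
  also have "\<dots> = (\<Sum>i<n. \<Sum>j<n. \<Sum>l<n. \<Sum>k<n. V i j * V k l * (A i j * A i k * A i l * (A j l)\<^sup>2))"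
    by (rule sum.cong[OF refl sum.swap])
  also have "\<dots> = form (\<lambda>i j k l. A i j * A i k * A i l * (A j l)\<^sup>2)"
    unfolding form_def by (rule sum.cong[OF refl], rule sum.cong[OF refl], rule sum.swap)
  finally show ?thesis
    by (simp add: bnd_def)
qed

section \<open>Collecting the error terms\<close>

definition \<gamma> :: real where
  "\<gamma> = \<mu> * (1 + \<rho> ^ 4) * (1 + \<sigma>\<^sup>2)"

lemma le_\<gamma>:
  assumes "p \<le> \<mu>" "q \<le> 1 + \<rho> ^ 4" "r \<le> 1 + \<sigma>\<^sup>2" "0 \<le> p" "0 \<le> q" "0 \<le> r"
  shows "p * q * r \<le> \<gamma>"
  unfolding \<gamma>_def using assms by (intro mult_mono) (auto intro: mult_nonneg_nonneg)

lemma \<gamma>_nonneg: "0 \<le> \<gamma>"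
  unfolding \<gamma>_def using \<mu>_nonneg by (intro mult_nonneg_nonneg) auto

lemma le_one_plus_square: "x \<le> 1 + (x::real)\<^sup>2"
proof -
  have "2 * x \<le> 1 + x\<^sup>2"
    using zero_le_power2[of "x - 1"] by (simp add: power2_diff)
  moreover have "0 \<le> x\<^sup>2" by simp
  ultimately show ?thesis by linarith
qed

lemma \<rho>_le: "1 \<le> 1 + \<rho> ^ 4" "\<rho>\<^sup>2 \<le> 1 + \<rho> ^ 4" "\<rho> \<le> 1 + \<rho> ^ 4" "\<rho> ^ 4 \<le> 1 + \<rho> ^ 4"
proof -
  show \<rho>2: "\<rho>\<^sup>2 \<le> 1 + \<rho> ^ 4"
    using le_one_plus_square[of "\<rho>\<^sup>2"] by simp
  show "\<rho> \<le> 1 + \<rho> ^ 4"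
  proof (cases "\<rho> \<le> 1")
    case True
    moreover have "0 \<le> \<rho> ^ 4" by simp
    ultimately show ?thesis by linarith
  next
    case False
    then have "\<rho> \<le> \<rho>\<^sup>2" by (simp add: power2_eq_square)
    with \<rho>2 show ?thesis by linarith
  qed
qed auto

lemma \<sigma>_le: "\<sigma> \<le> 1 + \<sigma>\<^sup>2" "\<sigma>\<^sup>2 \<le> 1 + \<sigma>\<^sup>2" "1 \<le> 1 + \<sigma>\<^sup>2"
  by (auto intro: le_one_plus_square)

lemma \<mu>_power_le: "\<mu>\<^sup>2 \<le> \<mu>" "\<mu>\<^sup>2 * \<mu>\<^sup>2 \<le> \<mu>"
proof -
  show 1: "\<mu>\<^sup>2 \<le> \<mu>"
    using \<mu>_nonneg \<mu>_le_1 by (simp add: power2_eq_square mult_left_le_one_le)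
  have "\<mu>\<^sup>2 * \<mu>\<^sup>2 \<le> \<mu> * 1"
    using 1 \<mu>_nonneg \<mu>_le_1 by (intro mult_mono) auto
  then show "\<mu>\<^sup>2 * \<mu>\<^sup>2 \<le> \<mu>" by simp
qed

text \<open>A Schur test: the inequality between the arithmetic and geometric mean decouples
  \<open>V i j\<close> from \<open>V k l\<close>, and then the majorant is summed over the indices
  of the other pair by two row bounds.\<close>

lemma bnd_abs:
  assumes f: "\<And>i j k l. \<bar>f i j k l\<bar> \<le> w * ((A i k)\<^sup>2 * (A j l)\<^sup>2 + (A i l)\<^sup>2 * (A j k)\<^sup>2)" and w: "0 \<le> w"
  shows "bnd (2 * w * \<rho> ^ 4) f"
proof -
  define h where "h i j k l = (A i k)\<^sup>2 * (A j l)\<^sup>2 + (A i l)\<^sup>2 * (A j k)\<^sup>2" for i j k l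
  define S where "S = (\<Sum>i<n. \<Sum>j<n. \<Sum>k<n. \<Sum>l<n. (V i j)\<^sup>2 * h i j k l)"
  have "(\<Sum>k<n. \<Sum>l<n. h i j k l) = 2 * ((\<Sum>k<n. (A i k)\<^sup>2) * (\<Sum>l<n. (A j l)\<^sup>2))" for i j
  proof -
    have "(\<Sum>k<n. \<Sum>l<n. (A i l)\<^sup>2 * (A j k)\<^sup>2) = (\<Sum>l<n. \<Sum>k<n. (A i l)\<^sup>2 * (A j k)\<^sup>2)"
      by (rule sum.swap)
    then show ?thesis
      by (simp add: h_def sum.distrib sum_product)
  qed
  then have "S = (\<Sum>i<n. \<Sum>j<n. (V i j)\<^sup>2 * (2 * ((\<Sum>k<n. (A i k)\<^sup>2) * (\<Sum>l<n. (A j l)\<^sup>2))))"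
    unfolding S_def by (simp only: sum_distrib_left[symmetric])
  also have "\<dots> \<le> (\<Sum>i<n. \<Sum>j<n. (V i j)\<^sup>2 * (2 * (\<rho>\<^sup>2 * \<rho>\<^sup>2)))"
    by (intro sum_mono mult_left_mono mult_mono row sum_nonneg) auto
  also have "\<dots> = 2 * \<rho> ^ 4 * fro V"
    by (simp add: fro_def sum_distrib_left mult_ac power2_eq_square power4_eq_xxxx)
  finally have S: "S \<le> 2 * \<rho> ^ 4 * fro V" .
  have S': "(\<Sum>i<n. \<Sum>j<n. \<Sum>k<n. \<Sum>l<n. (V k l)\<^sup>2 * h i j k l) = S"
  proof -
    have "(\<Sum>i<n. \<Sum>j<n. \<Sum>k<n. \<Sum>l<n. (V k l)\<^sup>2 * h i j k l) =
        (\<Sum>i<n. \<Sum>k<n. \<Sum>j<n. \<Sum>l<n. (V k l)\<^sup>2 * h i j k l)"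
      by (rule sum.cong[OF refl sum.swap])
    also have "\<dots> = (\<Sum>k<n. \<Sum>i<n. \<Sum>j<n. \<Sum>l<n. (V k l)\<^sup>2 * h i j k l)"
      by (rule sum.swap)
    also have "\<dots> = (\<Sum>k<n. \<Sum>i<n. \<Sum>l<n. \<Sum>j<n. (V k l)\<^sup>2 * h i j k l)"
      by (rule sum.cong[OF refl], rule sum.cong[OF refl], rule sum.swap)
    also have "\<dots> = (\<Sum>k<n. \<Sum>l<n. \<Sum>i<n. \<Sum>j<n. (V k l)\<^sup>2 * h i j k l)"
      by (rule sum.cong[OF refl], rule sum.swap)
    also have "\<dots> = S"
      unfolding S_def by (intro sum.cong refl) (simp add: h_def A_sym mult_ac)
    finally show ?thesis .
  qed
  have "\<bar>form f\<bar> \<le> (\<Sum>i<n. \<Sum>j<n. \<Sum>k<n. \<Sum>l<n. w / 2 * ((V i j)\<^sup>2 * h i j k l) + w / 2 * ((V k l)\<^sup>2 * h i j k l))"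
    unfolding form_def
  proof (intro order.trans[OF sum_abs] sum_mono)
    fix i j k l
    have "\<bar>V i j\<bar> * \<bar>V k l\<bar> \<le> ((V i j)\<^sup>2 + (V k l)\<^sup>2) / 2"
      using sum_squares_bound[of "\<bar>V i j\<bar>" "\<bar>V k l\<bar>"] by simp
    then have "\<bar>V i j * V k l * f i j k l\<bar> \<le> ((V i j)\<^sup>2 + (V k l)\<^sup>2) / 2 * (w * h i j k l)"
      unfolding abs_mult using f[folded h_def] by (intro mult_mono) auto
    then show "\<bar>V i j * V k l * f i j k l\<bar> \<le> w / 2 * ((V i j)\<^sup>2 * h i j k l) + w / 2 * ((V k l)\<^sup>2 * h i j k l)"
      by (simp add: field_simps)
  qed
  also have "\<dots> = w / 2 * S + w / 2 * S"
  proof -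
    have 1: "(\<Sum>i<n. \<Sum>j<n. \<Sum>k<n. \<Sum>l<n. w / 2 * ((V i j)\<^sup>2 * h i j k l)) = w / 2 * S"
      by (simp only: S_def sum_distrib_left)
    have 2: "(\<Sum>i<n. \<Sum>j<n. \<Sum>k<n. \<Sum>l<n. w / 2 * ((V k l)\<^sup>2 * h i j k l)) = w / 2 * S"
      unfolding S'[symmetric] by (simp only: sum_distrib_left)
    show ?thesis
      by (simp only: sum.distrib 1 2)
  qed
  also have "\<dots> \<le> w * (2 * \<rho> ^ 4 * fro V)"
    using mult_left_mono[OF S w] by (simp add: mult.commute)
  finally show ?thesis
    by (simp add: bnd_def mult_ac)
qed

text \<open>Shaped for left-nested sums: applied repeatedly as an introduction rule it peels off the
  long sum in \<open>bnd_err4\<close> and accumulates the constant.\<close>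

lemma bnd_\<gamma>_add: "bnd (c * \<gamma>) f \<Longrightarrow> bnd \<gamma> g \<Longrightarrow> bnd ((c + \<bar>t\<bar>) * \<gamma>) (\<lambda>i j k l. f i j k l + t * g i j k l)"
  unfolding distrib_right by (intro bnd_add bnd_cmult)

text \<open>The terms of \<open>err4\<close> that contain (c d)^2 or (e f)^2, or else the product c
  d e f, which is dominated by these two. Absolute values suffice for them.\<close>

definition err_rest :: "real \<Rightarrow> real \<Rightarrow> real \<Rightarrow> real \<Rightarrow> real \<Rightarrow> real \<Rightarrow> real" where
  "err_rest a b c d e f = 4 / 9 * ((c * d) ^ 3 + (e * f) ^ 3)
     + 4 * ((c * d)\<^sup>2 * (a * b + e * f) + (e * f)\<^sup>2 * (a * b + c * d)) + 16 * a * b * c * d * e * f"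

lemma err_rest_bound:
  assumes "\<bar>a\<bar> \<le> \<mu>" "\<bar>b\<bar> \<le> \<mu>" "\<bar>c\<bar> \<le> \<mu>" "\<bar>d\<bar> \<le> \<mu>" "\<bar>e\<bar> \<le> \<mu>" "\<bar>f\<bar> \<le> \<mu>"
  shows "\<bar>err_rest a b c d e f\<bar> \<le> 17 * \<mu> * (c\<^sup>2 * d\<^sup>2 + e\<^sup>2 * f\<^sup>2)"
proof -
  have prod: "\<bar>x * y\<bar> \<le> \<mu>" if "\<bar>x\<bar> \<le> \<mu>" "\<bar>y\<bar> \<le> \<mu>" for x y
  proof -
    have "\<bar>x * y\<bar> \<le> \<mu> * 1"
      unfolding abs_mult using that \<mu>_le_1 \<mu>_nonneg by (intro mult_mono) auto
    then show ?thesis by simp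
  qed
  have 1: "\<bar>a * b\<bar> \<le> \<mu>" "\<bar>c * d\<bar> \<le> \<mu>" "\<bar>e * f\<bar> \<le> \<mu>"
    using assms prod by auto
  define P Q where "P = (c * d)\<^sup>2" and "Q = (e * f)\<^sup>2"
  have PQ: "0 \<le> P" "0 \<le> Q" by (auto simp: P_def Q_def)
  have t: "\<bar>u * x\<bar> \<le> \<mu> * x" if "\<bar>u\<bar> \<le> \<mu>" "0 \<le> x" for u x
    using that by (simp add: abs_mult mult_right_mono)
  have "\<bar>(c * d) * (e * f)\<bar> \<le> (P + Q) / 2"
    using sum_squares_bound[of "\<bar>c * d\<bar>" "\<bar>e * f\<bar>"]
    unfolding abs_mult[of "c * d" "e * f"] P_def Q_def by simp
  then have "\<bar>(a * b) * ((c * d) * (e * f))\<bar> \<le> \<mu> * ((P + Q) / 2)"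
    unfolding abs_mult[of "a * b"] using 1 by (intro mult_mono) auto
  moreover have "\<bar>(c * d) * P\<bar> \<le> \<mu> * P" "\<bar>(e * f) * Q\<bar> \<le> \<mu> * Q" "\<bar>(a * b) * P\<bar> \<le> \<mu> * P"
     "\<bar>(a * b) * Q\<bar> \<le> \<mu> * Q" "\<bar>(e * f) * P\<bar> \<le> \<mu> * P" "\<bar>(c * d) * Q\<bar> \<le> \<mu> * Q"
    using 1 PQ t by auto
  moreover have "0 \<le> \<mu> * P" "0 \<le> \<mu> * Q"
    using PQ \<mu>_nonneg by auto
  \<comment> \<open>The coefficients that fall on \<open>\<mu> * P\<close>, and likewise on
    \<open>\<mu> * Q\<close>, are 4/9 + 4 + 4 + 8, rounded up to 17.\<close>
  moreover have "err_rest a b c d e f = 4 / 9 * ((c * d) * P) + 4 / 9 * ((e * f) * Q) + 4 * ((a * b) * P)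
      + 4 * ((e * f) * P) + 4 * ((a * b) * Q) + 4 * ((c * d) * Q) + 16 * ((a * b) * ((c * d) * (e * f)))"
    by (simp add: err_rest_def P_def Q_def algebra_simps power2_eq_square power3_eq_cube)
  moreover have "17 * \<mu> * (c\<^sup>2 * d\<^sup>2 + e\<^sup>2 * f\<^sup>2) = 17 * (\<mu> * P) + 17 * (\<mu> * Q)"
    by (simp add: P_def Q_def algebra_simps power_mult_distrib)
  moreover have "\<mu> * ((P + Q) / 2) = (\<mu> * P) / 2 + (\<mu> * Q) / 2"
    by (simp add: algebra_simps)
  ultimately show ?thesis
    by linarith
qed

lemma bnd_err_rest:
  "bnd (34 * \<gamma>) (\<lambda>i j k l. err_rest (A i j) (A k l) (A i k) (A j l) (A i l) (A j k))"
proof -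
  have "2 * (17 * \<mu>) * \<rho> ^ 4 = 34 * (\<mu> * \<rho> ^ 4 * 1)" by simp
  also have "\<dots> \<le> 34 * \<gamma>"
    using \<mu>_nonneg \<rho>_le \<sigma>_le by (intro mult_left_mono le_\<gamma>) auto
  finally show ?thesis
    using \<mu>_nonneg \<gamma>_nonneg
    by (intro bnd_mono[OF bnd_abs[where w = "17 * \<mu>"]] err_rest_bound A_le) auto
qed

lemma bnd_\<gamma>_basic:
  "bnd \<gamma> (\<lambda>i j k l. (A i j)\<^sup>2 * (A i k * A j l))"
  "bnd \<gamma> (\<lambda>i j k l. (A i j)\<^sup>2 * (A k l)\<^sup>2 * (A i k * A j l))"
  "bnd \<gamma> (\<lambda>i j k l. (A i k)\<^sup>2 * (A i l * A j k))"
  "bnd \<gamma> (\<lambda>i j k l. (A i k) ^ 3 * A j l)"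
  "bnd \<gamma> (\<lambda>i j k l. A i j * A i k * A i l * (A k l)\<^sup>2)"
  "bnd \<gamma> (\<lambda>i j k l. A i j * A i k * A i l * (A j l)\<^sup>2)"
proof -
  have "\<mu>\<^sup>2 * 1 * \<sigma>\<^sup>2 \<le> \<gamma>"
    using \<mu>_nonneg \<rho>_nonneg \<sigma>_nonneg \<mu>_power_le \<rho>_le \<sigma>_le by (intro le_\<gamma>) auto
  then show "bnd \<gamma> (\<lambda>i j k l. (A i j)\<^sup>2 * (A i k * A j l))"
    by (intro bnd_mono[OF bnd_aacd]) (simp add: power2_eq_square mult_ac)
  have "(\<mu>\<^sup>2 * \<mu>\<^sup>2) * 1 * \<sigma>\<^sup>2 \<le> \<gamma>"
    using \<mu>_nonneg \<rho>_nonneg \<sigma>_nonneg \<mu>_power_le \<rho>_le \<sigma>_le by (intro le_\<gamma>) auto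
  then show "bnd \<gamma> (\<lambda>i j k l. (A i j)\<^sup>2 * (A k l)\<^sup>2 * (A i k * A j l))"
    by (intro bnd_mono[OF bnd_aabbcd]) (simp add: power2_eq_square mult_ac)
  have "\<mu>\<^sup>2 * 1 * \<sigma>\<^sup>2 \<le> \<gamma>"
    using \<mu>_nonneg \<rho>_nonneg \<sigma>_nonneg \<mu>_power_le \<rho>_le \<sigma>_le by (intro le_\<gamma>) auto
  then show "bnd \<gamma> (\<lambda>i j k l. (A i k)\<^sup>2 * (A i l * A j k))"
    by (intro bnd_mono[OF bnd_ccef]) (simp add: power2_eq_square mult_ac)
  have "\<mu> * \<rho>\<^sup>2 * \<sigma> \<le> \<gamma>"
    using \<mu>_nonneg \<rho>_nonneg \<sigma>_nonneg \<mu>_power_le \<rho>_le \<sigma>_le by (intro le_\<gamma>) auto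
  then show "bnd \<gamma> (\<lambda>i j k l. (A i k) ^ 3 * A j l)"
    by (intro bnd_mono[OF bnd_cccd]) (simp add: power2_eq_square mult_ac)
  have "\<mu>\<^sup>2 * \<rho> * \<sigma>\<^sup>2 \<le> \<gamma>"
    using \<mu>_nonneg \<rho>_nonneg \<sigma>_nonneg \<mu>_power_le \<rho>_le \<sigma>_le by (intro le_\<gamma>) auto
  then show "bnd \<gamma> (\<lambda>i j k l. A i j * A i k * A i l * (A k l)\<^sup>2)"
    by (intro bnd_mono[OF bnd_acebb]) (simp add: power2_eq_square mult_ac)
  have "\<mu>\<^sup>2 * \<rho>\<^sup>2 * \<sigma> \<le> \<gamma>"
    using \<mu>_nonneg \<rho>_nonneg \<sigma>_nonneg \<mu>_power_le \<rho>_le \<sigma>_le by (intro le_\<gamma>) auto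
  then show "bnd \<gamma> (\<lambda>i j k l. A i j * A i k * A i l * (A j l)\<^sup>2)"
    by (intro bnd_mono[OF bnd_acedd]) (simp add: power2_eq_square mult_ac)
qed

text \<open>The images of the six basic estimates under the symmetries of \<open>form\<close>:
  exchanging the indices inside either pair, and exchanging the two pairs.\<close>

lemma bnd_\<gamma>_terms:
  "bnd \<gamma> (\<lambda>i j k l. (A i j)\<^sup>2 * A i k * A j l)"
  "bnd \<gamma> (\<lambda>i j k l. (A i j)\<^sup>2 * A j k * A i l)"
  "bnd \<gamma> (\<lambda>i j k l. (A k l)\<^sup>2 * A i k * A j l)"
  "bnd \<gamma> (\<lambda>i j k l. (A k l)\<^sup>2 * A i l * A j k)"
  "bnd \<gamma> (\<lambda>i j k l. (A i j)\<^sup>2 * (A k l)\<^sup>2 * A i k * A j l)"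
  "bnd \<gamma> (\<lambda>i j k l. (A i j)\<^sup>2 * (A k l)\<^sup>2 * A j k * A i l)"
  "bnd \<gamma> (\<lambda>i j k l. (A i k)\<^sup>2 * A i l * A j k)"
  "bnd \<gamma> (\<lambda>i j k l. (A j k)\<^sup>2 * A j l * A i k)"
  "bnd \<gamma> (\<lambda>i j k l. (A i l)\<^sup>2 * A i k * A j l)"
  "bnd \<gamma> (\<lambda>i j k l. (A j l)\<^sup>2 * A j k * A i l)"
  "bnd \<gamma> (\<lambda>i j k l. (A i k) ^ 3 * A j l)"
  "bnd \<gamma> (\<lambda>i j k l. (A j k) ^ 3 * A i l)"
  "bnd \<gamma> (\<lambda>i j k l. (A i l) ^ 3 * A j k)"
  "bnd \<gamma> (\<lambda>i j k l. (A j l) ^ 3 * A i k)"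
  "bnd \<gamma> (\<lambda>i j k l. A i j * A i k * A i l * (A k l)\<^sup>2)"
  "bnd \<gamma> (\<lambda>i j k l. A i j * A j k * A j l * (A k l)\<^sup>2)"
  "bnd \<gamma> (\<lambda>i j k l. A k l * A i k * A j k * (A i j)\<^sup>2)"
  "bnd \<gamma> (\<lambda>i j k l. A k l * A i l * A j l * (A i j)\<^sup>2)"
  "bnd \<gamma> (\<lambda>i j k l. A i j * A i k * A i l * (A j l)\<^sup>2)"
  "bnd \<gamma> (\<lambda>i j k l. A i j * A j k * A j l * (A i l)\<^sup>2)"
  "bnd \<gamma> (\<lambda>i j k l. A i j * A i l * A i k * (A j k)\<^sup>2)"
  "bnd \<gamma> (\<lambda>i j k l. A k l * A i k * A j k * (A j l)\<^sup>2)"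
  "bnd \<gamma> (\<lambda>i j k l. A i j * A j l * A j k * (A i k)\<^sup>2)"
  "bnd \<gamma> (\<lambda>i j k l. A k l * A i l * A j l * (A j k)\<^sup>2)"
  "bnd \<gamma> (\<lambda>i j k l. A k l * A j k * A i k * (A i l)\<^sup>2)"
  "bnd \<gamma> (\<lambda>i j k l. A k l * A j l * A i l * (A i k)\<^sup>2)"
proof -
  show "bnd \<gamma> (\<lambda>i j k l. (A i j)\<^sup>2 * A i k * A j l)"
    by (rule bnd_cong[OF bnd_\<gamma>_basic(1)]) (simp add: A_sym mult_ac)
  show "bnd \<gamma> (\<lambda>i j k l. (A i j)\<^sup>2 * A j k * A i l)"
    by (rule bnd_cong[OF bnd_swap12[OF bnd_\<gamma>_basic(1)]]) (simp add: A_sym mult_ac)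
  show "bnd \<gamma> (\<lambda>i j k l. (A k l)\<^sup>2 * A i k * A j l)"
    by (rule bnd_cong[OF bnd_swap_pairs[OF bnd_\<gamma>_basic(1)]]) (simp add: A_sym mult_ac)
  show "bnd \<gamma> (\<lambda>i j k l. (A k l)\<^sup>2 * A i l * A j k)"
    by (rule bnd_cong[OF bnd_swap_pairs[OF bnd_swap12[OF bnd_\<gamma>_basic(1)]]]) (simp add: A_sym mult_ac)
  show "bnd \<gamma> (\<lambda>i j k l. (A i j)\<^sup>2 * (A k l)\<^sup>2 * A i k * A j l)"
    by (rule bnd_cong[OF bnd_\<gamma>_basic(2)]) (simp add: A_sym mult_ac)
  show "bnd \<gamma> (\<lambda>i j k l. (A i j)\<^sup>2 * (A k l)\<^sup>2 * A j k * A i l)"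
    by (rule bnd_cong[OF bnd_swap12[OF bnd_\<gamma>_basic(2)]]) (simp add: A_sym mult_ac)
  show "bnd \<gamma> (\<lambda>i j k l. (A i k)\<^sup>2 * A i l * A j k)"
    by (rule bnd_cong[OF bnd_\<gamma>_basic(3)]) (simp add: A_sym mult_ac)
  show "bnd \<gamma> (\<lambda>i j k l. (A j k)\<^sup>2 * A j l * A i k)"
    by (rule bnd_cong[OF bnd_swap12[OF bnd_\<gamma>_basic(3)]]) (simp add: A_sym mult_ac)
  show "bnd \<gamma> (\<lambda>i j k l. (A i l)\<^sup>2 * A i k * A j l)"
    by (rule bnd_cong[OF bnd_swap34[OF bnd_\<gamma>_basic(3)]]) (simp add: A_sym mult_ac)
  show "bnd \<gamma> (\<lambda>i j k l. (A j l)\<^sup>2 * A j k * A i l)"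
    by (rule bnd_cong[OF bnd_swap34[OF bnd_swap12[OF bnd_\<gamma>_basic(3)]]]) (simp add: A_sym mult_ac)
  show "bnd \<gamma> (\<lambda>i j k l. (A i k) ^ 3 * A j l)"
    by (rule bnd_cong[OF bnd_\<gamma>_basic(4)]) (simp add: A_sym mult_ac)
  show "bnd \<gamma> (\<lambda>i j k l. (A j k) ^ 3 * A i l)"
    by (rule bnd_cong[OF bnd_swap12[OF bnd_\<gamma>_basic(4)]]) (simp add: A_sym mult_ac)
  show "bnd \<gamma> (\<lambda>i j k l. (A i l) ^ 3 * A j k)"
    by (rule bnd_cong[OF bnd_swap34[OF bnd_\<gamma>_basic(4)]]) (simp add: A_sym mult_ac)
  show "bnd \<gamma> (\<lambda>i j k l. (A j l) ^ 3 * A i k)"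
    by (rule bnd_cong[OF bnd_swap34[OF bnd_swap12[OF bnd_\<gamma>_basic(4)]]]) (simp add: A_sym mult_ac)
  show "bnd \<gamma> (\<lambda>i j k l. A i j * A i k * A i l * (A k l)\<^sup>2)"
    by (rule bnd_cong[OF bnd_\<gamma>_basic(5)]) (simp add: A_sym mult_ac)
  show "bnd \<gamma> (\<lambda>i j k l. A i j * A j k * A j l * (A k l)\<^sup>2)"
    by (rule bnd_cong[OF bnd_swap12[OF bnd_\<gamma>_basic(5)]]) (simp add: A_sym mult_ac)
  show "bnd \<gamma> (\<lambda>i j k l. A k l * A i k * A j k * (A i j)\<^sup>2)"
    by (rule bnd_cong[OF bnd_swap_pairs[OF bnd_\<gamma>_basic(5)]]) (simp add: A_sym mult_ac)
  show "bnd \<gamma> (\<lambda>i j k l. A k l * A i l * A j l * (A i j)\<^sup>2)"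
    by (rule bnd_cong[OF bnd_swap_pairs[OF bnd_swap12[OF bnd_\<gamma>_basic(5)]]]) (simp add: A_sym mult_ac)
  show "bnd \<gamma> (\<lambda>i j k l. A i j * A i k * A i l * (A j l)\<^sup>2)"
    by (rule bnd_cong[OF bnd_\<gamma>_basic(6)]) (simp add: A_sym mult_ac)
  show "bnd \<gamma> (\<lambda>i j k l. A i j * A j k * A j l * (A i l)\<^sup>2)"
    by (rule bnd_cong[OF bnd_swap12[OF bnd_\<gamma>_basic(6)]]) (simp add: A_sym mult_ac)
  show "bnd \<gamma> (\<lambda>i j k l. A i j * A i l * A i k * (A j k)\<^sup>2)"
    by (rule bnd_cong[OF bnd_swap34[OF bnd_\<gamma>_basic(6)]]) (simp add: A_sym mult_ac)
  show "bnd \<gamma> (\<lambda>i j k l. A k l * A i k * A j k * (A j l)\<^sup>2)"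
    by (rule bnd_cong[OF bnd_swap_pairs[OF bnd_\<gamma>_basic(6)]]) (simp add: A_sym mult_ac)
  show "bnd \<gamma> (\<lambda>i j k l. A i j * A j l * A j k * (A i k)\<^sup>2)"
    by (rule bnd_cong[OF bnd_swap34[OF bnd_swap12[OF bnd_\<gamma>_basic(6)]]]) (simp add: A_sym mult_ac)
  show "bnd \<gamma> (\<lambda>i j k l. A k l * A i l * A j l * (A j k)\<^sup>2)"
    by (rule bnd_cong[OF bnd_swap_pairs[OF bnd_swap12[OF bnd_\<gamma>_basic(6)]]]) (simp add: A_sym mult_ac)
  show "bnd \<gamma> (\<lambda>i j k l. A k l * A j k * A i k * (A i l)\<^sup>2)"
    by (rule bnd_cong[OF bnd_swap_pairs[OF bnd_swap34[OF bnd_\<gamma>_basic(6)]]]) (simp add: A_sym mult_ac)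
  show "bnd \<gamma> (\<lambda>i j k l. A k l * A j l * A i l * (A i k)\<^sup>2)"
    by (rule bnd_cong[OF bnd_swap_pairs[OF bnd_swap34[OF bnd_swap12[OF bnd_\<gamma>_basic(6)]]]]) (simp add: A_sym mult_ac)
qed

lemma bnd_err4: "bnd (109 * \<gamma>) (\<lambda>i j k l. err4 (A i j) (A k l) (A i k) (A j l) (A i l) (A j k))"
proof -
  let ?f = "\<lambda>i j k l. err_rest (A i j) (A k l) (A i k) (A j l) (A i l) (A j k)
       + 2 * ((A i j)\<^sup>2 * A i k * A j l)
       + 2 * ((A i j)\<^sup>2 * A j k * A i l)
       + 2 * ((A k l)\<^sup>2 * A i k * A j l)
       + 2 * ((A k l)\<^sup>2 * A i l * A j k)
       + 4 * ((A i j)\<^sup>2 * (A k l)\<^sup>2 * A i k * A j l)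
       + 4 * ((A i j)\<^sup>2 * (A k l)\<^sup>2 * A j k * A i l)
       + 2 * ((A i k)\<^sup>2 * A i l * A j k)
       + 2 * ((A j k)\<^sup>2 * A j l * A i k)
       + 2 * ((A i l)\<^sup>2 * A i k * A j l)
       + 2 * ((A j l)\<^sup>2 * A j k * A i l)
       + 2/3 * ((A i k) ^ 3 * A j l)
       + 2/3 * ((A j k) ^ 3 * A i l)
       + 2/3 * ((A i l) ^ 3 * A j k)
       + 2/3 * ((A j l) ^ 3 * A i k)
       + (- 4) * (A i j * A i k * A i l * (A k l)\<^sup>2)
       + (- 4) * (A i j * A j k * A j l * (A k l)\<^sup>2)
       + (- 4) * (A k l * A i k * A j k * (A i j)\<^sup>2)
       + (- 4) * (A k l * A i l * A j l * (A i j)\<^sup>2)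
       + (- 4) * (A i j * A i k * A i l * (A j l)\<^sup>2)
       + (- 4) * (A i j * A j k * A j l * (A i l)\<^sup>2)
       + (- 4) * (A i j * A i l * A i k * (A j k)\<^sup>2)
       + (- 4) * (A k l * A i k * A j k * (A j l)\<^sup>2)
       + (- 4) * (A i j * A j l * A j k * (A i k)\<^sup>2)
       + (- 4) * (A k l * A i l * A j l * (A j k)\<^sup>2)
       + (- 4) * (A k l * A j k * A i k * (A i l)\<^sup>2)
       + (- 4) * (A k l * A j l * A i l * (A i k)\<^sup>2)"
  have "bnd ((34 + \<bar>2\<bar> + \<bar>2\<bar> + \<bar>2\<bar> + \<bar>2\<bar> + \<bar>4\<bar> + \<bar>4\<bar> +
      \<bar>2\<bar> + \<bar>2\<bar> + \<bar>2\<bar> + \<bar>2\<bar> + \<bar>2/3\<bar> + \<bar>2/3\<bar> +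
      \<bar>2/3\<bar> + \<bar>2/3\<bar> + \<bar>(- 4)\<bar> + \<bar>(- 4)\<bar> + \<bar>(- 4)\<bar> +
      \<bar>(- 4)\<bar> + \<bar>(- 4)\<bar> + \<bar>(- 4)\<bar> + \<bar>(- 4)\<bar> + \<bar>(- 4)\<bar> +
      \<bar>(- 4)\<bar> + \<bar>(- 4)\<bar> + \<bar>(- 4)\<bar> + \<bar>(- 4)\<bar>) * \<gamma>) ?f"
    by (intro bnd_\<gamma>_add bnd_err_rest bnd_\<gamma>_terms)
  \<comment> \<open>The accumulated constant is 34 + 24 + 8/3 + 48, rounded up.\<close>
  then have "bnd (109 * \<gamma>) ?f"
    by (rule bnd_mono) (use \<gamma>_nonneg in simp)
  then show ?thesis
    by (rule bnd_cong) (simp add: err4_def err_rest_def algebra_simps power2_eq_square power3_eq_cube)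
qed

section \<open>Overlapping pairs\<close>

definition overlap :: "nat \<Rightarrow> nat \<Rightarrow> nat \<Rightarrow> real" where
  "overlap i j l = (A j l)\<^sup>2 + \<bar>A i j * A j l\<bar> + \<bar>A i l * A j l\<bar> + \<bar>A i j * A i l\<bar> + (if j = l then 1 else 0)"

lemma overlap_nonneg: "0 \<le> overlap i j l"
  by (simp add: overlap_def)

text \<open>Each of the four products is at most half the sum of one square weighted by
  \<open>V i j\<close> and one weighted by \<open>V i l\<close>. Two squares of either kind occur,
  each of them in two products, so the halves add up exactly. The four squares contribute
  \<open>\<rho>\<^sup>2\<close> each, and the case \<open>j = l\<close> contributes the 1.\<close>

lemma sum_overlap:
  "(\<Sum>i<n. \<Sum>j<n. \<Sum>l<n. \<bar>V i j\<bar> * \<bar>V i l\<bar> * overlap i j l) \<le> (4 * \<rho>\<^sup>2 + 1) * fro V"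
proof -
  have pointwise: "\<bar>V i j\<bar> * \<bar>V i l\<bar> * overlap i j l \<le>
      ((V i j)\<^sup>2 * (A j l)\<^sup>2 + (V i j)\<^sup>2 * (A i l)\<^sup>2) + ((V i l)\<^sup>2 * (A j l)\<^sup>2 + (V i l)\<^sup>2 * (A i j)\<^sup>2)
      + (if j = l then (V i j)\<^sup>2 else 0)" for i j l
  proof -
    have amgm: "2 * (\<bar>x\<bar> * \<bar>y\<bar> * \<bar>a * b\<bar>) \<le> x\<^sup>2 * a\<^sup>2 + y\<^sup>2 * b\<^sup>2" for x y a b :: real
    proof -
      have "2 * \<bar>x * a\<bar> * \<bar>y * b\<bar> \<le> \<bar>x * a\<bar>\<^sup>2 + \<bar>y * b\<bar>\<^sup>2"
        by (rule sum_squares_bound)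
      then show ?thesis
        by (simp add: abs_mult power_mult_distrib mult_ac)
    qed
    have lin: "x1 + x2 + x3 + x4 \<le> a + b + (c + d)"
      if "2 * x1 \<le> a + c" "2 * x2 \<le> a + d" "2 * x3 \<le> b + c" "2 * x4 \<le> b + d"
      for x1 x2 x3 x4 a b c d :: real
      using that by linarith
    have eq: "\<bar>V i j\<bar> * \<bar>V i l\<bar> * overlap i j l = \<bar>V i j\<bar> * \<bar>V i l\<bar> * \<bar>A j l * A j l\<bar> + \<bar>V i j\<bar> * \<bar>V i l\<bar> * \<bar>A j l * A i j\<bar>
       + \<bar>V i j\<bar> * \<bar>V i l\<bar> * \<bar>A i l * A j l\<bar> + \<bar>V i j\<bar> * \<bar>V i l\<bar> * \<bar>A i l * A i j\<bar>
       + (if j = l then (V i j)\<^sup>2 else 0)"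
      by (auto simp: overlap_def algebra_simps power2_eq_square)
    show ?thesis
      unfolding eq
      by (rule add_right_mono[OF lin[OF amgm amgm amgm amgm]])
  qed
  have "(\<Sum>i<n. \<Sum>j<n. \<Sum>l<n. \<bar>V i j\<bar> * \<bar>V i l\<bar> * overlap i j l) \<le>
     (\<Sum>i<n. \<Sum>j<n. \<Sum>l<n. ((V i j)\<^sup>2 * (A j l)\<^sup>2 + (V i j)\<^sup>2 * (A i l)\<^sup>2)
        + ((V i l)\<^sup>2 * (A j l)\<^sup>2 + (V i l)\<^sup>2 * (A i j)\<^sup>2) + (if j = l then (V i j)\<^sup>2 else 0))"
    by (intro sum_mono pointwise)
  also have "\<dots> = (\<Sum>i<n. \<Sum>j<n. \<Sum>l<n. (V i j)\<^sup>2 * (A j l)\<^sup>2 + (V i j)\<^sup>2 * (A i l)\<^sup>2)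
     + (\<Sum>i<n. \<Sum>j<n. \<Sum>l<n. (V i l)\<^sup>2 * (A j l)\<^sup>2 + (V i l)\<^sup>2 * (A i j)\<^sup>2)
     + (\<Sum>i<n. \<Sum>j<n. \<Sum>l<n. if j = l then (V i j)\<^sup>2 else 0)"
    by (simp only: sum.distrib)
  also have "(\<Sum>i<n. \<Sum>j<n. \<Sum>l<n. (V i l)\<^sup>2 * (A j l)\<^sup>2 + (V i l)\<^sup>2 * (A i j)\<^sup>2) =
      (\<Sum>i<n. \<Sum>l<n. \<Sum>j<n. (V i l)\<^sup>2 * (A j l)\<^sup>2 + (V i l)\<^sup>2 * (A i j)\<^sup>2)"
    by (rule sum.cong[OF refl sum.swap])
  also have "\<dots> = (\<Sum>i<n. \<Sum>j<n. \<Sum>l<n. (V i j)\<^sup>2 * (A j l)\<^sup>2 + (V i j)\<^sup>2 * (A i l)\<^sup>2)"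
    by (intro sum.cong refl) (simp add: A_sym)
  also have "(\<Sum>i<n. \<Sum>j<n. \<Sum>l<n. if j = l then (V i j)\<^sup>2 else 0) = fro V"
    by (simp add: fro_def)
  also have "(\<Sum>i<n. \<Sum>j<n. \<Sum>l<n. (V i j)\<^sup>2 * (A j l)\<^sup>2 + (V i j)\<^sup>2 * (A i l)\<^sup>2) =
     (\<Sum>i<n. \<Sum>j<n. (V i j)\<^sup>2 * ((\<Sum>l<n. (A j l)\<^sup>2) + (\<Sum>l<n. (A i l)\<^sup>2)))"
    by (simp only: sum.distrib sum_distrib_left[symmetric] distrib_left)
  finally have "(\<Sum>i<n. \<Sum>j<n. \<Sum>l<n. \<bar>V i j\<bar> * \<bar>V i l\<bar> * overlap i j l) \<le>
     2 * (\<Sum>i<n. \<Sum>j<n. (V i j)\<^sup>2 * ((\<Sum>l<n. (A j l)\<^sup>2) + (\<Sum>l<n. (A i l)\<^sup>2))) + fro V"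
    by simp
  moreover have "(\<Sum>i<n. \<Sum>j<n. (V i j)\<^sup>2 * ((\<Sum>l<n. (A j l)\<^sup>2) + (\<Sum>l<n. (A i l)\<^sup>2))) \<le>
     (\<Sum>i<n. \<Sum>j<n. (V i j)\<^sup>2 * (\<rho>\<^sup>2 + \<rho>\<^sup>2))"
    by (intro sum_mono mult_left_mono add_mono row) auto
  moreover have "(\<Sum>i<n. \<Sum>j<n. (V i j)\<^sup>2 * (\<rho>\<^sup>2 + \<rho>\<^sup>2)) = 2 * \<rho>\<^sup>2 * fro V"
    by (simp add: fro_def sum_distrib_left mult_ac)
  ultimately show ?thesis
    by (simp add: algebra_simps)
qed

definition overlaps :: "nat \<Rightarrow> nat \<Rightarrow> nat \<Rightarrow> nat \<Rightarrow> real" where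
  "overlaps i j k l = (if i = k then overlap i j l else 0) + (if i = l then overlap i j k else 0)
     + (if j = k then overlap j i l else 0) + (if j = l then overlap j i k else 0)"

lemma bnd_overlaps:
  assumes f: "\<And>i j k l. i < n \<Longrightarrow> j < n \<Longrightarrow> k < n \<Longrightarrow> l < n \<Longrightarrow> i \<noteq> j \<Longrightarrow> k \<noteq> l \<Longrightarrow>
      \<bar>f i j k l\<bar> \<le> w * overlaps i j k l" and w: "0 \<le> w"
  shows "bnd (4 * w * (4 * \<rho>\<^sup>2 + 1)) f"
proof -
  \<comment> \<open>Entrywise absolute values of \<open>V\<close> satisfy the same assumptions and
    have the same \<open>fro\<close>, so the symmetry rules become available for the nonnegative
    majorant.\<close>
  interpret abs: error_bound n A "\<lambda>i j. \<bar>V i j\<bar>" \<mu> \<rho> \<sigma>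
    by unfold_locales
      (auto intro: A_sym A_le \<mu>_le_1 row spec \<rho>_nonneg \<sigma>_nonneg simp: V_diag arg_cong[OF V_sym])
  have fro: "abs.fro (\<lambda>i j. \<bar>V i j\<bar>) = fro V"
    by (simp add: abs.fro_def fro_def)
  let ?o = "\<lambda>i j k l. if i = k then overlap i j l else 0"
  have "abs.form ?o = (\<Sum>i<n. \<Sum>j<n. \<Sum>k<n. if i = k then (\<Sum>l<n. \<bar>V i j\<bar> * \<bar>V i l\<bar> * overlap i j l) else 0)"
    unfolding abs.form_def by (intro sum.cong refl) auto
  also have "\<dots> = (\<Sum>i<n. \<Sum>j<n. \<Sum>l<n. \<bar>V i j\<bar> * \<bar>V i l\<bar> * overlap i j l)"
    by (rule sum.cong[OF refl], rule sum.cong[OF refl]) simp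
  finally have "abs.form ?o = \<dots>" .
  moreover have "0 \<le> (\<Sum>i<n. \<Sum>j<n. \<Sum>l<n. \<bar>V i j\<bar> * \<bar>V i l\<bar> * overlap i j l)"
    by (intro sum_nonneg mult_nonneg_nonneg overlap_nonneg) auto
  ultimately have 1: "abs.bnd (4 * \<rho>\<^sup>2 + 1) ?o"
    using sum_overlap by (simp add: abs.bnd_def fro)
  have "abs.bnd ((4 * \<rho>\<^sup>2 + 1) + (4 * \<rho>\<^sup>2 + 1) + (4 * \<rho>\<^sup>2 + 1) + (4 * \<rho>\<^sup>2 + 1)) overlaps"
    unfolding overlaps_def
    by (intro abs.bnd_add 1 abs.bnd_swap12[OF 1] abs.bnd_swap34[OF 1] abs.bnd_swap12[OF abs.bnd_swap34[OF 1]])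
  then have "abs.form overlaps \<le> 4 * (4 * \<rho>\<^sup>2 + 1) * fro V"
    by (simp add: abs.bnd_def fro)
  moreover have "\<bar>form f\<bar> \<le> (\<Sum>i<n. \<Sum>j<n. \<Sum>k<n. \<Sum>l<n. w * (\<bar>V i j\<bar> * \<bar>V k l\<bar> * overlaps i j k l))"
    unfolding form_def
  proof (intro order.trans[OF sum_abs] sum_mono)
    fix i j k l assume "i \<in> {..<n}" "j \<in> {..<n}" "k \<in> {..<n}" "l \<in> {..<n}"
    then have "\<bar>V i j\<bar> * \<bar>V k l\<bar> * \<bar>f i j k l\<bar> \<le> \<bar>V i j\<bar> * \<bar>V k l\<bar> * (w * overlaps i j k l)"
      using f[of i j k l] mult_left_mono[of "\<bar>f i j k l\<bar>" "w * overlaps i j k l" "\<bar>V i j\<bar> * \<bar>V k l\<bar>"]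
      by (cases "i = j \<or> k = l") (auto simp: V_diag)
    then show "\<bar>V i j * V k l * f i j k l\<bar> \<le> w * (\<bar>V i j\<bar> * \<bar>V k l\<bar> * overlaps i j k l)"
      by (simp add: abs_mult mult_ac)
  qed
  moreover have "(\<Sum>i<n. \<Sum>j<n. \<Sum>k<n. \<Sum>l<n. w * (\<bar>V i j\<bar> * \<bar>V k l\<bar> * overlaps i j k l)) = w * abs.form overlaps"
    by (simp only: abs.form_def sum_distrib_left)
  ultimately have "\<bar>form f\<bar> \<le> w * (4 * (4 * \<rho>\<^sup>2 + 1) * fro V)"
    using mult_left_mono[OF _ w] by fastforce
  then show ?thesis
    by (simp add: bnd_def mult_ac)
qed

text \<open>The bare product p q has to cancel: its coefficient is 1 in the product of the two-point
  moments and 1 - 2 - 2 + 2 = -1 in \<open>gram4\<close>. Everything left carries an additional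
  small factor. The third argument is the entry at the shared index, 1 on the diagonal of X but 0 on
  the diagonal of A.\<close>

lemma overlap_remainder:
  assumes "\<bar>p\<bar> \<le> \<mu>" "\<bar>q\<bar> \<le> \<mu>" "\<bar>r\<bar> \<le> \<mu>"
  shows "\<bar>moment2 r - moment2 p * moment2 q - gram4 p q 1 r q p - err4 p q 0 r q p\<bar>
    \<le> 40 * \<mu> * (r\<^sup>2 + \<bar>p * r\<bar> + \<bar>q * r\<bar> + \<bar>p * q\<bar>)"
proof -
  have prod: "\<bar>x * y\<bar> \<le> \<mu>" if "\<bar>x\<bar> \<le> \<mu>" "\<bar>y\<bar> \<le> \<mu>" for x y
  proof -
    have "\<bar>x * y\<bar> \<le> \<mu> * 1"
      unfolding abs_mult using that \<mu>_le_1 \<mu>_nonneg by (intro mult_mono) auto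
    then show ?thesis by simp
  qed
  define z where "z = - 16/3 * (p * p) - 16/3 * (q * q) - 4 * (r * r) + 16 * (p * q * r) - 80/9 * ((p * q) * (p * q))"
  have eq: "moment2 r - moment2 p * moment2 q - gram4 p q 1 r q p - err4 p q 0 r q p =
     (2/3 * r) * r\<^sup>2 + (2 * p) * (p * r) + (2 * q) * (q * r) + z * (p * q)"
    by (simp add: z_def moment2_def gram4_def err4_def field_simps power2_eq_square power3_eq_cube)
  \<comment> \<open>40 rounds up 16/3 + 16/3 + 4 + 16 + 80/9.\<close>
  have "\<bar>z\<bar> \<le> 40 * \<mu>"
    unfolding z_def using prod[OF assms(1) assms(1)] prod[OF assms(2) assms(2)] prod[OF assms(3) assms(3)]
      prod[OF prod[OF assms(1) assms(2)] assms(3)] prod[OF prod[OF assms(1) assms(2)] prod[OF assms(1) assms(2)]]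
    by linarith
  then have "\<bar>z * (p * q)\<bar> \<le> 40 * \<mu> * \<bar>p * q\<bar>"
    unfolding abs_mult[of z] by (intro mult_right_mono) auto
  moreover have "\<bar>(2/3 * r) * r\<^sup>2\<bar> \<le> 40 * \<mu> * r\<^sup>2"
    unfolding abs_mult[of "2/3 * r"] using assms \<mu>_nonneg by (intro mult_mono) auto
  moreover have "\<bar>(2 * p) * (p * r)\<bar> \<le> 40 * \<mu> * \<bar>p * r\<bar>"
    unfolding abs_mult[of "2 * p"] using assms \<mu>_nonneg by (intro mult_right_mono) auto
  moreover have "\<bar>(2 * q) * (q * r)\<bar> \<le> 40 * \<mu> * \<bar>q * r\<bar>"
    unfolding abs_mult[of "2 * q"] using assms \<mu>_nonneg by (intro mult_right_mono) auto
  ultimately show ?thesis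
    unfolding eq distrib_left by linarith
qed

text \<open>The product of the third and fourth arguments of \<open>gram4\<close> matches the entry
  1. All other terms have even degree at least two in p, and p^2 is at most
  \<open>\<mu>\<close>.\<close>

lemma diagonal_remainder:
  assumes "\<bar>p\<bar> \<le> \<mu>"
  shows "\<bar>1 - moment2 p * moment2 p - gram4 p p 1 1 p p - err4 p p 0 0 p p\<bar> \<le> 40 * \<mu>"
proof -
  have p2: "p\<^sup>2 \<le> \<mu>\<^sup>2"
    using power_mono[OF assms, of 2] by simp
  then have p2: "p\<^sup>2 \<le> \<mu>" "p\<^sup>2 \<le> 1" "0 \<le> p\<^sup>2"
    using \<mu>_power_le(1) \<mu>_le_1 by auto
  have p4: "p\<^sup>2 * p\<^sup>2 \<le> \<mu> * 1" "0 \<le> p\<^sup>2 * p\<^sup>2"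
    using mult_mono[OF p2(1,2) \<mu>_nonneg p2(3)] by auto
  have p6: "(p\<^sup>2 * p\<^sup>2) * p\<^sup>2 \<le> (\<mu> * 1) * 1" "0 \<le> (p\<^sup>2 * p\<^sup>2) * p\<^sup>2"
    using mult_mono[OF p4(1) p2(2) _ p2(3)] p4(2) p2(3) \<mu>_nonneg by auto
  have eq: "1 - moment2 p * moment2 p - gram4 p p 1 1 p p - err4 p p 0 0 p p =
     2 * p\<^sup>2 - 32/3 * (p\<^sup>2 * p\<^sup>2) - 80/9 * ((p\<^sup>2 * p\<^sup>2) * p\<^sup>2)"
    by (simp add: moment2_def gram4_def err4_def field_simps power2_eq_square power3_eq_cube)
  show ?thesis
    unfolding eq using p2 p4 p6 by linarith
qed

end

section \<open>Norms of the correlation matrix\<close>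

lemma alpha_mag_bounds:
  assumes X: "X \<in> carrier_mat n n" and le1: "\<And>i j. i < n \<Longrightarrow> j < n \<Longrightarrow> \<bar>X $$ (i, j)\<bar> \<le> 1"
  shows "i < n \<Longrightarrow> j < n \<Longrightarrow> i \<noteq> j \<Longrightarrow> \<bar>X $$ (i, j)\<bar> \<le> alpha_mag X"
    and "0 \<le> alpha_mag X" and "alpha_mag X \<le> 1"
proof -
  let ?E = "{\<bar>X $$ (i, j)\<bar> | i j. i < dim_row X \<and> j < dim_col X \<and> i \<noteq> j}"
  have "?E \<subseteq> (\<lambda>(i, j). \<bar>X $$ (i, j)\<bar>) ` ({..<dim_row X} \<times> {..<dim_col X})" by auto
  then have fin: "finite (insert 0 ?E)"
    using finite_subset by fastforce
  show "\<bar>X $$ (i, j)\<bar> \<le> alpha_mag X" if "i < n" "j < n" "i \<noteq> j"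
  proof -
    have "\<bar>X $$ (i, j)\<bar> \<in> insert 0 ?E"
      using that X by auto
    then show ?thesis unfolding alpha_mag_def by (rule Max_ge[OF fin])
  qed
  show "0 \<le> alpha_mag X"
    unfolding alpha_mag_def by (rule Max_ge[OF fin]) simp
  show "alpha_mag X \<le> 1"
    unfolding alpha_mag_def using X le1 by (subst Max_le_iff[OF fin]) auto
qed

lemma alpha_row_bounds:
  assumes X: "X \<in> carrier_mat n n" and n: "n \<ge> 1"
  shows "i < n \<Longrightarrow> (\<Sum>j\<in>{..<n} - {i}. (X $$ (i, j))\<^sup>2) \<le> (alpha_row X)\<^sup>2" and "0 \<le> alpha_row X"
proof -
  let ?r = "\<lambda>i. sqrt (\<Sum>j\<in>{..<n} - {i}. (X $$ (i, j))\<^sup>2)"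
  have eq: "alpha_row X = Max (?r ` {..<n})"
    using X by (simp add: alpha_row_def)
  have le: "?r i \<le> alpha_row X" if "i < n" for i
    unfolding eq using that by (intro Max_ge) auto
  have nn: "0 \<le> ?r i" for i
    by (simp add: sum_nonneg)
  show "0 \<le> alpha_row X"
    using le[of 0] nn[of 0] n by linarith
  show "(\<Sum>j\<in>{..<n} - {i}. (X $$ (i, j))\<^sup>2) \<le> (alpha_row X)\<^sup>2" if "i < n"
    using power_mono[OF le[OF that] nn, of 2] by (simp add: sum_nonneg)
qed

lemma mult_mat_vec_index_sum:
  assumes "X \<in> carrier_mat n n" "v \<in> carrier_vec n" "i < n"
  shows "(X *\<^sub>v v) $ i = (\<Sum>j<n. X $$ (i, j) * v $ j :: real)"
  using assms by (auto simp: scalar_prod_def lessThan_atLeast0 intro!: sum.cong)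

lemma scalar_prod_self_sum:
  assumes "v \<in> carrier_vec n"
  shows "scalar_prod v v = (\<Sum>j<n. (v $ j)\<^sup>2 :: real)"
  using assms by (auto simp: scalar_prod_def lessThan_atLeast0 power2_eq_square)

text \<open>The supremum is attained over a nonempty set of values bounded by the Frobenius norm in
  the sense needed for upper bounds: nonemptiness comes from a unit vector, boundedness from
  Cauchy-Schwarz in each row. Scaling then covers every nonzero vector.\<close>

lemma alpha_spec_bounds:
  assumes X: "X \<in> carrier_mat n n" and n: "n \<ge> 1"
  shows "L2_set (\<lambda>i. \<Sum>j<n. X $$ (i, j) * y j) {..<n} \<le> alpha_spec X * L2_set y {..<n}" and "0 \<le> alpha_spec X"
proof -
  let ?U = "{v \<in> carrier_vec (dim_col X). scalar_prod v v = (1::real)}"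
  let ?f = "\<lambda>v. sqrt (scalar_prod (X *\<^sub>v v) (X *\<^sub>v v))"
  have f: "?f v = L2_set (\<lambda>i. \<Sum>j<n. X $$ (i, j) * v $ j) {..<n}" if "v \<in> carrier_vec n" for v
  proof -
    have "scalar_prod (X *\<^sub>v v) (X *\<^sub>v v) = (\<Sum>i<n. ((X *\<^sub>v v) $ i)\<^sup>2)"
      by (rule scalar_prod_self_sum) (use X that in auto)
    also have "\<dots> = (\<Sum>i<n. (\<Sum>j<n. X $$ (i, j) * v $ j)\<^sup>2)"
      by (intro sum.cong refl) (simp add: mult_mat_vec_index_sum[OF X that])
    finally show ?thesis by (simp add: L2_set_def)
  qed
  have bdd: "bdd_above (?f ` ?U)"
  proof (rule bdd_aboveI2)
    fix v assume v: "v \<in> ?U"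
    then have vc: "v \<in> carrier_vec n" using X by auto
    then have v1: "(\<Sum>j<n. (v $ j)\<^sup>2) = 1"
      using v scalar_prod_self_sum by auto
    have "(\<Sum>j<n. X $$ (i, j) * v $ j)\<^sup>2 \<le> (\<Sum>j<n. (X $$ (i, j))\<^sup>2)" for i
      using Cauchy_Schwarz_ineq_sum[of "\<lambda>j. X $$ (i, j)" "\<lambda>j. v $ j" "{..<n}"] by (simp add: v1)
    then show "?f v \<le> sqrt (\<Sum>i<n. \<Sum>j<n. (X $$ (i, j))\<^sup>2)"
      unfolding f[OF vc] L2_set_def by (intro real_sqrt_le_mono sum_mono)
  qed
  have upper: "?f v \<le> alpha_spec X" if "v \<in> ?U" for v
    unfolding alpha_spec_def spectral_norm_def by (rule cSUP_upper[OF that bdd])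
  show nonneg: "0 \<le> alpha_spec X"
  proof -
    have "scalar_prod (unit_vec n 0) (unit_vec n 0) = (1::real)"
      using n by simp
    then have "unit_vec n 0 \<in> ?U" using X by auto
    from upper[OF this] show ?thesis
      unfolding f[OF unit_vec_carrier] by (rule order.trans[OF L2_set_nonneg])
  qed
  show "L2_set (\<lambda>i. \<Sum>j<n. X $$ (i, j) * y j) {..<n} \<le> alpha_spec X * L2_set y {..<n}"
  proof (cases "L2_set y {..<n} = 0")
    case True
    then have "y j = 0" if "j < n" for j
      using that by (simp add: L2_set_eq_0_iff)
    then show ?thesis
      by (simp add: L2_set_def)
  next
    case False
    define t where "t = L2_set y {..<n}"
    have t: "t > 0" using False L2_set_nonneg[of y "{..<n}"] unfolding t_def by linarith
    define v where "v = vec n (\<lambda>j. y j / t)"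
    have vc: "v \<in> carrier_vec n" by (simp add: v_def)
    have t2: "t\<^sup>2 = (\<Sum>j<n. (y j)\<^sup>2)"
      by (simp add: t_def L2_set_def sum_nonneg)
    have "scalar_prod v v = (\<Sum>j<n. (y j)\<^sup>2) / t\<^sup>2"
      unfolding scalar_prod_self_sum[OF vc] by (simp add: v_def power_divide sum_divide_distrib)
    then have "v \<in> ?U" using X vc t t2 by auto
    from upper[OF this] have "L2_set (\<lambda>i. \<Sum>j<n. X $$ (i, j) * v $ j) {..<n} \<le> alpha_spec X"
      using f[OF vc] by simp
    moreover have "L2_set (\<lambda>i. \<Sum>j<n. X $$ (i, j) * v $ j) {..<n} =
        L2_set (\<lambda>i. (1 / t) * (\<Sum>j<n. X $$ (i, j) * y j)) {..<n}"
      by (intro L2_set_cong refl) (simp add: v_def sum_distrib_left)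
    moreover have "\<dots> = (1 / t) * L2_set (\<lambda>i. \<Sum>j<n. X $$ (i, j) * y j) {..<n}"
      using t by (intro L2_set_right_distrib[symmetric]) simp
    ultimately show ?thesis
      using t by (simp add: t_def[symmetric] divide_le_eq)
  qed
qed

text \<open>Here A is X minus the identity, and the triangle inequality charges the identity with
  the additional 1.\<close>

lemma spectral_offdiagonal:
  assumes X: "X \<in> carrier_mat n n" and n: "n \<ge> 1" and diag: "\<And>i. i < n \<Longrightarrow> X $$ (i, i) = 1"
    and A: "\<And>i j. i < n \<Longrightarrow> j < n \<Longrightarrow> A i j = (if i = j then 0 else X $$ (i, j))"
  shows "(\<Sum>i<n. (\<Sum>j<n. A i j * y j)\<^sup>2) \<le> (1 + alpha_spec X)\<^sup>2 * (\<Sum>j<n. (y j)\<^sup>2)"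
proof -
  have "(\<Sum>j<n. A i j * y j) = (\<Sum>j<n. X $$ (i, j) * y j) + (- 1) * y i" if "i < n" for i
  proof -
    have "(\<Sum>j<n. A i j * y j) = (\<Sum>j<n. X $$ (i, j) * y j + (if i = j then - y i else 0))"
      using that by (intro sum.cong refl) (auto simp: A diag)
    then show ?thesis using that by (simp add: sum.distrib)
  qed
  then have "L2_set (\<lambda>i. \<Sum>j<n. A i j * y j) {..<n} =
      L2_set (\<lambda>i. (\<Sum>j<n. X $$ (i, j) * y j) + (- 1) * y i) {..<n}"
    by (intro L2_set_cong) auto
  also have "\<dots> \<le> L2_set (\<lambda>i. \<Sum>j<n. X $$ (i, j) * y j) {..<n} + L2_set (\<lambda>i. (- 1) * y i) {..<n}"
    by (rule L2_set_triangle_ineq)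
  also have "L2_set (\<lambda>i. (- 1) * y i) {..<n} = L2_set y {..<n}"
    by (simp add: L2_set_def)
  also have "L2_set (\<lambda>i. \<Sum>j<n. X $$ (i, j) * y j) {..<n} + L2_set y {..<n} \<le>
      (1 + alpha_spec X) * L2_set y {..<n}"
    using alpha_spec_bounds(1)[OF X n, of y] by (simp add: algebra_simps)
  finally have "(L2_set (\<lambda>i. \<Sum>j<n. A i j * y j) {..<n})\<^sup>2 \<le> ((1 + alpha_spec X) * L2_set y {..<n})\<^sup>2"
    by (intro power_mono L2_set_nonneg)
  then show ?thesis
    by (simp add: L2_set_def sum_nonneg power_mult_distrib)
qed

section \<open>Positive semidefiniteness\<close>

lemma gram4_swap:
  "gram4 a b f e d c = gram4 a b c d e f" "gram4 a b e f c d = gram4 a b c d e f"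
  by (simp_all add: gram4_def algebra_simps)

lemma err4_swap:
  "err4 a b f e d c = err4 a b c d e f" "err4 a b e f c d = err4 a b c d e f"
  by (simp_all add: err4_def algebra_simps)

lemma gram_form_nonneg:
  fixes c :: "'a \<Rightarrow> real" and u :: "'a \<Rightarrow> 'b \<Rightarrow> real"
  shows "0 \<le> (\<Sum>x\<in>I. \<Sum>y\<in>I. c x * c y * (\<Sum>w\<in>J. u x w * u y w))"
proof -
  have "(\<Sum>x\<in>I. \<Sum>y\<in>I. c x * c y * (\<Sum>w\<in>J. u x w * u y w)) =
      (\<Sum>x\<in>I. \<Sum>y\<in>I. \<Sum>w\<in>J. (c x * u x w) * (c y * u y w))"
    by (simp add: sum_distrib_left mult_ac)
  also have "\<dots> = (\<Sum>x\<in>I. \<Sum>w\<in>J. \<Sum>y\<in>I. (c x * u x w) * (c y * u y w))"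
    by (rule sum.cong[OF refl sum.swap])
  also have "\<dots> = (\<Sum>w\<in>J. (\<Sum>x\<in>I. c x * u x w)\<^sup>2)"
    by (subst sum.swap) (simp add: power2_eq_square sum_product)
  finally show ?thesis
    by (simp add: sum_nonneg)
qed

definition pairs :: "nat \<Rightarrow> nat set set" where
  "pairs n = {S. S \<subseteq> {..<n} \<and> card S = 2}"

lemma finite_pairs: "finite (pairs n)"
  by (rule finite_subset[of _ "Pow {..<n}"]) (auto simp: pairs_def)

lemma sum_pairs:
  fixes f :: "nat set \<Rightarrow> real"
  shows "2 * (\<Sum>S\<in>pairs n. f S) = (\<Sum>i<n. \<Sum>j<n. if i = j then 0 else f {i, j})"
proof -
  let ?O = "{x \<in> {..<n} \<times> {..<n}. fst x \<noteq> snd x}" and ?h = "\<lambda>x. {fst x, snd x}"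
  have "(\<Sum>i<n. \<Sum>j<n. if i = j then 0 else f {i, j}) = (\<Sum>x\<in>{..<n} \<times> {..<n}. if fst x \<noteq> snd x then f (?h x) else 0)"
    by (simp add: sum.cartesian_product split_beta if_distrib) (auto intro: sum.cong)
  also have "\<dots> = (\<Sum>x\<in>?O. f (?h x))"
    by (rule sum.inter_filter[symmetric]) simp
  also have "\<dots> = (\<Sum>S\<in>pairs n. \<Sum>x\<in>{x \<in> ?O. ?h x = S}. f (?h x))"
    by (rule sum.group[symmetric]) (auto simp: finite_pairs pairs_def)
  also have "\<dots> = (\<Sum>S\<in>pairs n. 2 * f S)"
  proof (rule sum.cong)
    fix S assume "S \<in> pairs n"
    then obtain a b where S: "S = {a, b}" "a \<noteq> b" "a < n" "b < n"
      by (auto simp: pairs_def card_2_iff)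
    have "{x \<in> ?O. ?h x = S} = {(a, b), (b, a)}"
      using S by (auto simp: doubleton_eq_iff)
    then show "(\<Sum>x\<in>{x \<in> ?O. ?h x = S}. f (?h x)) = 2 * f S"
      using S by (simp add: insert_commute)
  qed simp
  finally show ?thesis
    by (simp add: sum_distrib_left)
qed

lemma sum_small_subsets:
  fixes f :: "nat set \<Rightarrow> real"
  shows "(\<Sum>S\<in>small_subsets n. f S) = f {} + (\<Sum>i<n. f {i}) + (\<Sum>S\<in>pairs n. f S)"
proof -
  have eq: "small_subsets n = ({{}} \<union> (\<lambda>i. {i}) ` {..<n}) \<union> pairs n"
  proof (intro equalityI subsetI)
    fix S assume S: "S \<in> small_subsets n"
    then have fin: "finite S" and sub: "S \<subseteq> {..<n}"
      using finite_subset by (auto simp: small_subsets_def)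
    have "card S = 0 \<or> card S = 1 \<or> card S = 2"
      using S by (auto simp: small_subsets_def)
    then show "S \<in> ({{}} \<union> (\<lambda>i. {i}) ` {..<n}) \<union> pairs n"
      using sub fin by (auto simp: pairs_def card_1_singleton_iff)
  qed (auto simp: small_subsets_def pairs_def)
  have "(\<Sum>S\<in>small_subsets n. f S) = (\<Sum>S\<in>{{}} \<union> (\<lambda>i. {i}) ` {..<n}. f S) + (\<Sum>S\<in>pairs n. f S)"
    unfolding eq by (rule sum.union_disjoint) (auto simp: finite_pairs pairs_def)
  also have "(\<Sum>S\<in>{{}} \<union> (\<lambda>i. {i}) ` {..<n}. f S) = f {} + (\<Sum>S\<in>(\<lambda>i. {i}) ` {..<n}. f S)"
    by (subst sum.union_disjoint) auto
  also have "(\<Sum>S\<in>(\<lambda>i. {i}) ` {..<n}. f S) = (\<Sum>i<n. f {i})"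
    by (simp add: sum.reindex)
  finally show ?thesis .
qed

lemma odd_card_sym_diff:
  assumes "finite S" "finite T" "odd (card S + card T)"
  shows "odd (card (sym_diff S T))"
proof -
  have "card (sym_diff S T) = card (S - T) + card (T - S)"
    using assms by (intro card_Un_disjoint) auto
  moreover have "(S - T) \<inter> (S \<inter> T) = {}" "(T - S) \<inter> (S \<inter> T) = {}"
    by auto
  moreover from this have "card S = card (S - T) + card (S \<inter> T)"
    using assms card_Un_disjoint[of "S - T" "S \<inter> T"] by (simp add: Un_Diff_Int)
  moreover from calculation have "card T = card (T - S) + card (S \<inter> T)"
    using assms card_Un_disjoint[of "T - S" "S \<inter> T"] by (simp add: Un_Diff_Int Int_commute[of S])
  ultimately show ?thesis
    using assms(3) by presburger
qed

text \<open>The test vector \<open>v\<close> is a parameter so that the estimates of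
  \<open>error_bound\<close> apply to the matrix of its coefficients on pairs.\<close>

locale moment_setup =
  fixes n :: nat and X M :: "real mat" and v :: "nat set \<Rightarrow> real"
  assumes n: "n \<ge> 1" and X: "X \<in> carrier_mat n n" and M: "M \<in> carrier_mat n n"
    and psd: "psd_mat X" and diag: "\<And>i. i < n \<Longrightarrow> X $$ (i, i) = 1" and XM: "X = M * transpose_mat M"
begin

text \<open>Extended by zero because \<open>error_bound\<close> bounds entries and rows at all
  indices, without range conditions.\<close>

definition x :: "nat \<Rightarrow> nat \<Rightarrow> real" where
  "x i j = (if i < n \<and> j < n then X $$ (i, j) else 0)"

definition A :: "nat \<Rightarrow> nat \<Rightarrow> real" where
  "A i j = (if i = j then 0 else x i j)"

definition V :: "nat \<Rightarrow> nat \<Rightarrow> real" where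
  "V i j = (if i = j then 0 else v {i, j})"

lemma x_sum: "i < n \<Longrightarrow> j < n \<Longrightarrow> x i j = (\<Sum>p<n. M $$ (i, p) * M $$ (j, p))"
  using mult_transpose_index[OF M, folded XM] by (simp add: x_def)

lemma x_sym: "x i j = x j i"
  using x_sum[of i j] x_sum[of j i] by (cases "i < n \<and> j < n") (auto simp: x_def mult.commute)

lemma x_diag: "i < n \<Longrightarrow> x i i = 1"
  by (simp add: x_def diag)

lemma x_le_1: "\<bar>x i j\<bar> \<le> 1"
proof (cases "i < n \<and> j < n")
  case True
  then have "(x i j)\<^sup>2 \<le> (\<Sum>p<n. (M $$ (i, p))\<^sup>2) * (\<Sum>p<n. (M $$ (j, p))\<^sup>2)"
    unfolding x_sum[OF conjunct1[OF True] conjunct2[OF True]] by (intro Cauchy_Schwarz_ineq_sum)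
  also have "\<dots> = x i i * x j j"
    using True by (simp add: x_sum power2_eq_square)
  finally show ?thesis
    using True by (simp add: x_diag abs_square_le_1)
qed (auto simp: x_def)

sublocale error_bound n A V "alpha_mag X" "alpha_row X" "1 + alpha_spec X"
proof
  note mag = alpha_mag_bounds[OF X]
  have le1: "\<bar>X $$ (i, j)\<bar> \<le> 1" if "i < n" "j < n" for i j
    using x_le_1[of i j] that by (simp add: x_def)
  fix i j :: nat and y :: "nat \<Rightarrow> real"
  show "A i j = A j i" by (simp add: A_def x_sym)
  show "V i j = V j i" by (simp add: V_def insert_commute)
  show "V i i = 0" by (simp add: V_def)
  show "\<bar>A i j\<bar> \<le> alpha_mag X"
    using mag[OF le1] by (auto simp: A_def x_def)
  show "alpha_mag X \<le> 1"
    using mag[OF le1] by simp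
  show "0 \<le> alpha_row X" by (rule alpha_row_bounds[OF X n])
  show "0 \<le> 1 + alpha_spec X" using alpha_spec_bounds(2)[OF X n] by simp
  show "(\<Sum>j<n. (A i j)\<^sup>2) \<le> (alpha_row X)\<^sup>2"
  proof (cases "i < n")
    case True
    have "(\<Sum>j<n. (A i j)\<^sup>2) = (\<Sum>j\<in>{..<n} - {i}. (A i j)\<^sup>2)"
      by (intro sum.mono_neutral_right) (auto simp: A_def)
    also have "\<dots> = (\<Sum>j\<in>{..<n} - {i}. (X $$ (i, j))\<^sup>2)"
      using True by (intro sum.cong) (auto simp: A_def x_def)
    also have "\<dots> \<le> (alpha_row X)\<^sup>2"
      by (rule alpha_row_bounds(1)[OF X n True])
    finally show ?thesis .
  qed (simp add: A_def x_def)
  show "(\<Sum>i<n. (\<Sum>j<n. A i j * y j)\<^sup>2) \<le> (1 + alpha_spec X)\<^sup>2 * (\<Sum>j<n. (y j)\<^sup>2)"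
    by (rule spectral_offdiagonal[OF X n diag]) (auto simp: A_def x_def)
qed

abbreviation m :: "nat set \<Rightarrow> nat set \<Rightarrow> real" where
  "m S T \<equiv> limit_moment M (sym_diff S T)"

lemma limit_moment_pair: "i < n \<Longrightarrow> j < n \<Longrightarrow> i \<noteq> j \<Longrightarrow> limit_moment M {i, j} = moment2 (x i j)"
  using limit_moment_2[OF M, folded XM, of i j] diag by (simp add: x_def)

definition gram :: "nat \<Rightarrow> nat \<Rightarrow> nat \<Rightarrow> nat \<Rightarrow> real" where
  "gram i j k l = gram4 (x i j) (x k l) (x i k) (x j l) (x i l) (x j k)"

definition err :: "nat \<Rightarrow> nat \<Rightarrow> nat \<Rightarrow> nat \<Rightarrow> real" where
  "err i j k l = m {i, j} {k, l} - moment2 (x i j) * moment2 (x k l) - gram i j k l"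

text \<open>\<open>gram\<close> keeps the unit diagonal of \<open>x\<close>, whereas
  \<open>err4\<close> is evaluated at \<open>A\<close> with zero diagonal, since its bound requires
  every entry to be small. Hence this difference vanishes for distinct indices and collects
  precisely what happens at overlaps.\<close>

definition rest :: "nat \<Rightarrow> nat \<Rightarrow> nat \<Rightarrow> nat \<Rightarrow> real" where
  "rest i j k l = err i j k l - err4 (A i j) (A k l) (A i k) (A j l) (A i l) (A j k)"

lemma rest_swap12: "rest j i k l = rest i j k l"
proof -
  have "gram j i k l = gram i j k l"
    unfolding gram_def x_sym[of j i] by (rule gram4_swap)
  moreover have "err4 (A j i) (A k l) (A j k) (A i l) (A j l) (A i k) =
      err4 (A i j) (A k l) (A i k) (A j l) (A i l) (A j k)"
    unfolding A_sym[of j i] by (rule err4_swap)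
  ultimately show ?thesis
    by (simp add: rest_def err_def insert_commute x_sym[of j i])
qed

lemma rest_swap34: "rest i j l k = rest i j k l"
proof -
  have "gram i j l k = gram i j k l"
    unfolding gram_def x_sym[of l k] by (rule gram4_swap)
  moreover have "err4 (A i j) (A l k) (A i l) (A j k) (A i k) (A j l) =
      err4 (A i j) (A k l) (A i k) (A j l) (A i l) (A j k)"
    unfolding A_sym[of l k] by (rule err4_swap)
  ultimately show ?thesis
    by (simp add: rest_def err_def insert_commute x_sym[of l k])
qed

lemma rest_same_first:
  assumes "i < n" "j < n" "l < n" "i \<noteq> j" "i \<noteq> l"
  shows "\<bar>rest i j i l\<bar> \<le> 40 * alpha_mag X * overlap i j l"
proof (cases "j = l")
  case True
  have "rest i j i l = 1 - moment2 (A i j) * moment2 (A i j) - gram4 (A i j) (A i j) 1 1 (A i j) (A i j)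
      - err4 (A i j) (A i j) 0 0 (A i j) (A i j)"
    using True assms by (simp add: rest_def err_def gram_def limit_moment_empty A_def x_diag x_sym)
  then have "\<bar>rest i j i l\<bar> \<le> 40 * alpha_mag X * 1"
    using diagonal_remainder[OF A_le] by simp
  also have "\<dots> \<le> 40 * alpha_mag X * overlap i j l"
    using True \<mu>_nonneg by (intro mult_left_mono) (auto simp: overlap_def)
  finally show ?thesis .
next
  case False
  have sd: "sym_diff {i, j} {i, l} = {j, l}"
    using False assms by auto
  have "rest i j i l = moment2 (A j l) - moment2 (A i j) * moment2 (A i l)
      - gram4 (A i j) (A i l) 1 (A j l) (A i l) (A i j) - err4 (A i j) (A i l) 0 (A j l) (A i l) (A i j)"
    unfolding rest_def err_def gram_def sd using False assms
    by (simp add: limit_moment_pair A_def x_diag x_sym[of j i])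
  then have "\<bar>rest i j i l\<bar> \<le> 40 * alpha_mag X * ((A j l)\<^sup>2 + \<bar>A i j * A j l\<bar> + \<bar>A i l * A j l\<bar> + \<bar>A i j * A i l\<bar>)"
    using overlap_remainder[OF A_le A_le A_le] by simp
  then show ?thesis
    using False by (simp add: overlap_def)
qed

lemma rest_bound:
  assumes "i < n" "j < n" "k < n" "l < n" "i \<noteq> j" "k \<noteq> l"
  shows "\<bar>rest i j k l\<bar> \<le> 40 * alpha_mag X * overlaps i j k l"
proof -
  have ov: "40 * alpha_mag X * overlap a b c \<le> 40 * alpha_mag X * overlaps i j k l"
    if "overlap a b c \<le> overlaps i j k l" for a b c
    using that \<mu>_nonneg by (intro mult_left_mono) auto
  consider "i = k" | "i = l" | "j = k" | "j = l" | "distinct [i, j, k, l]"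
    using assms by auto
  then show ?thesis
  proof cases
    case 1
    then show ?thesis
      using rest_same_first[of i j l] assms overlap_nonneg
      by (intro order.trans[OF _ ov[of i j l]]) (auto simp: overlaps_def)
  next
    case 2
    then show ?thesis
      using rest_same_first[of i j k] assms overlap_nonneg rest_swap34[of i j i k]
      by (intro order.trans[OF _ ov[of i j k]]) (auto simp: overlaps_def)
  next
    case 3
    then show ?thesis
      using rest_same_first[of j i l] assms overlap_nonneg rest_swap12[of j i j l]
      by (intro order.trans[OF _ ov[of j i l]]) (auto simp: overlaps_def)
  next
    case 4
    then show ?thesis
      using rest_same_first[of j i k] assms overlap_nonneg rest_swap12[of j i k j] rest_swap34[of j i j k]
      by (intro order.trans[OF _ ov[of j i k]]) (auto simp: overlaps_def)
  next
    case 5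
    have "sym_diff {i, j} {k, l} = {i, j, k, l}"
      using 5 by auto
    then have "rest i j k l = 0"
      using limit_moment_4[OF M, folded XM, OF diag assms(1-4) 5] 5 assms
      by (simp add: rest_def err_def gram_def A_def x_def)
    then show ?thesis
      using \<mu>_nonneg overlap_nonneg by (simp add: overlaps_def)
  qed
qed

lemma bnd_err: "bnd (909 * \<gamma>) err"
proof -
  have "bnd (4 * (40 * alpha_mag X) * (4 * (alpha_row X)\<^sup>2 + 1)) rest"
    using \<mu>_nonneg by (intro bnd_overlaps rest_bound) auto
  \<comment> \<open>800 = 4 * 40 * (4 + 1), as both
    \<open>alpha_mag X * (alpha_row X)\<^sup>2\<close> and \<open>alpha_mag X\<close> are at most
    \<open>\<gamma>\<close>. Together with the 109 of \<open>bnd_err4\<close> this gives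
    909.\<close>
  moreover have "4 * (40 * alpha_mag X) * (4 * (alpha_row X)\<^sup>2 + 1) \<le> 800 * \<gamma>"
  proof -
    have "alpha_mag X * (alpha_row X)\<^sup>2 * 1 \<le> \<gamma>"
      using \<mu>_nonneg \<rho>_le \<sigma>_le by (intro le_\<gamma>) auto
    moreover have "alpha_mag X * 1 * 1 \<le> \<gamma>"
      using \<mu>_nonneg \<rho>_le \<sigma>_le by (intro le_\<gamma>) auto
    ultimately show ?thesis by (simp add: algebra_simps)
  qed
  ultimately have "bnd (800 * \<gamma>) rest"
    by (rule bnd_mono)
  from bnd_add[OF bnd_err4 this] have "bnd (909 * \<gamma>)
      (\<lambda>i j k l. err4 (A i j) (A k l) (A i k) (A j l) (A i l) (A j k) + rest i j k l)"
    by (simp add: distrib_right[symmetric])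
  then show ?thesis
    by (rule bnd_cong) (simp add: rest_def)
qed

section \<open>The Gram part on pairs\<close>

definition ip :: "(nat \<Rightarrow> nat \<Rightarrow> real) \<Rightarrow> (nat \<Rightarrow> nat \<Rightarrow> real) \<Rightarrow> real" where
  "ip f g = (\<Sum>p<n. \<Sum>q<n. f p q * g p q)"

definition outer :: "nat \<Rightarrow> nat \<Rightarrow> nat \<Rightarrow> nat \<Rightarrow> real" where
  "outer i j p q = M $$ (i, p) * M $$ (j, q)"

lemma ip_linear:
  "ip (\<lambda>p q. f p q + g p q) h = ip f h + ip g h" "ip h (\<lambda>p q. f p q + g p q) = ip h f + ip h g"
  "ip (\<lambda>p q. f p q - g p q) h = ip f h - ip g h" "ip h (\<lambda>p q. f p q - g p q) = ip h f - ip h g"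
  "ip (\<lambda>p q. c * f p q) h = c * ip f h" "ip h (\<lambda>p q. c * f p q) = c * ip h f"
  by (simp_all add: ip_def algebra_simps sum.distrib sum_subtractf sum_distrib_left)

lemma ip_outer:
  assumes "a < n" "b < n" "c < n" "d < n"
  shows "ip (outer a b) (outer c d) = x a c * x b d"
  using assms by (simp add: ip_def outer_def x_sum sum_product mult_ac)

text \<open>
  The vectors \<open>m\<^sub>i m\<^sub>j\<^sup>T + m\<^sub>j m\<^sub>i\<^sup>T\<close> approximately projected away from the
  pairwise almost orthogonal unit vectors \<open>m\<^sub>a m\<^sub>a\<^sup>T\<close>, where \<open>m\<^sub>i\<close> is row \<open>i\<close> of \<open>M\<close>.
\<close>

definition proj :: "nat \<Rightarrow> nat \<Rightarrow> nat \<Rightarrow> nat \<Rightarrow> real" where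
  "proj i j = (\<lambda>p q. outer i j p q + outer j i p q - (2 * x i j) * (outer i i p q + outer j j p q))"

lemma ip_proj:
  assumes "i < n" "j < n" "k < n" "l < n"
  shows "ip (proj i j) (proj k l) = 2 * gram i j k l"
  unfolding proj_def ip_linear ip_outer[OF assms(1) assms(1) assms(3) assms(3)] gram_def gram4_def
  using assms by (simp add: ip_outer x_sym algebra_simps power2_eq_square)

lemma form_gram_nonneg: "0 \<le> form gram"
proof -
  let ?I = "{..<n} \<times> {..<n}"
  have "0 \<le> (\<Sum>a\<in>?I. \<Sum>b\<in>?I. V (fst a) (snd a) * V (fst b) (snd b) *
      (\<Sum>w\<in>?I. proj (fst a) (snd a) (fst w) (snd w) * proj (fst b) (snd b) (fst w) (snd w)))"
    by (rule gram_form_nonneg)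
  also have "\<dots> = (\<Sum>a\<in>?I. \<Sum>b\<in>?I. V (fst a) (snd a) * V (fst b) (snd b) *
      (2 * gram (fst a) (snd a) (fst b) (snd b)))"
  proof (intro sum.cong refl)
    fix a b assume "a \<in> ?I" "b \<in> ?I"
    then have "(\<Sum>w\<in>?I. proj (fst a) (snd a) (fst w) (snd w) * proj (fst b) (snd b) (fst w) (snd w)) =
        2 * gram (fst a) (snd a) (fst b) (snd b)"
      by (subst ip_proj[symmetric]) (auto simp: ip_def sum.cartesian_product split_beta)
    then show "V (fst a) (snd a) * V (fst b) (snd b) *
      (\<Sum>w\<in>?I. proj (fst a) (snd a) (fst w) (snd w) * proj (fst b) (snd b) (fst w) (snd w)) =
      V (fst a) (snd a) * V (fst b) (snd b) * (2 * gram (fst a) (snd a) (fst b) (snd b))" by simp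
  qed
  also have "\<dots> = form (\<lambda>i j k l. 2 * gram i j k l)"
    by (simp add: form_def sum.cartesian_product')
  also have "\<dots> = 2 * form gram"
    by (simp add: form_def sum_distrib_left mult_ac)
  finally show ?thesis by simp
qed

section \<open>Combination of the blocks\<close>

definition P :: real where
  "P = (\<Sum>S\<in>pairs n. v S * limit_moment M S)"

text \<open>The factor 4 arises because each of the two sums over sets becomes a sum over ordered
  pairs.\<close>

lemma pair_block:
  "4 * (\<Sum>S\<in>pairs n. \<Sum>T\<in>pairs n. v S * m S T * v T) = 4 * P\<^sup>2 + form gram + form err"
proof -
  have inner: "2 * (\<Sum>T\<in>pairs n. v S * m S T * v T) = (\<Sum>k<n. \<Sum>l<n. v S * m S {k, l} * V k l)" for S
    unfolding sum_pairs by (intro sum.cong refl) (simp add: V_def)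
  have "4 * (\<Sum>S\<in>pairs n. \<Sum>T\<in>pairs n. v S * m S T * v T) =
      2 * (\<Sum>S\<in>pairs n. 2 * (\<Sum>T\<in>pairs n. v S * m S T * v T))"
    by (simp add: sum_distrib_left)
  also have "\<dots> = 2 * (\<Sum>S\<in>pairs n. \<Sum>k<n. \<Sum>l<n. v S * m S {k, l} * V k l)"
    by (simp only: inner)
  also have "\<dots> = (\<Sum>i<n. \<Sum>j<n. \<Sum>k<n. \<Sum>l<n. V i j * V k l * m {i, j} {k, l})"
    unfolding sum_pairs by (intro sum.cong refl) (simp add: V_def mult_ac)
  also have "\<dots> = form (\<lambda>i j k l. moment2 (x i j) * moment2 (x k l)) + form gram + form err"
    unfolding form_def sum.distrib[symmetric]
    by (intro sum.cong refl) (simp add: err_def algebra_simps)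
  also have "form (\<lambda>i j k l. moment2 (x i j) * moment2 (x k l)) =
      (\<Sum>i<n. \<Sum>j<n. V i j * moment2 (x i j)) * (\<Sum>k<n. \<Sum>l<n. V k l * moment2 (x k l))"
    by (simp only: form_def sum_distrib_right, simp only: sum_distrib_left, intro sum.cong refl)
      (simp add: mult_ac)
  also have "(\<Sum>i<n. \<Sum>j<n. V i j * moment2 (x i j)) = 2 * P"
    unfolding P_def sum_pairs by (intro sum.cong refl) (auto simp: V_def limit_moment_pair)
  finally show ?thesis
    by (simp add: power2_eq_square)
qed

lemma fro_V: "fro V = 2 * (\<Sum>S\<in>pairs n. (v S)\<^sup>2)"
  unfolding sum_pairs fro_def by (intro sum.cong refl) (simp add: V_def)

text \<open>X itself contributes a nonnegative form. For the cubes of the off-diagonal entries a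
  Schur test suffices: one factor pays for \<open>alpha_mag X\<close>, and the remaining square is
  summed along the row.\<close>

lemma single_block:
  "- \<gamma> * (\<Sum>i<n. (v {i})\<^sup>2) \<le> (\<Sum>i<n. \<Sum>j<n. v {i} * m {i} {j} * v {j})"
proof -
  have mij: "m {i} {j} = x i j + 2/3 * (A i j) ^ 3" if "i < n" "j < n" for i j
  proof (cases "i = j")
    case False
    then have "sym_diff {i} {j} = {i, j}" by auto
    with False show ?thesis
      using that by (simp add: limit_moment_pair moment2_def A_def)
  qed (use that in \<open>simp add: limit_moment_empty A_def x_diag\<close>)
  have "(\<Sum>i<n. \<Sum>j<n. v {i} * m {i} {j} * v {j}) =
     (\<Sum>i<n. \<Sum>j<n. v {i} * x i j * v {j} + 2/3 * (v {i} * v {j} * (A i j) ^ 3))"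
    by (intro sum.cong refl) (simp add: mij algebra_simps)
  also have "\<dots> = (\<Sum>i<n. \<Sum>j<n. v {i} * x i j * v {j}) + 2/3 * (\<Sum>i<n. \<Sum>j<n. v {i} * v {j} * (A i j) ^ 3)"
    by (simp only: sum.distrib sum_distrib_left)
  finally have eq: "(\<Sum>i<n. \<Sum>j<n. v {i} * m {i} {j} * v {j}) = \<dots>" .
  have "(\<Sum>i<n. \<Sum>j<n. v {i} * x i j * v {j}) = (\<Sum>i<n. \<Sum>j<n. v {i} * X $$ (i, j) * v {j})"
    by (intro sum.cong refl) (simp add: x_def)
  then have nonneg: "0 \<le> (\<Sum>i<n. \<Sum>j<n. v {i} * x i j * v {j})"
    using psd X unfolding psd_mat_def psd_on_def by auto
  let ?N = "\<Sum>i<n. (v {i})\<^sup>2"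
  have "\<bar>\<Sum>i<n. \<Sum>j<n. v {i} * v {j} * (A i j) ^ 3\<bar> \<le>
     (\<Sum>i<n. \<Sum>j<n. alpha_mag X / 2 * ((v {i})\<^sup>2 * (A i j)\<^sup>2) + alpha_mag X / 2 * ((v {j})\<^sup>2 * (A i j)\<^sup>2))"
  proof (intro order.trans[OF sum_abs] sum_mono)
    fix i j
    have "\<bar>v {i}\<bar> * \<bar>v {j}\<bar> \<le> ((v {i})\<^sup>2 + (v {j})\<^sup>2) / 2"
      using sum_squares_bound[of "\<bar>v {i}\<bar>" "\<bar>v {j}\<bar>"] by simp
    moreover have "\<bar>(A i j) ^ 3\<bar> \<le> alpha_mag X * (A i j)\<^sup>2"
      using mult_right_mono[OF A_le, of "(A i j)\<^sup>2" i j] by (simp add: power3_eq_cube power2_eq_square abs_mult)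
    ultimately have "\<bar>v {i} * v {j} * (A i j) ^ 3\<bar> \<le> ((v {i})\<^sup>2 + (v {j})\<^sup>2) / 2 * (alpha_mag X * (A i j)\<^sup>2)"
      unfolding abs_mult[of "v {i} * v {j}"] abs_mult[of "v {i}" "v {j}"] by (intro mult_mono) auto
    then show "\<bar>v {i} * v {j} * (A i j) ^ 3\<bar> \<le>
       alpha_mag X / 2 * ((v {i})\<^sup>2 * (A i j)\<^sup>2) + alpha_mag X / 2 * ((v {j})\<^sup>2 * (A i j)\<^sup>2)"
      by (simp add: field_simps)
  qed
  also have "\<dots> = alpha_mag X / 2 * (\<Sum>i<n. \<Sum>j<n. (v {i})\<^sup>2 * (A i j)\<^sup>2)
      + alpha_mag X / 2 * (\<Sum>i<n. \<Sum>j<n. (v {j})\<^sup>2 * (A i j)\<^sup>2)"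
    by (simp only: sum.distrib sum_distrib_left)
  also have "(\<Sum>i<n. \<Sum>j<n. (v {j})\<^sup>2 * (A i j)\<^sup>2) = (\<Sum>j<n. \<Sum>i<n. (v {j})\<^sup>2 * (A i j)\<^sup>2)"
    by (rule sum.swap)
  also have "\<dots> = (\<Sum>i<n. \<Sum>j<n. (v {i})\<^sup>2 * (A i j)\<^sup>2)"
    by (intro sum.cong refl) (simp add: A_sym)
  also have "alpha_mag X / 2 * (\<Sum>i<n. \<Sum>j<n. (v {i})\<^sup>2 * (A i j)\<^sup>2) + alpha_mag X / 2 * (\<Sum>i<n. \<Sum>j<n. (v {i})\<^sup>2 * (A i j)\<^sup>2)
     = alpha_mag X * (\<Sum>i<n. (v {i})\<^sup>2 * (\<Sum>j<n. (A i j)\<^sup>2))"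
    by (simp add: sum_distrib_left[symmetric])
  also have "\<dots> \<le> alpha_mag X * (\<Sum>i<n. (v {i})\<^sup>2 * (alpha_row X)\<^sup>2)"
    using \<mu>_nonneg by (intro mult_left_mono sum_mono row) auto
  also have "\<dots> = (alpha_mag X * (alpha_row X)\<^sup>2 * 1) * ?N"
    by (simp add: sum_distrib_left mult_ac)
  also have "\<dots> \<le> \<gamma> * ?N"
    using \<mu>_nonneg \<rho>_le \<sigma>_le by (intro mult_right_mono le_\<gamma> sum_nonneg) auto
  finally have "\<bar>\<Sum>i<n. \<Sum>j<n. v {i} * v {j} * (A i j) ^ 3\<bar> \<le> \<gamma> * ?N" .
  moreover have "0 \<le> \<gamma> * ?N"
    using \<gamma>_nonneg by (intro mult_nonneg_nonneg sum_nonneg) auto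
  ultimately show ?thesis
    unfolding eq using nonneg by simp
qed

text \<open>Parity separates the singletons from the empty set and the pairs. On the latter, the
  rank-one part of the pair block and the row of the empty set complete to the square of
  \<open>v {} + P\<close>. The constant 455 rounds up 909 / 2, from the factor 4 in
  \<open>pair_block\<close> and the factor 2 in \<open>fro_V\<close>.\<close>

lemma moment_form_lower:
  "- (455 * \<gamma>) * (\<Sum>S\<in>small_subsets n. (v S)\<^sup>2) \<le>
    (\<Sum>S\<in>small_subsets n. \<Sum>T\<in>small_subsets n. v S * m S T * v T)"
proof -
  have fin: "finite S" if "S \<in> pairs n" for S
    using that finite_subset by (auto simp: pairs_def)
  have z1: "limit_moment M {i} = 0" for i :: nat
    by (rule limit_moment_odd) simp
  have z2: "m {i} S = 0" "m S {i} = 0" if "S \<in> pairs n" for i S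
    by (rule limit_moment_odd[OF odd_card_sym_diff]; use that fin[OF that] in \<open>simp add: pairs_def\<close>)+
  let ?S1 = "\<Sum>i<n. \<Sum>j<n. v {i} * m {i} {j} * v {j}"
  let ?S2 = "\<Sum>S\<in>pairs n. \<Sum>T\<in>pairs n. v S * m S T * v T"
  have "(\<Sum>S\<in>small_subsets n. \<Sum>T\<in>small_subsets n. v S * m S T * v T) =
     (v {})\<^sup>2 + v {} * P + v {} * P + ?S1 + ?S2"
    unfolding sum_small_subsets
    by (simp add: z1 z2 limit_moment_empty sum.distrib P_def sum_distrib_left power2_eq_square mult_ac)
  moreover have "4 * ?S2 \<ge> 4 * P\<^sup>2 - 909 * \<gamma> * fro V"
    using pair_block form_gram_nonneg bnd_err unfolding bnd_def by linarith
  moreover have "0 \<le> (v {} + P)\<^sup>2"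
    by simp
  moreover have "(v {} + P)\<^sup>2 = (v {})\<^sup>2 + v {} * P + v {} * P + P\<^sup>2"
    by (simp add: power2_eq_square algebra_simps)
  moreover have "909 * \<gamma> * fro V = 1818 * (\<gamma> * (\<Sum>S\<in>pairs n. (v S)\<^sup>2))"
    by (simp add: fro_V)
  moreover have "0 \<le> \<gamma> * (\<Sum>S\<in>pairs n. (v S)\<^sup>2)" "0 \<le> \<gamma> * (\<Sum>i<n. (v {i})\<^sup>2)" "0 \<le> \<gamma> * (v {})\<^sup>2"
    using \<gamma>_nonneg by (auto intro!: mult_nonneg_nonneg sum_nonneg)
  moreover have "(455 * \<gamma>) * (\<Sum>S\<in>small_subsets n. (v S)\<^sup>2) = 455 * (\<gamma> * (v {})\<^sup>2)
     + 455 * (\<gamma> * (\<Sum>i<n. (v {i})\<^sup>2)) + 455 * (\<gamma> * (\<Sum>S\<in>pairs n. (v S)\<^sup>2))"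
    by (simp add: sum_small_subsets distrib_left)
  moreover have "- (\<gamma> * (\<Sum>i<n. (v {i})\<^sup>2)) \<le> ?S1"
    using single_block by simp
  ultimately show ?thesis
    by linarith
qed

text \<open>In \<open>\<gamma>\<close> the spectral constant is \<open>1 + alpha_spec X\<close>.
  Replacing it by \<open>alpha_spec X\<close> costs a factor 3, and 3 * 455 = 1365 is below
  1500.\<close>

lemma \<gamma>_le: "455 * \<gamma> \<le> 1500 * alpha_mag X * (1 + alpha_row X ^ 4) * (1 + (alpha_spec X)\<^sup>2)"
proof -
  define B where "B = alpha_mag X * (1 + alpha_row X ^ 4) * (1 + (alpha_spec X)\<^sup>2)"
  have eq: "3 * (1 + (alpha_spec X)\<^sup>2) - (1 + (1 + alpha_spec X)\<^sup>2) = (alpha_spec X - 1)\<^sup>2 + (alpha_spec X)\<^sup>2"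
    by (simp add: power2_eq_square algebra_simps)
  have "0 \<le> 3 * (1 + (alpha_spec X)\<^sup>2) - (1 + (1 + alpha_spec X)\<^sup>2)"
    unfolding eq by simp
  then have "1 + (1 + alpha_spec X)\<^sup>2 \<le> 3 * (1 + (alpha_spec X)\<^sup>2)"
    by (rule diff_ge_0_iff_ge[THEN iffD1])
  then have "\<gamma> \<le> alpha_mag X * (1 + alpha_row X ^ 4) * (3 * (1 + (alpha_spec X)\<^sup>2))"
    unfolding \<gamma>_def using \<mu>_nonneg by (intro mult_left_mono) auto
  also have "\<dots> = 3 * B"
    by (simp only: B_def mult_ac)
  finally have "\<gamma> \<le> 3 * B" .
  moreover have "0 \<le> B"
    unfolding B_def using \<mu>_nonneg by (intro mult_nonneg_nonneg) auto
  ultimately have "455 * \<gamma> \<le> 1500 * B"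
    by linarith
  then show ?thesis
    by (simp only: B_def mult.assoc)
qed

end

theorem theorem2p4:
  "\<exists>C::real. C > 0 \<and>
     (\<forall>n::nat. n \<ge> 1 \<longrightarrow>
       (\<forall>X \<in> carrier_mat n n. \<forall>M \<in> carrier_mat n n.
          psd_mat X \<longrightarrow> (\<forall>i<n. X $$ (i, i) = 1) \<longrightarrow> X = M * transpose_mat M \<longrightarrow>
          (let \<alpha> = C * alpha_mag X * (1 + alpha_row X ^ 4) * (1 + (alpha_spec X)\<^sup>2);
               \<eta> = \<alpha> / (1 + \<alpha>)
           in psd_on (small_subsets n)
                (\<lambda>S T. (1 - \<eta>) * moment_matrix M S T + \<eta> * (if S = T then 1 else 0)))))"
proof (intro exI[of _ 1500] conjI allI ballI impI)
  fix n :: nat and X M :: "real mat"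
  assume *: "n \<ge> 1" "X \<in> carrier_mat n n" "M \<in> carrier_mat n n" "psd_mat X"
    "\<forall>i<n. X $$ (i, i) = 1" "X = M * transpose_mat M"
  define \<alpha> where "\<alpha> = 1500 * alpha_mag X * (1 + alpha_row X ^ 4) * (1 + (alpha_spec X)\<^sup>2)"
  define \<eta> where "\<eta> = \<alpha> / (1 + \<alpha>)"
  have psd: "psd_on (small_subsets n)
      (\<lambda>S T. (1 - \<eta>) * moment_matrix M S T + \<eta> * (if S = T then 1 else 0))"
    unfolding psd_on_def
  proof (intro conjI ballI allI)
    fix S T
    show "(1 - \<eta>) * moment_matrix M S T + \<eta> * (if S = T then 1 else 0) =
      (1 - \<eta>) * moment_matrix M T S + \<eta> * (if T = S then 1 else 0)"
      by (auto simp: moment_matrix_eq Un_commute)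
  next
    fix v :: "nat set \<Rightarrow> real"
    interpret moment_setup n X M v
      using * by unfold_locales auto
    let ?I = "small_subsets n"
    define Q N where "Q = (\<Sum>S\<in>?I. \<Sum>T\<in>?I. v S * m S T * v T)" and "N = (\<Sum>S\<in>?I. (v S)\<^sup>2)"
    have fin: "finite ?I"
      by (rule finite_subset[of _ "Pow {..<n}"]) (auto simp: small_subsets_def)
    have \<alpha>: "455 * \<gamma> \<le> \<alpha>" "0 \<le> \<alpha>"
      using \<gamma>_le \<gamma>_nonneg by (simp_all add: \<alpha>_def)
    have N: "0 \<le> N"
      by (simp add: N_def sum_nonneg)
    have "- (455 * \<gamma>) * N \<le> Q"
      unfolding N_def Q_def by (rule moment_form_lower)
    then have "0 \<le> Q + \<alpha> * N"
      using mult_right_mono[OF \<alpha>(1) N] by simp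
    have "(\<Sum>S\<in>?I. \<Sum>T\<in>?I. v S * ((1 - \<eta>) * moment_matrix M S T + \<eta> * (if S = T then 1 else 0)) * v T) =
       (\<Sum>S\<in>?I. \<Sum>T\<in>?I. (1 - \<eta>) * (v S * m S T * v T) + (if S = T then \<eta> * (v S)\<^sup>2 else 0))"
      by (intro sum.cong refl) (auto simp: moment_matrix_eq algebra_simps power2_eq_square)
    also have "\<dots> = (1 - \<eta>) * Q + \<eta> * N"
      by (simp add: sum.distrib fin Q_def N_def sum_distrib_left)
    also have "\<dots> = (Q + \<alpha> * N) / (1 + \<alpha>)"
    proof -
      have "1 - \<eta> = 1 / (1 + \<alpha>)"
        using \<alpha>(2) by (simp add: \<eta>_def field_simps)
      then show ?thesis
        by (simp add: \<eta>_def add_divide_distrib)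
    qed
    finally show "0 \<le> (\<Sum>S\<in>?I. \<Sum>T\<in>?I. v S * ((1 - \<eta>) * moment_matrix M S T + \<eta> * (if S = T then 1 else 0)) * v T)"
      using \<open>0 \<le> Q + \<alpha> * N\<close> \<alpha>(2) by simp
  qed
  then show "let \<alpha> = 1500 * alpha_mag X * (1 + alpha_row X ^ 4) * (1 + (alpha_spec X)\<^sup>2);
            \<eta> = \<alpha> / (1 + \<alpha>)
        in psd_on (small_subsets n)
             (\<lambda>S T. (1 - \<eta>) * moment_matrix M S T + \<eta> * (if S = T then 1 else 0))"
    by (simp only: Let_def \<eta>_def \<alpha>_def)
qed simp

end
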